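(* Let $(\mathcal B,\mathbb E,\mathfrak s)$ be a Hom-finite Krull--Schmidt extriangulated category over a field $k$ with enough projectives and enough injectives. Let $\mathcal T$ be a contravariantly finite subcategory of $\mathcal B$, closed under direct sums and direct summands, such that $\mathcal P\subseteq\mathcal T$ and $\mathbb E(\mathcal T,\mathcal P)=0$. Then the functor $\operatorname{Hom}_{\underline{\mathcal B}}(\Omega\mathcal T,-)\colon\mathcal B\to\operatorname{mod}\underline{\Omega\mathcal T}$ is a quotient functor, i.e. full and dense, if and only if the following two conditions are satisfied: (a) For every commutative diagram of $\mathbb E$-triangles $$R_1\xrightarrow{f}R_2\xrightarrow{g}A\dashrightarrow,\quad R_1\xrightarrow{u}P\xrightarrow{p}T_1\dashrightarrow,\quad R_2\xrightarrow{q}P\xrightarrow{v}T_2\dashrightarrow,\quad A\xrightarrow{h}T_1\xrightarrow{t}T_2\dashrightarrow$$ with $qf=u$, $pq=hg$, $tp=v$, where $T_1,T_2\in\mathcal T$ and $P\in\mathcal P$: if $\underline f\neq0$ and $\underline f$ is right minimal (in $\underline{\mathcal B}$), then $\operatorname{Hom}_{\underline{\mathcal B}}(\Omega\mathcal T,\underline h)=0$. (b) For any indecomposable object $A$ such that $\operatorname{Hom}_{\underline{\mathcal B}}(\Omega\mathcal T,A)\neq0$, there exists a commutative diagram of $\mathbb E$-triangles of the same form (the four $\mathbb E$-triangles above with $qf=u$, $pq=hg$, $tp=v$) for this $A$, where $T_1,T_2\in\mathcal T$, $P\in\mathcal P$ and $\operatorname{Hom}_{\underline{\mathcal B}}(\Omega\mathcal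 T,\underline h)=0$.
   Context: Extriangulated category (Nakaoka--Palu): a triple $(\mathcal B,\mathbb E,\mathfrak s)$ with $\mathcal B$ additive, $\mathbb E\colon\mathcal B^{op}\times\mathcal B\to\mathrm{Ab}$ an additive bifunctor (write $a_*\delta=\mathbb E(C,a)(\delta)$, $c^*\delta=\mathbb E(c,A)(\delta)$), and $\mathfrak s$ assigning to each $\delta\in\mathbb E(C,A)$ a class $\mathfrak s(\delta)=[A\to B\to C]$ of sequences modulo isomorphisms of middle terms compatible with the identities of $A,C$, such that: whenever $a_*\delta=c^*\delta'$, the pair $(a,c)$ extends to a commutative diagram $(a,b,c)$ between realizing sequences; $\mathfrak s(0)$ is the split sequence and $\mathfrak s(\delta\oplus\delta')=\mathfrak s(\delta)\oplus\mathfrak s(\delta')$; (ET3) if $A\xrightarrow{x}B\xrightarrow{y}C$, $A'\xrightarrow{x'}B'\xrightarrow{y'}C'$ realize $\delta,\delta'$ and $bx=x'a$, there is $c$ with $cy=y'b$ and $a_*\delta=c^*\delta'$; (ET4) if $A\xrightarrow{f}B\xrightarrow{f'}D$ and $B\xrightarrow{g}C\xrightarrow{g'}F$ realize $\delta,\delta'$, there are an object $E$, morphisms $h'\colon C\to E$, $d\colon D\to E$, $e\colon E\to F$ with $df'=h'g$, $eh'=g'$, and $\delta''\in\mathbb E(E,A)$ realized by $A\xrightarrow{gf}C\xrightarrow{h'}E$, such that $D\xrightarrow{d}E\xrightarrow{e}F$ realizes $f'_*\delta'$, $d^*\delta''=\delta$ and $f_*\delta''=e^*\delta'$; and the duals (ET3)$^{op}$,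 (ET4)$^{op}$. If $\mathfrak s(\delta)=[A\xrightarrow{x}B\xrightarrow{y}C]$, then $A\xrightarrow{x}B\xrightarrow{y}C\dashrightarrow$ is called an $\mathbb E$-triangle, $x$ an inflation, $y$ a deflation. An object $P$ is projective if every morphism $P\to C$ lifts along every deflation $B\to C$; injective is dual. $\mathcal P$, $\mathcal I$ are the full subcategories of projectives and injectives. Enough projectives: every $C$ admits an $\mathbb E$-triangle $A\to P\to C\dashrightarrow$ with $P\in\mathcal P$; enough injectives is dual. Subcategories are full and closed under isomorphisms. $\mathbb E(\mathcal T,\mathcal P)=0$ means $\mathbb E(T,P)=0$ for all $T\in\mathcal T$, $P\in\mathcal P$. $\underline{\mathcal B}=\mathcal B/\mathcal P$ is the quotient by the ideal of morphisms factoring through objects of $\mathcal P$; $\underline f$ is the image of $f$; for $\mathcal P\subseteq\mathcal B'\subseteq\mathcal B$, $\underline{\mathcal B'}=\mathcal B'/\mathcal P$. $\Omega\mathcal T$ is the subcategory of objects $X$ admitting an $\mathbb E$-triangle $X\to P\to T\dashrightarrow$ with $P\in\mathcal P$, $T\in\mathcal T$. $\operatorname{mod}\underline{\Omega\mathcal T}$ is the category of finitely presented contravariant additive functors on $\underline{\Omega\mathcal T}$, and $\operatorname{Hom}_{\underline{\mathcal B}}(\Omega\mathcal T,-)$ sends $X$ to $\operatorname{Hom}_{\underline{\mathcal B}}(-,X)|_{\underline{\Omega\mathcal T}}$; thus $\operatorname{Hom}_{\underline{\mathcal B}}(\Omega\mathcal T,\underline h)=0$ means that $\operatorname{Hom}_{\underline{\mathcal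 B}}(R,\underline h)=0$ for all $R\in\Omega\mathcal T$. A morphism $f$ is right minimal if $fr=f$ implies that the endomorphism $r$ is an isomorphism. *)

theory Defs
  imports "HOL-Algebra.AbelCoset" "HOL-Algebra.Module"
begin

section \<open>Categories and functors\<close>

text \<open>
  Hom sets are indexed by source and target and need not be disjoint, so composition carries its
  three objects: \<open>Comp C X Y Z g f\<close> is the composite of \<open>f : X \<rightarrow> Y\<close> and \<open>g : Y \<rightarrow> Z\<close>.
\<close>

record ('o, 'm) cat =
  Ob :: "'o set"
  Hom :: "'o \<Rightarrow> 'o \<Rightarrow> 'm set"
  Comp :: "'o \<Rightarrow> 'o \<Rightarrow> 'o \<Rightarrow> 'm \<Rightarrow> 'm \<Rightarrow> 'm"
  Ident :: "'o \<Rightarrow> 'm"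

locale category =
  fixes C :: "('o, 'm, 'z) cat_scheme"
  assumes ident_closed: "X \<in> Ob C \<Longrightarrow> Ident C X \<in> Hom C X X"
    and comp_closed:
      "\<lbrakk>X \<in> Ob C; Y \<in> Ob C; Z \<in> Ob C; f \<in> Hom C X Y; g \<in> Hom C Y Z\<rbrakk>
        \<Longrightarrow> Comp C X Y Z g f \<in> Hom C X Z"
    and comp_ident_right:
      "\<lbrakk>X \<in> Ob C; Y \<in> Ob C; f \<in> Hom C X Y\<rbrakk> \<Longrightarrow> Comp C X X Y f (Ident C X) = f"
    and comp_ident_left:
      "\<lbrakk>X \<in> Ob C; Y \<in> Ob C; f \<in> Hom C X Y\<rbrakk> \<Longrightarrow> Comp C X Y Y (Ident C Y) f = f"
    and comp_assoc:
      "\<lbrakk>W \<in> Ob C; X \<in> Ob C; Y \<in> Ob C; Z \<in> Ob C;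
        f \<in> Hom C W X; g \<in> Hom C X Y; h \<in> Hom C Y Z\<rbrakk>
        \<Longrightarrow> Comp C W Y Z h (Comp C W X Y g f) = Comp C W X Z (Comp C X Y Z h g) f"

definition is_iso :: "('o, 'm, 'z) cat_scheme \<Rightarrow> 'o \<Rightarrow> 'o \<Rightarrow> 'm \<Rightarrow> bool" where
  "is_iso C X Y f \<longleftrightarrow> f \<in> Hom C X Y \<and>
     (\<exists>g\<in>Hom C Y X. Comp C X Y X g f = Ident C X \<and> Comp C Y X Y f g = Ident C Y)"

definition isomorphic :: "('o, 'm, 'z) cat_scheme \<Rightarrow> 'o \<Rightarrow> 'o \<Rightarrow> bool" where
  "isomorphic C X Y \<longleftrightarrow> (\<exists>f. is_iso C X Y f)"

definition right_minimal :: "('o, 'm, 'z) cat_scheme \<Rightarrow> 'o \<Rightarrow> 'o \<Rightarrow> 'm \<Rightarrow> bool" where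
  "right_minimal C X Y f \<longleftrightarrow> (\<forall>r\<in>Hom C X X. Comp C X X Y f r = f \<longrightarrow> is_iso C X X r)"

text \<open>Full subcategories are given by their sets of objects.\<close>

definition full_subcat :: "('o, 'm, 'z) cat_scheme \<Rightarrow> 'o set \<Rightarrow> ('o, 'm, 'z) cat_scheme" where
  "full_subcat C S = C\<lparr>Ob := S\<rparr>"

definition replete_subcat :: "('o, 'm, 'z) cat_scheme \<Rightarrow> 'o set \<Rightarrow> bool" where
  "replete_subcat C S \<longleftrightarrow> S \<subseteq> Ob C \<and> (\<forall>X\<in>S. \<forall>Y\<in>Ob C. isomorphic C X Y \<longrightarrow> Y \<in> S)"

definition contravariantly_finite :: "('o, 'm, 'z) cat_scheme \<Rightarrow> 'o set \<Rightarrow> bool" where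
  "contravariantly_finite C S \<longleftrightarrow>
     (\<forall>X\<in>Ob C. \<exists>T\<in>S. \<exists>g\<in>Hom C T X.
        \<forall>T'\<in>S. \<forall>g'\<in>Hom C T' X. \<exists>u\<in>Hom C T' T. Comp C T' T X g u = g')"

record ('o, 'm, 'p, 'n) cfunctor =
  on_ob :: "'o \<Rightarrow> 'p"
  on_hom :: "'o \<Rightarrow> 'o \<Rightarrow> 'm \<Rightarrow> 'n"

definition is_functor ::
    "('o, 'm, 'y) cat_scheme \<Rightarrow> ('p, 'n, 'z) cat_scheme \<Rightarrow> ('o, 'm, 'p, 'n) cfunctor \<Rightarrow> bool" where
  "is_functor C D F \<longleftrightarrow>
     (\<forall>X\<in>Ob C. on_ob F X \<in> Ob D) \<and>
     (\<forall>X\<in>Ob C. \<forall>Y\<in>Ob C. \<forall>f\<in>Hom C X Y. on_hom F X Y f \<in> Hom D (on_ob F X) (on_ob F Y)) \<and>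
     (\<forall>X\<in>Ob C. on_hom F X X (Ident C X) = Ident D (on_ob F X)) \<and>
     (\<forall>X\<in>Ob C. \<forall>Y\<in>Ob C. \<forall>Z\<in>Ob C. \<forall>f\<in>Hom C X Y. \<forall>g\<in>Hom C Y Z.
        on_hom F X Z (Comp C X Y Z g f) =
          Comp D (on_ob F X) (on_ob F Y) (on_ob F Z) (on_hom F Y Z g) (on_hom F X Y f))"

definition full_functor ::
    "('o, 'm, 'y) cat_scheme \<Rightarrow> ('p, 'n, 'z) cat_scheme \<Rightarrow> ('o, 'm, 'p, 'n) cfunctor \<Rightarrow> bool" where
  "full_functor C D F \<longleftrightarrow>
     (\<forall>X\<in>Ob C. \<forall>Y\<in>Ob C. \<forall>\<phi>\<in>Hom D (on_ob F X) (on_ob F Y). \<exists>f\<in>Hom C X Y. on_hom F X Y f = \<phi>)"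

definition dense_functor ::
    "('o, 'm, 'y) cat_scheme \<Rightarrow> ('p, 'n, 'z) cat_scheme \<Rightarrow> ('o, 'm, 'p, 'n) cfunctor \<Rightarrow> bool" where
  "dense_functor C D F \<longleftrightarrow> (\<forall>M\<in>Ob D. \<exists>X\<in>Ob C. isomorphic D (on_ob F X) M)"

definition quotient_functor ::
    "('o, 'm, 'y) cat_scheme \<Rightarrow> ('p, 'n, 'z) cat_scheme \<Rightarrow> ('o, 'm, 'p, 'n) cfunctor \<Rightarrow> bool" where
  "quotient_functor C D F \<longleftrightarrow> is_functor C D F \<and> full_functor C D F \<and> dense_functor C D F"


section \<open>Additive categories\<close>

record ('o, 'm) pcat = "('o, 'm) cat" +
  hadd :: "'o \<Rightarrow> 'o \<Rightarrow> 'm \<Rightarrow> 'm \<Rightarrow> 'm"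
  hzero :: "'o \<Rightarrow> 'o \<Rightarrow> 'm"

text \<open>
  As usual in HOL-Algebra, an abelian group is a \<open>ring\<close> record satisfying \<open>abelian_group\<close>; its
  multiplicative fields are irrelevant.
\<close>

definition HomG :: "('o, 'm, 'z) pcat_scheme \<Rightarrow> 'o \<Rightarrow> 'o \<Rightarrow> 'm ring" where
  "HomG C X Y = \<lparr>carrier = Hom C X Y, mult = undefined, one = undefined,
     zero = hzero C X Y, add = hadd C X Y\<rparr>"

locale preadditive_category = category C for C :: "('o, 'm, 'z) pcat_scheme" +
  assumes abelian_group_Hom: "\<lbrakk>X \<in> Ob C; Y \<in> Ob C\<rbrakk> \<Longrightarrow> abelian_group (HomG C X Y)"
    and comp_add_right:
      "\<lbrakk>X \<in> Ob C; Y \<in> Ob C; Z \<in> Ob C; f \<in> Hom C X Y; f' \<in> Hom C X Y; g \<in> Hom C Y Z\<rbrakk>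
        \<Longrightarrow> Comp C X Y Z g (hadd C X Y f f') =
            hadd C X Z (Comp C X Y Z g f) (Comp C X Y Z g f')"
    and comp_add_left:
      "\<lbrakk>X \<in> Ob C; Y \<in> Ob C; Z \<in> Ob C; f \<in> Hom C X Y; g \<in> Hom C Y Z; g' \<in> Hom C Y Z\<rbrakk>
        \<Longrightarrow> Comp C X Y Z (hadd C Y Z g g') f =
            hadd C X Z (Comp C X Y Z g f) (Comp C X Y Z g' f)"

definition zero_object :: "('o, 'm, 'z) cat_scheme \<Rightarrow> 'o \<Rightarrow> bool" where
  "zero_object C Z \<longleftrightarrow> Z \<in> Ob C \<and>
     (\<forall>X\<in>Ob C. (\<exists>!f. f \<in> Hom C X Z) \<and> (\<exists>!f. f \<in> Hom C Z X))"

definition biproduct ::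
    "('o, 'm, 'z) pcat_scheme \<Rightarrow> 'o \<Rightarrow> 'o \<Rightarrow> 'o \<Rightarrow> 'm \<Rightarrow> 'm \<Rightarrow> 'm \<Rightarrow> 'm \<Rightarrow> bool" where
  "biproduct C X Y S i j p q \<longleftrightarrow>
     X \<in> Ob C \<and> Y \<in> Ob C \<and> S \<in> Ob C \<and>
     i \<in> Hom C X S \<and> j \<in> Hom C Y S \<and> p \<in> Hom C S X \<and> q \<in> Hom C S Y \<and>
     Comp C X S X p i = Ident C X \<and> Comp C Y S Y q j = Ident C Y \<and>
     Comp C Y S X p j = hzero C Y X \<and> Comp C X S Y q i = hzero C X Y \<and>
     hadd C S S (Comp C S X S i p) (Comp C S Y S j q) = Ident C S"

definition direct_sum :: "('o, 'm, 'z) pcat_scheme \<Rightarrow> 'o \<Rightarrow> 'o \<Rightarrow> 'o \<Rightarrow> bool" where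
  "direct_sum C X Y S \<longleftrightarrow> (\<exists>i j p q. biproduct C X Y S i j p q)"

locale additive_category = preadditive_category C for C :: "('o, 'm, 'z) pcat_scheme" +
  assumes ex_zero_object: "\<exists>Z. zero_object C Z"
    and ex_direct_sum: "\<lbrakk>X \<in> Ob C; Y \<in> Ob C\<rbrakk> \<Longrightarrow> \<exists>S. direct_sum C X Y S"

definition closed_under_sums :: "('o, 'm, 'z) pcat_scheme \<Rightarrow> 'o set \<Rightarrow> bool" where
  "closed_under_sums C T \<longleftrightarrow> (\<forall>X\<in>T. \<forall>Y\<in>T. \<forall>S. direct_sum C X Y S \<longrightarrow> S \<in> T)"

definition closed_under_summands :: "('o, 'm, 'z) pcat_scheme \<Rightarrow> 'o set \<Rightarrow> bool" where
  "closed_under_summands C T \<longleftrightarrow> (\<forall>S\<in>T. \<forall>X Y. direct_sum C X Y S \<longrightarrow> X \<in> T \<and> Y \<in> T)"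

definition indecomposable :: "('o, 'm, 'z) pcat_scheme \<Rightarrow> 'o \<Rightarrow> bool" where
  "indecomposable C S \<longleftrightarrow> S \<in> Ob C \<and> \<not> zero_object C S \<and>
     (\<forall>X Y. direct_sum C X Y S \<longrightarrow> zero_object C X \<or> zero_object C Y)"

definition finite_direct_sum ::
    "('o, 'm, 'z) pcat_scheme \<Rightarrow> nat \<Rightarrow> (nat \<Rightarrow> 'o) \<Rightarrow> 'o \<Rightarrow> bool" where
  "finite_direct_sum C n X S \<longleftrightarrow>
     S \<in> Ob C \<and> (\<forall>a<n. X a \<in> Ob C) \<and>
     (\<exists>i p. (\<forall>a<n. i a \<in> Hom C (X a) S \<and> p a \<in> Hom C S (X a)) \<and>
       (\<forall>a<n. \<forall>b<n. Comp C (X b) S (X a) (p a) (i b) =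
          (if a = b then Ident C (X a) else hzero C (X b) (X a))) \<and>
       (\<Oplus>\<^bsub>HomG C S S\<^esub>a\<in>{..<n}. Comp C S (X a) S (i a) (p a)) = Ident C S)"

definition End_ring :: "('o, 'm, 'z) pcat_scheme \<Rightarrow> 'o \<Rightarrow> 'm ring" where
  "End_ring C X = \<lparr>carrier = Hom C X X, mult = Comp C X X X, one = Ident C X,
     zero = hzero C X X, add = hadd C X X\<rparr>"

definition local_ring :: "('a, 'z) ring_scheme \<Rightarrow> bool" where
  "local_ring R \<longleftrightarrow> ring R \<and> \<one>\<^bsub>R\<^esub> \<noteq> \<zero>\<^bsub>R\<^esub> \<and>
     (\<forall>x\<in>carrier R - Units R. \<forall>y\<in>carrier R - Units R. x \<oplus>\<^bsub>R\<^esub> y \<notin> Units R)"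

text \<open>The empty sum is allowed here, so that zero objects are covered.\<close>

definition krull_schmidt :: "('o, 'm, 'z) pcat_scheme \<Rightarrow> bool" where
  "krull_schmidt C \<longleftrightarrow>
     (\<forall>S\<in>Ob C. \<exists>n X. finite_direct_sum C n X S \<and> (\<forall>a<n. local_ring (End_ring C (X a))))"


section \<open>Ideal quotients\<close>

definition factors_through :: "('o, 'm, 'z) cat_scheme \<Rightarrow> 'o set \<Rightarrow> 'o \<Rightarrow> 'o \<Rightarrow> 'm set" where
  "factors_through C P X Y =
     {f \<in> Hom C X Y. \<exists>W\<in>P. \<exists>a\<in>Hom C X W. \<exists>b\<in>Hom C W Y. f = Comp C X W Y b a}"

definition qmor :: "('o, 'm, 'z) pcat_scheme \<Rightarrow> 'o set \<Rightarrow> 'o \<Rightarrow> 'o \<Rightarrow> 'm \<Rightarrow> 'm set" where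
  "qmor C P X Y f = factors_through C P X Y +>\<^bsub>HomG C X Y\<^esub> f"

definition ideal_quotient :: "('o, 'm, 'z) pcat_scheme \<Rightarrow> 'o set \<Rightarrow> ('o, 'm set) pcat" where
  "ideal_quotient C P = \<lparr>
     Ob = Ob C,
     Hom = (\<lambda>X Y. a_rcosets\<^bsub>HomG C X Y\<^esub> (factors_through C P X Y)),
     Comp = (\<lambda>X Y Z G F. \<Union>g\<in>G. \<Union>f\<in>F. qmor C P X Z (Comp C X Y Z g f)),
     Ident = (\<lambda>X. qmor C P X X (Ident C X)),
     hadd = (\<lambda>X Y F G. \<Union>f\<in>F. \<Union>g\<in>G. qmor C P X Y (hadd C X Y f g)),
     hzero = (\<lambda>X Y. qmor C P X Y (hzero C X Y))\<rparr>"


section \<open>Finitely presented functors\<close>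

text \<open>Contravariant functors to abelian groups: a morphism \<open>f : X \<rightarrow> Y\<close> is sent to
  \<open>ab_hom F X Y f : ab_ob F Y \<rightarrow> ab_ob F X\<close>.\<close>

record ('o, 'm, 'v) ab_functor =
  ab_ob :: "'o \<Rightarrow> 'v ring"
  ab_hom :: "'o \<Rightarrow> 'o \<Rightarrow> 'm \<Rightarrow> 'v \<Rightarrow> 'v"

definition additive_ab_functor ::
    "('o, 'm, 'z) pcat_scheme \<Rightarrow> ('o, 'm, 'v) ab_functor \<Rightarrow> bool" where
  "additive_ab_functor A F \<longleftrightarrow>
     (\<forall>X\<in>Ob A. abelian_group (ab_ob F X)) \<and>
     (\<forall>X\<in>Ob A. \<forall>Y\<in>Ob A. \<forall>f\<in>Hom A X Y.
        abelian_group_hom (ab_ob F Y) (ab_ob F X) (ab_hom F X Y f)) \<and>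
     (\<forall>X\<in>Ob A. \<forall>v\<in>carrier (ab_ob F X). ab_hom F X X (Ident A X) v = v) \<and>
     (\<forall>X\<in>Ob A. \<forall>Y\<in>Ob A. \<forall>Z\<in>Ob A. \<forall>f\<in>Hom A X Y. \<forall>g\<in>Hom A Y Z. \<forall>v\<in>carrier (ab_ob F Z).
        ab_hom F X Z (Comp A X Y Z g f) v = ab_hom F X Y f (ab_hom F Y Z g v)) \<and>
     (\<forall>X\<in>Ob A. \<forall>Y\<in>Ob A. \<forall>f\<in>Hom A X Y. \<forall>g\<in>Hom A X Y. \<forall>v\<in>carrier (ab_ob F Y).
        ab_hom F X Y (hadd A X Y f g) v = ab_hom F X Y f v \<oplus>\<^bsub>ab_ob F X\<^esub> ab_hom F X Y g v)"

text \<open>Natural transformations are extensional, so that equality of the HOL functions is equality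
  of natural transformations.\<close>

definition nat_trans ::
    "('o, 'm, 'z) pcat_scheme \<Rightarrow> ('o, 'm, 'v) ab_functor \<Rightarrow> ('o, 'm, 'v) ab_functor
      \<Rightarrow> ('o \<Rightarrow> 'v \<Rightarrow> 'v) set" where
  "nat_trans A F G = {\<eta> \<in> extensional (Ob A).
     (\<forall>X\<in>Ob A. \<eta> X \<in> extensional (carrier (ab_ob F X)) \<and>
        abelian_group_hom (ab_ob F X) (ab_ob G X) (\<eta> X)) \<and>
     (\<forall>X\<in>Ob A. \<forall>Y\<in>Ob A. \<forall>f\<in>Hom A X Y. \<forall>v\<in>carrier (ab_ob F Y).
        \<eta> X (ab_hom F X Y f v) = ab_hom G X Y f (\<eta> Y v))}"

definition hom_functor :: "('o, 'm, 'z) pcat_scheme \<Rightarrow> 'o \<Rightarrow> ('o, 'm, 'm) ab_functor" where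
  "hom_functor A X = \<lparr>
     ab_ob = (\<lambda>R. HomG A R X),
     ab_hom = (\<lambda>R S f \<phi>. Comp A R S X \<phi> f)\<rparr>"

text \<open>There is an exact sequence \<open>Hom(-,R1) \<rightarrow> Hom(-,R0) \<rightarrow> F \<rightarrow> 0\<close>.\<close>

definition finitely_presented ::
    "('o, 'm, 'z) pcat_scheme \<Rightarrow> ('o, 'm, 'm) ab_functor \<Rightarrow> bool" where
  "finitely_presented A F \<longleftrightarrow> additive_ab_functor A F \<and>
     (\<exists>R1\<in>Ob A. \<exists>R0\<in>Ob A.
      \<exists>\<alpha>\<in>nat_trans A (hom_functor A R1) (hom_functor A R0).
      \<exists>\<pi>\<in>nat_trans A (hom_functor A R0) F.
        \<forall>X\<in>Ob A. \<pi> X ` Hom A X R0 = carrier (ab_ob F X) \<and>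
          \<alpha> X ` Hom A X R1 = a_kernel (HomG A X R0) (ab_ob F X) (\<pi> X))"

text \<open>
  The values of the functors in \<open>mod_cat A\<close> are groups on subsets of the type of morphisms of \<open>A\<close>.
  Up to isomorphism this is no restriction: every value of a finitely presented functor is a
  quotient of a Hom group of \<open>A\<close>, hence can be transported to a set of coset representatives.
\<close>

definition mod_cat ::
    "('o, 'm, 'z) pcat_scheme \<Rightarrow> (('o, 'm, 'm) ab_functor, 'o \<Rightarrow> 'm \<Rightarrow> 'm) cat" where
  "mod_cat A = \<lparr>
     Ob = {F. finitely_presented A F},
     Hom = nat_trans A,
     Comp = (\<lambda>F G H \<theta> \<eta>. \<lambda>X\<in>Ob A. \<lambda>v\<in>carrier (ab_ob F X). \<theta> X (\<eta> X v)),
     Ident = (\<lambda>F. \<lambda>X\<in>Ob A. \<lambda>v\<in>carrier (ab_ob F X). v)\<rparr>"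


section \<open>Extriangulated categories\<close>

text \<open>
  \<open>Ext B C A\<close> is the group of extensions of \<open>C\<close> by \<open>A\<close>.  For \<open>a : A \<rightarrow> A'\<close> and \<open>c : C' \<rightarrow> C\<close>,
  \<open>push B C A A' a\<close> is the induced map from \<open>Ext B C A\<close> to \<open>Ext B C A'\<close>, and \<open>pull B C' C A c\<close> is
  the induced map from \<open>Ext B C A\<close> to \<open>Ext B C' A\<close>.  \<open>realz B C A \<delta>\<close> is the class of sequences
  assigned to \<open>\<delta>\<close>, where \<open>(M, x, y)\<close> stands for the sequence with middle term \<open>M\<close> and morphisms
  \<open>x : A \<rightarrow> M\<close>, \<open>y : M \<rightarrow> C\<close>.
\<close>

record ('o, 'm, 'e) excat = "('o, 'm) pcat" +
  Ext :: "'o \<Rightarrow> 'o \<Rightarrow> 'e ring"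
  push :: "'o \<Rightarrow> 'o \<Rightarrow> 'o \<Rightarrow> 'm \<Rightarrow> 'e \<Rightarrow> 'e"
  pull :: "'o \<Rightarrow> 'o \<Rightarrow> 'o \<Rightarrow> 'm \<Rightarrow> 'e \<Rightarrow> 'e"
  realz :: "'o \<Rightarrow> 'o \<Rightarrow> 'e \<Rightarrow> ('o \<times> 'm \<times> 'm) set"

locale ext_bifunctor = additive_category B for B :: "('o, 'm, 'e, 'z) excat_scheme" +
  assumes abelian_group_Ext: "\<lbrakk>C \<in> Ob B; A \<in> Ob B\<rbrakk> \<Longrightarrow> abelian_group (Ext B C A)"
    and push_hom: "\<lbrakk>C \<in> Ob B; A \<in> Ob B; A' \<in> Ob B; a \<in> Hom B A A'\<rbrakk>
      \<Longrightarrow> abelian_group_hom (Ext B C A) (Ext B C A') (push B C A A' a)"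
    and pull_hom: "\<lbrakk>C \<in> Ob B; C' \<in> Ob B; A \<in> Ob B; c \<in> Hom B C' C\<rbrakk>
      \<Longrightarrow> abelian_group_hom (Ext B C A) (Ext B C' A) (pull B C' C A c)"
    and push_ident: "\<lbrakk>C \<in> Ob B; A \<in> Ob B; \<delta> \<in> carrier (Ext B C A)\<rbrakk>
      \<Longrightarrow> push B C A A (Ident B A) \<delta> = \<delta>"
    and pull_ident: "\<lbrakk>C \<in> Ob B; A \<in> Ob B; \<delta> \<in> carrier (Ext B C A)\<rbrakk>
      \<Longrightarrow> pull B C C A (Ident B C) \<delta> = \<delta>"
    and push_comp: "\<lbrakk>C \<in> Ob B; A \<in> Ob B; A' \<in> Ob B; A'' \<in> Ob B;
        a \<in> Hom B A A'; a' \<in> Hom B A' A''; \<delta> \<in> carrier (Ext B C A)\<rbrakk>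
      \<Longrightarrow> push B C A A'' (Comp B A A' A'' a' a) \<delta> = push B C A' A'' a' (push B C A A' a \<delta>)"
    and pull_comp: "\<lbrakk>C \<in> Ob B; C' \<in> Ob B; C'' \<in> Ob B; A \<in> Ob B;
        c \<in> Hom B C' C; c' \<in> Hom B C'' C'; \<delta> \<in> carrier (Ext B C A)\<rbrakk>
      \<Longrightarrow> pull B C'' C A (Comp B C'' C' C c c') \<delta> = pull B C'' C' A c' (pull B C' C A c \<delta>)"
    and push_pull: "\<lbrakk>C \<in> Ob B; C' \<in> Ob B; A \<in> Ob B; A' \<in> Ob B;
        a \<in> Hom B A A'; c \<in> Hom B C' C; \<delta> \<in> carrier (Ext B C A)\<rbrakk>
      \<Longrightarrow> push B C' A A' a (pull B C' C A c \<delta>) = pull B C' C A' c (push B C A A' a \<delta>)"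
    and push_add: "\<lbrakk>C \<in> Ob B; A \<in> Ob B; A' \<in> Ob B;
        a \<in> Hom B A A'; a' \<in> Hom B A A'; \<delta> \<in> carrier (Ext B C A)\<rbrakk>
      \<Longrightarrow> push B C A A' (hadd B A A' a a') \<delta> =
          push B C A A' a \<delta> \<oplus>\<^bsub>Ext B C A'\<^esub> push B C A A' a' \<delta>"
    and pull_add: "\<lbrakk>C \<in> Ob B; C' \<in> Ob B; A \<in> Ob B;
        c \<in> Hom B C' C; c' \<in> Hom B C' C; \<delta> \<in> carrier (Ext B C A)\<rbrakk>
      \<Longrightarrow> pull B C' C A (hadd B C' C c c') \<delta> =
          pull B C' C A c \<delta> \<oplus>\<^bsub>Ext B C' A\<^esub> pull B C' C A c' \<delta>"

definition sequences :: "('o, 'm, 'z) cat_scheme \<Rightarrow> 'o \<Rightarrow> 'o \<Rightarrow> ('o \<times> 'm \<times> 'm) set" where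
  "sequences B A C = {(M, x, y). M \<in> Ob B \<and> x \<in> Hom B A M \<and> y \<in> Hom B M C}"

definition seq_equiv ::
    "('o, 'm, 'z) cat_scheme \<Rightarrow> 'o \<Rightarrow> 'o \<Rightarrow> (('o \<times> 'm \<times> 'm) \<times> ('o \<times> 'm \<times> 'm)) set" where
  "seq_equiv B A C = {((M, x, y), (M', x', y')).
     (M, x, y) \<in> sequences B A C \<and> (M', x', y') \<in> sequences B A C \<and>
     (\<exists>b. is_iso B M M' b \<and> Comp B A M M' b x = x' \<and> Comp B M M' C y' b = y)}"

definition realizes ::
    "('o, 'm, 'e, 'z) excat_scheme \<Rightarrow> 'o \<Rightarrow> 'o \<Rightarrow> 'o \<Rightarrow> 'm \<Rightarrow> 'm \<Rightarrow> 'e \<Rightarrow> bool" where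
  "realizes B A M C x y \<delta> \<longleftrightarrow>
     A \<in> Ob B \<and> C \<in> Ob B \<and> \<delta> \<in> carrier (Ext B C A) \<and> (M, x, y) \<in> realz B C A \<delta>"

text \<open>In \<open>realz_sum\<close>, the extension \<open>i\<^sub>A\<^sub>* p\<^sub>C\<^sup>* \<delta> + j\<^sub>A\<^sub>* q\<^sub>C\<^sup>* \<delta>'\<close> of the direct sums is
  the element \<open>\<delta> \<oplus> \<delta>'\<close>, i.e. \<open>(\<delta>, 0, 0, \<delta>')\<close> under additivity of \<open>Ext\<close> in both arguments.\<close>

locale extriangulated = ext_bifunctor B for B :: "('o, 'm, 'e, 'z) excat_scheme" +
  assumes realz_class: "\<lbrakk>C \<in> Ob B; A \<in> Ob B; \<delta> \<in> carrier (Ext B C A)\<rbrakk>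
      \<Longrightarrow> realz B C A \<delta> \<in> sequences B A C // seq_equiv B A C"
    and realz_morphism: "\<lbrakk>realizes B A M C x y \<delta>; realizes B A' M' C' x' y' \<delta>';
        a \<in> Hom B A A'; c \<in> Hom B C C'; push B C A A' a \<delta> = pull B C C' A' c \<delta>'\<rbrakk>
      \<Longrightarrow> \<exists>b\<in>Hom B M M'. Comp B A M M' b x = Comp B A A' M' x' a \<and>
            Comp B M M' C' y' b = Comp B M C C' c y"
    and realz_zero: "biproduct B A C S i j p q \<Longrightarrow> realizes B A S C i q \<zero>\<^bsub>Ext B C A\<^esub>"
    and realz_sum: "\<lbrakk>realizes B A M C x y \<delta>; realizes B A' M' C' x' y' \<delta>';
        biproduct B A A' SA iA jA pA qA; biproduct B M M' SM iM jM pM qM;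
        biproduct B C C' SC iC jC pC qC\<rbrakk>
      \<Longrightarrow> realizes B SA SM SC
            (hadd B SA SM (Comp B SA M SM iM (Comp B SA A M x pA))
                          (Comp B SA M' SM jM (Comp B SA A' M' x' qA)))
            (hadd B SM SC (Comp B SM C SC iC (Comp B SM M C y pM))
                          (Comp B SM C' SC jC (Comp B SM M' C' y' qM)))
            (push B SC A SA iA (pull B SC C A pC \<delta>) \<oplus>\<^bsub>Ext B SC SA\<^esub>
             push B SC A' SA jA (pull B SC C' A' qC \<delta>'))"
    and ET3: "\<lbrakk>realizes B A M C x y \<delta>; realizes B A' M' C' x' y' \<delta>';
        a \<in> Hom B A A'; b \<in> Hom B M M'; Comp B A M M' b x = Comp B A A' M' x' a\<rbrakk>
      \<Longrightarrow> \<exists>c\<in>Hom B C C'. Comp B M C C' c y = Comp B M M' C' y' b \<and>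
            push B C A A' a \<delta> = pull B C C' A' c \<delta>'"
    and ET3_op: "\<lbrakk>realizes B A M C x y \<delta>; realizes B A' M' C' x' y' \<delta>';
        b \<in> Hom B M M'; c \<in> Hom B C C'; Comp B M C C' c y = Comp B M M' C' y' b\<rbrakk>
      \<Longrightarrow> \<exists>a\<in>Hom B A A'. Comp B A M M' b x = Comp B A A' M' x' a \<and>
            push B C A A' a \<delta> = pull B C C' A' c \<delta>'"
    and ET4: "\<lbrakk>realizes B X Y D f f' \<delta>; realizes B Y Z F g g' \<delta>'\<rbrakk>
      \<Longrightarrow> \<exists>E\<in>Ob B. \<exists>h'\<in>Hom B Z E. \<exists>d\<in>Hom B D E. \<exists>e\<in>Hom B E F. \<exists>\<delta>''.
            Comp B Y D E d f' = Comp B Y Z E h' g \<and>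
            Comp B Z E F e h' = g' \<and>
            realizes B X Z E (Comp B X Y Z g f) h' \<delta>'' \<and>
            realizes B D E F d e (push B F Y D f' \<delta>') \<and>
            pull B D E X d \<delta>'' = \<delta> \<and>
            push B E X Y f \<delta>'' = pull B E F Y e \<delta>'"
    and ET4_op: "\<lbrakk>realizes B D X Y f' f \<delta>; realizes B F Y Z g' g \<delta>'\<rbrakk>
      \<Longrightarrow> \<exists>E\<in>Ob B. \<exists>h'\<in>Hom B E X. \<exists>d\<in>Hom B D E. \<exists>e\<in>Hom B E F. \<exists>\<delta>''.
            Comp B D E X h' d = f' \<and>
            Comp B E F Y g' e = Comp B E X Y f h' \<and>
            realizes B E X Z h' (Comp B X Y Z g f) \<delta>'' \<and>
            realizes B D E F d e (pull B F Y D g' \<delta>) \<and>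
            push B Z E F e \<delta>'' = \<delta>' \<and>
            push B Y D E d \<delta> = pull B Y Z E g \<delta>''"

definition E_triangle ::
    "('o, 'm, 'e, 'z) excat_scheme \<Rightarrow> 'o \<Rightarrow> 'o \<Rightarrow> 'o \<Rightarrow> 'm \<Rightarrow> 'm \<Rightarrow> bool" where
  "E_triangle B A M C x y \<longleftrightarrow> (\<exists>\<delta>. realizes B A M C x y \<delta>)"

definition inflation :: "('o, 'm, 'e, 'z) excat_scheme \<Rightarrow> 'o \<Rightarrow> 'o \<Rightarrow> 'm \<Rightarrow> bool" where
  "inflation B A M x \<longleftrightarrow> (\<exists>C y. E_triangle B A M C x y)"

definition deflation :: "('o, 'm, 'e, 'z) excat_scheme \<Rightarrow> 'o \<Rightarrow> 'o \<Rightarrow> 'm \<Rightarrow> bool" where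
  "deflation B M C y \<longleftrightarrow> (\<exists>A x. E_triangle B A M C x y)"

definition projectives :: "('o, 'm, 'e, 'z) excat_scheme \<Rightarrow> 'o set" where
  "projectives B = {P \<in> Ob B. \<forall>M C y. deflation B M C y \<longrightarrow>
     (\<forall>f\<in>Hom B P C. \<exists>f'\<in>Hom B P M. Comp B P M C y f' = f)}"

definition injectives :: "('o, 'm, 'e, 'z) excat_scheme \<Rightarrow> 'o set" where
  "injectives B = {I \<in> Ob B. \<forall>A M x. inflation B A M x \<longrightarrow>
     (\<forall>f\<in>Hom B A I. \<exists>f'\<in>Hom B M I. Comp B A M I f' x = f)}"

definition enough_projectives :: "('o, 'm, 'e, 'z) excat_scheme \<Rightarrow> bool" where
  "enough_projectives B \<longleftrightarrow>
     (\<forall>C\<in>Ob B. \<exists>A. \<exists>P\<in>projectives B. \<exists>x y. E_triangle B A P C x y)"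

definition enough_injectives :: "('o, 'm, 'e, 'z) excat_scheme \<Rightarrow> bool" where
  "enough_injectives B \<longleftrightarrow>
     (\<forall>A\<in>Ob B. \<exists>C. \<exists>I\<in>injectives B. \<exists>x y. E_triangle B A I C x y)"

definition Ext_vanishes :: "('o, 'm, 'e, 'z) excat_scheme \<Rightarrow> 'o set \<Rightarrow> 'o set \<Rightarrow> bool" where
  "Ext_vanishes B S T \<longleftrightarrow> (\<forall>C\<in>S. \<forall>A\<in>T. carrier (Ext B C A) = {\<zero>\<^bsub>Ext B C A\<^esub>})"


section \<open>Linear structure over a field\<close>

record ('o, 'm, 'e, 'k) lin_excat = "('o, 'm, 'e) excat" +
  hsmult :: "'o \<Rightarrow> 'o \<Rightarrow> 'k \<Rightarrow> 'm \<Rightarrow> 'm"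

definition HomM :: "('o, 'm, 'e, 'k, 'z) lin_excat_scheme \<Rightarrow> 'o \<Rightarrow> 'o \<Rightarrow> ('k, 'm) module" where
  "HomM C X Y = \<lparr>carrier = Hom C X Y, mult = undefined, one = undefined,
     zero = hzero C X Y, add = hadd C X Y, smult = hsmult C X Y\<rparr>"

locale linear_over = preadditive_category C + field K
  for K :: "('k, 'y) ring_scheme" and C :: "('o, 'm, 'e, 'k, 'z) lin_excat_scheme" +
  assumes module_Hom: "\<lbrakk>X \<in> Ob C; Y \<in> Ob C\<rbrakk> \<Longrightarrow> module K (HomM C X Y)"
    and comp_smult_right:
      "\<lbrakk>X \<in> Ob C; Y \<in> Ob C; Z \<in> Ob C; f \<in> Hom C X Y; g \<in> Hom C Y Z; c \<in> carrier K\<rbrakk>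
        \<Longrightarrow> Comp C X Y Z g (hsmult C X Y c f) = hsmult C X Z c (Comp C X Y Z g f)"
    and comp_smult_left:
      "\<lbrakk>X \<in> Ob C; Y \<in> Ob C; Z \<in> Ob C; f \<in> Hom C X Y; g \<in> Hom C Y Z; c \<in> carrier K\<rbrakk>
        \<Longrightarrow> Comp C X Y Z (hsmult C Y Z c g) f = hsmult C X Z c (Comp C X Y Z g f)"

definition finite_dim :: "('k, 'y) ring_scheme \<Rightarrow> ('k, 'm, 'z) module_scheme \<Rightarrow> bool" where
  "finite_dim K V \<longleftrightarrow> (\<exists>S. finite S \<and> S \<subseteq> carrier V \<and>
     (\<forall>v\<in>carrier V. \<exists>c\<in>S \<rightarrow> carrier K. v = (\<Oplus>\<^bsub>V\<^esub>s\<in>S. c s \<odot>\<^bsub>V\<^esub> s)))"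

definition hom_finite ::
    "('k, 'y) ring_scheme \<Rightarrow> ('o, 'm, 'e, 'k, 'z) lin_excat_scheme \<Rightarrow> bool" where
  "hom_finite K C \<longleftrightarrow> (\<forall>X\<in>Ob C. \<forall>Y\<in>Ob C. finite_dim K (HomM C X Y))"


section \<open>The functor to finitely presented modules over the stable syzygy category\<close>

abbreviation stable_cat :: "('o, 'm, 'e, 'z) excat_scheme \<Rightarrow> ('o, 'm set) pcat" where
  "stable_cat B \<equiv> ideal_quotient B (projectives B)"

abbreviation stable_mor :: "('o, 'm, 'e, 'z) excat_scheme \<Rightarrow> 'o \<Rightarrow> 'o \<Rightarrow> 'm \<Rightarrow> 'm set" where
  "stable_mor B \<equiv> qmor B (projectives B)"

definition syzygies :: "('o, 'm, 'e, 'z) excat_scheme \<Rightarrow> 'o set \<Rightarrow> 'o set" where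
  "syzygies B T =
     {X \<in> Ob B. \<exists>P\<in>projectives B. \<exists>C\<in>T. \<exists>x y. E_triangle B X P C x y}"

definition stable_syzygies :: "('o, 'm, 'e, 'z) excat_scheme \<Rightarrow> 'o set \<Rightarrow> ('o, 'm set) pcat" where
  "stable_syzygies B T = full_subcat (stable_cat B) (syzygies B T)"

definition Hom_syzygies ::
    "('o, 'm, 'e, 'z) excat_scheme \<Rightarrow> 'o set
      \<Rightarrow> ('o, 'm, ('o, 'm set, 'm set) ab_functor, 'o \<Rightarrow> 'm set \<Rightarrow> 'm set) cfunctor" where
  "Hom_syzygies B T = \<lparr>
     on_ob = hom_functor (stable_cat B),
     on_hom = (\<lambda>X Y f. \<lambda>R\<in>syzygies B T. \<lambda>\<phi>\<in>Hom (stable_cat B) R X.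
        Comp (stable_cat B) R X Y (stable_mor B X Y f) \<phi>)\<rparr>"

definition Hom_syzygies_ob_zero :: "('o, 'm, 'e, 'z) excat_scheme \<Rightarrow> 'o set \<Rightarrow> 'o \<Rightarrow> bool" where
  "Hom_syzygies_ob_zero B T X \<longleftrightarrow>
     (\<forall>R\<in>syzygies B T. Hom (stable_cat B) R X = {hzero (stable_cat B) R X})"

definition Hom_syzygies_mor_zero ::
    "('o, 'm, 'e, 'z) excat_scheme \<Rightarrow> 'o set \<Rightarrow> 'o \<Rightarrow> 'o \<Rightarrow> 'm \<Rightarrow> bool" where
  "Hom_syzygies_mor_zero B T X Y f \<longleftrightarrow>
     (\<forall>R\<in>syzygies B T. \<forall>\<phi>\<in>Hom (stable_cat B) R X.
        Comp (stable_cat B) R X Y (stable_mor B X Y f) \<phi> = hzero (stable_cat B) R Y)"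

definition syzygy_diagram ::
    "('o, 'm, 'e, 'z) excat_scheme \<Rightarrow> 'o set \<Rightarrow> 'o \<Rightarrow> 'o \<Rightarrow> 'o \<Rightarrow> 'o \<Rightarrow> 'o \<Rightarrow> 'o
      \<Rightarrow> 'm \<Rightarrow> 'm \<Rightarrow> 'm \<Rightarrow> 'm \<Rightarrow> 'm \<Rightarrow> 'm \<Rightarrow> 'm \<Rightarrow> 'm \<Rightarrow> bool" where
  "syzygy_diagram B T R1 R2 A P T1 T2 f g u p q v h t \<longleftrightarrow>
     P \<in> projectives B \<and> T1 \<in> T \<and> T2 \<in> T \<and>
     E_triangle B R1 R2 A f g \<and> E_triangle B R1 P T1 u p \<and>
     E_triangle B R2 P T2 q v \<and> E_triangle B A T1 T2 h t \<and>
     Comp B R1 R2 P q f = u \<and>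
     Comp B R2 P T1 p q = Comp B R2 A T1 h g \<and>
     Comp B P T1 T2 t p = v"

end

theory Submission
  imports Defs
begin

text \<open>
  Write \<open>F X = Hom(-,X)\<close> for the functor on stable syzygies. A map \<open>f : R1 \<rightarrow> R2\<close> of syzygies is
  stably replaced by the inflation \<open>(f, u) : R1 \<rightarrow> R2 \<oplus> P\<close>; the octahedral axiom completes it to a
  diagram as in (a) in which the extension of \<open>A\<close> by \<open>R1\<close> is pulled back along \<open>h\<close>. Hence
  \<open>F h = 0\<close> makes \<open>F g\<close> epi, so that \<open>F A\<close> is the cokernel of \<open>F f\<close>, and maps out of \<open>F A\<close> lift
  to \<open>B\<close> because \<open>A\<close> is a weak stable cokernel of \<open>f\<close>. By Krull-Schmidt every finitely presented
  functor is the cokernel of \<open>F f\<close> for some right minimal \<open>f\<close>, so (a) gives density; fullness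
  reduces to indecomposable \<open>A\<close>, where (b) applies.

  Conversely, if the cokernel of \<open>F f\<close> is some \<open>F X\<close> with \<open>f\<close> right minimal, fullness produces an
  endomorphism of \<open>A\<close>, factoring through \<open>X\<close>, that fixes \<open>g\<close> stably. Right minimality forces it to
  be stably split epi, so \<open>F g\<close> is epi and \<open>F h = 0\<close>. For indecomposable \<open>A\<close>, applying this to a
  right minimal presentation of \<open>F A\<close> gives a diagram for \<open>A \<oplus> Q\<close> with \<open>Q\<close> projective, and \<open>Q\<close> can
  be split off.
\<close>

section \<open>Preadditive categories and biproducts\<close>

text \<open>The axioms speak about B, while the claim lives modulo projectives, so stable vanishing
  has to be turned back into honest vanishing. On the deflation side projectives lift. On the
  inflation side E(T,P) = 0 does it: a map to a projective extends along any inflation with cone in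
  \<open>T\<close>. The resulting exactness statements are \<open>stable_kernel\<close> and
  \<open>stable_cokernel\<close>. Kernels and cokernels are only weak, so comparison maps between
  cones are never unique. Their action on extension classes replaces uniqueness: an endomorphism of
  a cone that fixes the class is the identity plus a map factoring through the deflation. A diagram
  as in (a) does not record that the extension of A by R1 is pulled back along h, yet surjectivity
  of F g is derived from exactly that. Diagrams are therefore built, or rebuilt from u and h, by the
  octahedral axiom. Krull-Schmidt is applied in B and not in the stable category: an endomorphism s
  with 1 - s not invertible is traded for a split local summand whose inclusion factors through
  s.\<close>

context category
begin

lemmas comp_simps = ident_closed comp_closed comp_ident_left comp_ident_right

lemma comp_assoc_right:
  "\<lbrakk>W \<in> Ob C; X \<in> Ob C; Y \<in> Ob C; Z \<in> Ob C; f \<in> Hom C W X; g \<in> Hom C X Y; h \<in> Hom C Y Z\<rbrakk>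
    \<Longrightarrow> Comp C W X Z (Comp C X Y Z h g) f = Comp C W Y Z h (Comp C W X Y g f)"
  using comp_assoc by simp

text \<open>Once composites are associated to the right, an equation g f = k no longer matches
  inside a longer chain. The tail \<open>w\<close> makes such an equation usable as a rewrite rule
  again.\<close>

lemma comp_reassoc:
  assumes "Comp C X Y Z g f = k" and "W \<in> Ob C" "X \<in> Ob C" "Y \<in> Ob C" "Z \<in> Ob C"
    and "f \<in> Hom C X Y" "g \<in> Hom C Y Z" "w \<in> Hom C W X"
  shows "Comp C W Y Z g (Comp C W X Y f w) = Comp C W X Z k w"
  using assms comp_assoc by metis

lemma is_isoI:
  assumes "f \<in> Hom C X Y" "g \<in> Hom C Y X" "Comp C X Y X g f = Ident C X"
    "Comp C Y X Y f g = Ident C Y"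
  shows "is_iso C X Y f"
  using assms by (auto simp: is_iso_def)

lemma is_iso_comp:
  assumes ob: "X \<in> Ob C" "Y \<in> Ob C" "Z \<in> Ob C" and f: "is_iso C X Y f" and g: "is_iso C Y Z g"
  shows "is_iso C X Z (Comp C X Y Z g f)"
proof -
  obtain f' where f': "f \<in> Hom C X Y" "f' \<in> Hom C Y X" "Comp C X Y X f' f = Ident C X"
      "Comp C Y X Y f f' = Ident C Y"
    using f by (auto simp: is_iso_def)
  obtain g' where g': "g \<in> Hom C Y Z" "g' \<in> Hom C Z Y" "Comp C Y Z Y g' g = Ident C Y"
      "Comp C Z Y Z g g' = Ident C Z"
    using g by (auto simp: is_iso_def)
  show ?thesis
    by (rule is_isoI[where g = "Comp C Z Y X f' g'"])
      (simp_all add: ob f' g' comp_simps comp_assoc_right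
        comp_reassoc[OF f'(4)] comp_reassoc[OF g'(3)])
qed

text \<open>An inverse of g f turns g into a left inverse of f, an inverse of f g turns it into a
  right inverse, and the two must coincide.\<close>

lemma is_iso_if_both_sides:
  assumes ob: "X \<in> Ob C" "Y \<in> Ob C" and f: "f \<in> Hom C X Y" "g \<in> Hom C Y X"
    and 1: "is_iso C X X (Comp C X Y X g f)" and 2: "is_iso C Y Y (Comp C Y X Y f g)"
  shows "is_iso C X Y f"
proof -
  obtain a where a: "a \<in> Hom C X X" "Comp C X X X a (Comp C X Y X g f) = Ident C X"
    using 1 by (auto simp: is_iso_def)
  obtain b where b: "b \<in> Hom C Y Y" "Comp C Y Y Y (Comp C Y X Y f g) b = Ident C Y"
    using 2 by (auto simp: is_iso_def)
  let ?l = "Comp C Y X X a g" and ?r = "Comp C Y Y X g b"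
  have l: "Comp C X Y X ?l f = Ident C X" and r: "Comp C Y X Y f ?r = Ident C Y"
    using ob f a b by (simp_all add: comp_assoc_right comp_simps)
  have "?l = Comp C Y Y X ?l (Comp C Y X Y f ?r)"
    using ob f a b by (simp add: r comp_simps)
  also have "\<dots> = ?r"
    using ob f a(1) b(1) l by (simp add: comp_assoc comp_simps)
  finally have "?l = ?r" .
  then show ?thesis
    using ob f a b l r by (intro is_isoI[where g = ?r]) (simp_all add: comp_simps)
qed

end

text \<open>A name that hides the group record, so that negatives can be rewritten without
  mentioning \<open>HomG\<close>.\<close>

definition hneg :: "('o, 'm, 'z) pcat_scheme \<Rightarrow> 'o \<Rightarrow> 'o \<Rightarrow> 'm \<Rightarrow> 'm" where
  "hneg C X Y f = \<ominus>\<^bsub>HomG C X Y\<^esub> f"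

lemma HomG_simps [simp]:
  "carrier (HomG C X Y) = Hom C X Y" "\<zero>\<^bsub>HomG C X Y\<^esub> = hzero C X Y"
  "f \<oplus>\<^bsub>HomG C X Y\<^esub> g = hadd C X Y f g" "\<ominus>\<^bsub>HomG C X Y\<^esub> f = hneg C X Y f"
  by (simp_all add: HomG_def hneg_def)

context preadditive_category
begin

lemma
  assumes "X \<in> Ob C" "Y \<in> Ob C"
  shows hzero_closed: "hzero C X Y \<in> Hom C X Y"
    and hadd_closed: "\<lbrakk>f \<in> Hom C X Y; g \<in> Hom C X Y\<rbrakk> \<Longrightarrow> hadd C X Y f g \<in> Hom C X Y"
    and hneg_closed: "f \<in> Hom C X Y \<Longrightarrow> hneg C X Y f \<in> Hom C X Y"
    and hadd_assoc: "\<lbrakk>f \<in> Hom C X Y; g \<in> Hom C X Y; h \<in> Hom C X Y\<rbrakk>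
      \<Longrightarrow> hadd C X Y (hadd C X Y f g) h = hadd C X Y f (hadd C X Y g h)"
    and hadd_comm: "\<lbrakk>f \<in> Hom C X Y; g \<in> Hom C X Y\<rbrakk> \<Longrightarrow> hadd C X Y f g = hadd C X Y g f"
    and hadd_left_comm: "\<lbrakk>f \<in> Hom C X Y; g \<in> Hom C X Y; h \<in> Hom C X Y\<rbrakk>
      \<Longrightarrow> hadd C X Y f (hadd C X Y g h) = hadd C X Y g (hadd C X Y f h)"
    and hadd_zero_right: "f \<in> Hom C X Y \<Longrightarrow> hadd C X Y f (hzero C X Y) = f"
    and hadd_zero_left: "f \<in> Hom C X Y \<Longrightarrow> hadd C X Y (hzero C X Y) f = f"
    and hadd_neg_right: "f \<in> Hom C X Y \<Longrightarrow> hadd C X Y f (hneg C X Y f) = hzero C X Y"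
    and hadd_neg_left: "f \<in> Hom C X Y \<Longrightarrow> hadd C X Y (hneg C X Y f) f = hzero C X Y"
    and hadd_neg_cancel: "\<lbrakk>f \<in> Hom C X Y; g \<in> Hom C X Y\<rbrakk>
      \<Longrightarrow> hadd C X Y f (hadd C X Y (hneg C X Y f) g) = g"
    and hneg_add_cancel: "\<lbrakk>f \<in> Hom C X Y; g \<in> Hom C X Y\<rbrakk>
      \<Longrightarrow> hadd C X Y (hneg C X Y f) (hadd C X Y f g) = g"
    and hneg_neg: "f \<in> Hom C X Y \<Longrightarrow> hneg C X Y (hneg C X Y f) = f"
    and hneg_zero: "hneg C X Y (hzero C X Y) = hzero C X Y"
    and hneg_add: "\<lbrakk>f \<in> Hom C X Y; g \<in> Hom C X Y\<rbrakk>
      \<Longrightarrow> hneg C X Y (hadd C X Y f g) = hadd C X Y (hneg C X Y f) (hneg C X Y g)"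
    and hadd_left_cancel: "\<lbrakk>f \<in> Hom C X Y; g \<in> Hom C X Y; h \<in> Hom C X Y\<rbrakk>
      \<Longrightarrow> hadd C X Y f g = hadd C X Y f h \<longleftrightarrow> g = h"
proof -
  interpret G: abelian_group "HomG C X Y"
    using abelian_group_Hom assms .
  show "hzero C X Y \<in> Hom C X Y" "\<lbrakk>f \<in> Hom C X Y; g \<in> Hom C X Y\<rbrakk> \<Longrightarrow> hadd C X Y f g \<in> Hom C X Y"
    "f \<in> Hom C X Y \<Longrightarrow> hneg C X Y f \<in> Hom C X Y"
    using G.zero_closed G.a_closed[of f g] G.a_inv_closed[of f] by simp_all
  show "\<lbrakk>f \<in> Hom C X Y; g \<in> Hom C X Y; h \<in> Hom C X Y\<rbrakk>
      \<Longrightarrow> hadd C X Y (hadd C X Y f g) h = hadd C X Y f (hadd C X Y g h)"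
    "\<lbrakk>f \<in> Hom C X Y; g \<in> Hom C X Y\<rbrakk> \<Longrightarrow> hadd C X Y f g = hadd C X Y g f"
    "\<lbrakk>f \<in> Hom C X Y; g \<in> Hom C X Y; h \<in> Hom C X Y\<rbrakk>
      \<Longrightarrow> hadd C X Y f (hadd C X Y g h) = hadd C X Y g (hadd C X Y f h)"
    using G.a_assoc[of f g h] G.a_comm[of f g] G.a_lcomm[of f g h] by simp_all
  show "f \<in> Hom C X Y \<Longrightarrow> hadd C X Y f (hzero C X Y) = f"
    "f \<in> Hom C X Y \<Longrightarrow> hadd C X Y (hzero C X Y) f = f"
    "f \<in> Hom C X Y \<Longrightarrow> hadd C X Y f (hneg C X Y f) = hzero C X Y"
    "f \<in> Hom C X Y \<Longrightarrow> hadd C X Y (hneg C X Y f) f = hzero C X Y"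
    "f \<in> Hom C X Y \<Longrightarrow> hneg C X Y (hneg C X Y f) = f"
    using G.r_zero[of f] G.l_zero[of f] G.r_neg[of f] G.l_neg[of f]
      G.minus_minus[of f] by simp_all
  show "hneg C X Y (hzero C X Y) = hzero C X Y"
    using G.l_zero[of "\<ominus>\<^bsub>HomG C X Y\<^esub> hzero C X Y"] G.r_neg[of "hzero C X Y"]
      G.a_inv_closed G.zero_closed by simp
  show "\<lbrakk>f \<in> Hom C X Y; g \<in> Hom C X Y\<rbrakk>
      \<Longrightarrow> hadd C X Y f (hadd C X Y (hneg C X Y f) g) = g"
    "\<lbrakk>f \<in> Hom C X Y; g \<in> Hom C X Y\<rbrakk>
      \<Longrightarrow> hadd C X Y (hneg C X Y f) (hadd C X Y f g) = g"
    "\<lbrakk>f \<in> Hom C X Y; g \<in> Hom C X Y\<rbrakk>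
      \<Longrightarrow> hneg C X Y (hadd C X Y f g) = hadd C X Y (hneg C X Y f) (hneg C X Y g)"
    using G.r_neg2[of f g] G.r_neg1[of f g] G.minus_add[of f g] by simp_all
  show "\<lbrakk>f \<in> Hom C X Y; g \<in> Hom C X Y; h \<in> Hom C X Y\<rbrakk>
      \<Longrightarrow> hadd C X Y f g = hadd C X Y f h \<longleftrightarrow> g = h"
    using G.r_neg1[of f g] G.r_neg1[of f h] by (simp, metis)
qed

lemmas hadd_ac = hadd_assoc hadd_comm hadd_left_comm

lemma comp_zero_right:
  assumes "X \<in> Ob C" "Y \<in> Ob C" "Z \<in> Ob C" "g \<in> Hom C Y Z"
  shows "Comp C X Y Z g (hzero C X Y) = hzero C X Z"
proof -
  have "hadd C X Z (Comp C X Y Z g (hzero C X Y)) (Comp C X Y Z g (hzero C X Y))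
      = Comp C X Y Z g (hadd C X Y (hzero C X Y) (hzero C X Y))"
    using assms by (intro comp_add_right[symmetric]) (simp_all add: hzero_closed)
  also have "\<dots> = hadd C X Z (Comp C X Y Z g (hzero C X Y)) (hzero C X Z)"
    using assms by (simp add: hadd_zero_right hzero_closed comp_closed)
  finally show ?thesis
    using assms by (subst (asm) hadd_left_cancel) (simp_all add: hzero_closed comp_closed)
qed

lemma comp_zero_left:
  assumes "X \<in> Ob C" "Y \<in> Ob C" "Z \<in> Ob C" "f \<in> Hom C X Y"
  shows "Comp C X Y Z (hzero C Y Z) f = hzero C X Z"
proof -
  have "hadd C X Z (Comp C X Y Z (hzero C Y Z) f) (Comp C X Y Z (hzero C Y Z) f)
      = Comp C X Y Z (hadd C Y Z (hzero C Y Z) (hzero C Y Z)) f"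
    using assms by (intro comp_add_left[symmetric]) (simp_all add: hzero_closed)
  also have "\<dots> = hadd C X Z (Comp C X Y Z (hzero C Y Z) f) (hzero C X Z)"
    using assms by (simp add: hadd_zero_right hzero_closed comp_closed)
  finally show ?thesis
    using assms by (subst (asm) hadd_left_cancel) (simp_all add: hzero_closed comp_closed)
qed

lemma hneg_unique:
  assumes "X \<in> Ob C" "Y \<in> Ob C" "f \<in> Hom C X Y" "g \<in> Hom C X Y" "hadd C X Y f g = hzero C X Y"
  shows "g = hneg C X Y f"
  using assms hadd_left_cancel[of X Y f g "hneg C X Y f"] by (simp add: hadd_neg_right hneg_closed)

lemma comp_neg_right:
  assumes "X \<in> Ob C" "Y \<in> Ob C" "Z \<in> Ob C" "f \<in> Hom C X Y" "g \<in> Hom C Y Z"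
  shows "Comp C X Y Z g (hneg C X Y f) = hneg C X Z (Comp C X Y Z g f)"
  using assms by (intro hneg_unique)
    (simp_all add: hneg_closed comp_closed comp_add_right[symmetric] hadd_neg_right comp_zero_right)

lemma comp_neg_left:
  assumes "X \<in> Ob C" "Y \<in> Ob C" "Z \<in> Ob C" "f \<in> Hom C X Y" "g \<in> Hom C Y Z"
  shows "Comp C X Y Z (hneg C Y Z g) f = hneg C X Z (Comp C X Y Z g f)"
  using assms by (intro hneg_unique)
    (simp_all add: hneg_closed comp_closed comp_add_left[symmetric] hadd_neg_right comp_zero_left)

lemmas hom_closed = comp_closed ident_closed hzero_closed hadd_closed hneg_closed

text \<open>Normal form: sums of right-nested composites. Reordering of summands is kept out and
  supplied only where it is wanted.\<close>

lemmas hom_simps = hom_closed comp_ident_left comp_ident_right comp_add_left comp_add_right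
  comp_zero_left comp_zero_right comp_neg_left comp_neg_right hadd_zero_left hadd_zero_right
  hadd_neg_left hadd_neg_right hadd_neg_cancel hneg_add_cancel hneg_neg hneg_zero hneg_add
  comp_assoc_right

lemma eq_add_neg_iff:
  assumes "X \<in> Ob C" "Y \<in> Ob C" "f \<in> Hom C X Y" "g \<in> Hom C X Y" "h \<in> Hom C X Y"
  shows "hadd C X Y f (hneg C X Y g) = h \<longleftrightarrow> f = hadd C X Y g h"
proof
  assume "hadd C X Y f (hneg C X Y g) = h"
  then have "hadd C X Y g h = hadd C X Y g (hadd C X Y f (hneg C X Y g))" by simp
  also have "\<dots> = f"
    using assms by (simp add: hadd_left_comm[of X Y g f] hom_simps)
  finally show "f = hadd C X Y g h" by simp
next
  assume "f = hadd C X Y g h"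
  then show "hadd C X Y f (hneg C X Y g) = h"
    using assms by (simp add: hadd_comm[of X Y g h] hom_simps hadd_assoc)
qed

lemma add_eq_self_iff:
  assumes "X \<in> Ob C" "Y \<in> Ob C" "f \<in> Hom C X Y" "g \<in> Hom C X Y"
  shows "hadd C X Y f g = f \<longleftrightarrow> g = hzero C X Y"
  using assms hadd_left_cancel[of X Y f g "hzero C X Y"] by (simp add: hom_simps)

text \<open>The inverse of 1 + n is 1 - n.\<close>

lemma is_iso_add_square_zero:
  assumes ob: "X \<in> Ob C" and n: "n \<in> Hom C X X" "Comp C X X X n n = hzero C X X"
  shows "is_iso C X X (hadd C X X (Ident C X) n)"
  using assms by (intro is_isoI[where g = "hadd C X X (Ident C X) (hneg C X X n)"])
    (simp_all add: hom_simps hadd_assoc)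

lemma is_iso_Ident: "X \<in> Ob C \<Longrightarrow> is_iso C X X (Ident C X)"
  by (rule is_isoI[where g = "Ident C X"]) (simp_all add: hom_simps)

lemma zero_object_iff: "X \<in> Ob C \<Longrightarrow> zero_object C X \<longleftrightarrow> Ident C X = hzero C X X"
proof
  assume X: "X \<in> Ob C" and "zero_object C X"
  then show "Ident C X = hzero C X X"
    using hzero_closed[OF X X] ident_closed[OF X] by (auto simp: zero_object_def)
next
  assume X: "X \<in> Ob C" and eq: "Ident C X = hzero C X X"
  have "f = hzero C X Y" if "Y \<in> Ob C" "f \<in> Hom C X Y" for Y f
  proof -
    have "f = Comp C X X Y f (Ident C X)" using X that by (simp add: hom_simps)
    then show ?thesis using X that by (simp add: eq comp_zero_right)
  qed
  moreover have "f = hzero C Y X" if "Y \<in> Ob C" "f \<in> Hom C Y X" for Y f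
  proof -
    have "f = Comp C Y X X (Ident C X) f" using X that by (simp add: hom_simps)
    then show ?thesis using X that by (simp add: eq comp_zero_left)
  qed
  ultimately show "zero_object C X"
    using X hzero_closed unfolding zero_object_def by metis
qed

lemma zero_object_hom:
  assumes "zero_object C Z" "X \<in> Ob C"
  shows "f \<in> Hom C X Z \<Longrightarrow> f = hzero C X Z" and "f \<in> Hom C Z X \<Longrightarrow> f = hzero C Z X"
  using assms hzero_closed[of X Z] hzero_closed[of Z X] by (auto simp: zero_object_def)

lemma zero_object_ob: "zero_object C Z \<Longrightarrow> Z \<in> Ob C"
  by (simp add: zero_object_def)

section \<open>Biproducts: change of inclusion, isomorphic summands, regrouping\<close>

lemma biproductD:
  assumes "biproduct C X Y S i j p q"
  shows "X \<in> Ob C" "Y \<in> Ob C" "S \<in> Ob C"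
    "i \<in> Hom C X S" "j \<in> Hom C Y S" "p \<in> Hom C S X" "q \<in> Hom C S Y"
    "Comp C X S X p i = Ident C X" "Comp C Y S Y q j = Ident C Y"
    "Comp C Y S X p j = hzero C Y X" "Comp C X S Y q i = hzero C X Y"
    "hadd C S S (Comp C S X S i p) (Comp C S Y S j q) = Ident C S"
  using assms by (simp_all add: biproduct_def)

lemma biproduct_simps:
  assumes b: "biproduct C X Y S i j p q"
  shows "X \<in> Ob C" "Y \<in> Ob C" "S \<in> Ob C"
    "i \<in> Hom C X S" "j \<in> Hom C Y S" "p \<in> Hom C S X" "q \<in> Hom C S Y"
    "Comp C X S X p i = Ident C X" "Comp C Y S Y q j = Ident C Y"
    "Comp C Y S X p j = hzero C Y X" "Comp C X S Y q i = hzero C X Y"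
    "\<lbrakk>W \<in> Ob C; w \<in> Hom C W X\<rbrakk> \<Longrightarrow> Comp C W S X p (Comp C W X S i w) = w"
    "\<lbrakk>W \<in> Ob C; w \<in> Hom C W X\<rbrakk> \<Longrightarrow> Comp C W S Y q (Comp C W X S i w) = hzero C W Y"
    "\<lbrakk>W \<in> Ob C; w' \<in> Hom C W Y\<rbrakk> \<Longrightarrow> Comp C W S Y q (Comp C W Y S j w') = w'"
    "\<lbrakk>W \<in> Ob C; w' \<in> Hom C W Y\<rbrakk> \<Longrightarrow> Comp C W S X p (Comp C W Y S j w') = hzero C W X"
  using biproductD[OF b]
  by (simp_all add: comp_reassoc[OF biproductD(8)[OF b]] comp_reassoc[OF biproductD(9)[OF b]]
      comp_reassoc[OF biproductD(10)[OF b]] comp_reassoc[OF biproductD(11)[OF b]] hom_simps)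

lemma biproduct_decomp:
  assumes b: "biproduct C X Y S i j p q" and "W \<in> Ob C" "w \<in> Hom C W S"
  shows "hadd C W S (Comp C W X S i (Comp C W S X p w)) (Comp C W Y S j (Comp C W S Y q w)) = w"
proof -
  note bs = biproductD[OF b]
  have "Comp C W S S (hadd C S S (Comp C S X S i p) (Comp C S Y S j q)) w = w"
    using bs assms by (simp add: hom_simps)
  then show ?thesis
    using bs(1-7) assms by (simp add: hom_simps)
qed

lemma biproduct_decomp_dom:
  assumes b: "biproduct C X Y S i j p q" and "W \<in> Ob C" "w \<in> Hom C S W"
  shows "hadd C S W (Comp C S X W (Comp C X S W w i) p) (Comp C S Y W (Comp C Y S W w j) q) = w"
proof -
  note bs = biproductD[OF b]
  have "Comp C S S W w (hadd C S S (Comp C S X S i p) (Comp C S Y S j q)) = w"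
    using bs assms by (simp add: hom_simps)
  then show ?thesis
    using bs(1-7) assms by (simp add: hom_simps)
qed

lemma biproduct_ext_dom:
  assumes b: "biproduct C X Y S i j p q" and "W \<in> Ob C" "f \<in> Hom C S W" "g \<in> Hom C S W"
    and "Comp C X S W f i = Comp C X S W g i" "Comp C Y S W f j = Comp C Y S W g j"
  shows "f = g"
  using biproduct_decomp_dom[OF b, of W f] biproduct_decomp_dom[OF b, of W g] assms by metis

lemma biproduct_swap:
  assumes b: "biproduct C X Y S i j p q"
  shows "biproduct C Y X S j i q p"
  using biproductD[OF b] hadd_comm[of S S "Comp C S X S i p"]
  by (simp add: biproduct_def hom_closed)

lemma biproduct_zero_right:
  assumes "zero_object C Z" "X \<in> Ob C"
  shows "biproduct C X Z X (Ident C X) (hzero C Z X) (Ident C X) (hzero C X Z)"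
  using assms zero_object_ob[OF assms(1)] zero_object_iff[of Z]
  by (simp add: biproduct_def hom_simps)

text \<open>A section \<open>w\<close> of p is the graph of m = q w : X -> Y. Shearing by m keeps
  the complement \<open>j\<close> and the projection \<open>p\<close>; only q has to be corrected,
  to q - m p.\<close>

lemma biproduct_change_inclusion:
  assumes b: "biproduct C X Y S i j p q" and w: "w \<in> Hom C X S" "Comp C X S X p w = Ident C X"
  shows "biproduct C X Y S w j p
    (hadd C S Y q (hneg C S Y (Comp C S X Y (Comp C X S Y q w) p)))"
proof -
  note bs = biproduct_simps[OF b]
  have wd: "w = hadd C X S i (Comp C X Y S j (Comp C X S Y q w))"
    using biproduct_decomp[OF b, of X w] bs w by (simp add: hom_simps)
  define m where "m = Comp C X S Y q w"
  have m: "m \<in> Hom C X Y" using bs w by (simp add: m_def hom_simps)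
  let ?m = "Comp C S X Y m p"
  have "hadd C S S (Comp C S X S w p) (Comp C S Y S j (hadd C S Y q (hneg C S Y ?m))) = Ident C S"
  proof -
    have "hadd C S S (Comp C S X S w p) (Comp C S Y S j (hadd C S Y q (hneg C S Y ?m)))
      = hadd C S S (hadd C S S (Comp C S X S i p) (Comp C S Y S j ?m))
        (hadd C S S (Comp C S Y S j q) (hneg C S S (Comp C S Y S j ?m)))"
      by (subst wd) (use bs m in \<open>simp add: hom_simps flip: m_def\<close>)
    also have "\<dots> = hadd C S S (Comp C S X S i p) (Comp C S Y S j q)"
      using bs m by (simp add: hadd_assoc hom_simps hadd_left_comm[of S S "Comp C S Y S j ?m" "Comp C S Y S j q"])
    finally show ?thesis using biproductD(12)[OF b] by simp
  qed
  then show ?thesis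
    using bs w m by (simp add: biproduct_def hom_simps flip: m_def)
qed

lemma biproduct_iso_summand:
  assumes b: "biproduct C X Y S i j p q" and X': "X' \<in> Ob C"
    and t: "t \<in> Hom C X' X" "t' \<in> Hom C X X'" "Comp C X' X X' t' t = Ident C X'"
      "Comp C X X' X t t' = Ident C X"
  shows "biproduct C X' Y S (Comp C X' X S i t) j (Comp C S X X' t' p) q"
  using biproduct_simps[OF b] biproductD(12)[OF b] X' t
  by (simp add: biproduct_def hom_simps comp_reassoc[OF t(4)])

lemma biproduct_iso_sum:
  assumes b: "biproduct C X Y S i j p q" and S': "S' \<in> Ob C"
    and t: "t \<in> Hom C S S'" "t' \<in> Hom C S' S" "Comp C S S' S t' t = Ident C S"
      "Comp C S' S S' t t' = Ident C S'"
  shows "biproduct C X Y S' (Comp C X S S' t i) (Comp C Y S S' t j) (Comp C S' S X p t')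
    (Comp C S' S Y q t')"
proof -
  note bs = biproduct_simps[OF b]
  have "hadd C S' S' (Comp C S' X S' (Comp C X S S' t i) (Comp C S' S X p t'))
      (Comp C S' Y S' (Comp C Y S S' t j) (Comp C S' S Y q t'))
    = Comp C S' S S' t (hadd C S' S (Comp C S' X S i (Comp C S' S X p t'))
      (Comp C S' Y S j (Comp C S' S Y q t')))"
    using bs S' t by (simp add: hom_simps)
  also have "\<dots> = Ident C S'"
    using biproduct_decomp[OF b S' t(2)] t by simp
  finally show ?thesis
    using bs S' t by (simp add: biproduct_def hom_simps comp_reassoc[OF t(3)])
qed

text \<open>X + (X' + Y') regrouped as X' + (X + Y'). This brings a summand of Y to the front of S
  in \<open>exchange\<close>.\<close>

lemma biproduct_assoc:
  assumes b: "biproduct C X Y S i j p q" and b': "biproduct C X' Y' Y i' j' p' q'"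
    and c: "biproduct C X Y' V k l k' l'"
  shows "biproduct C X' V S (Comp C X' Y S j i')
    (hadd C V S (Comp C V X S i k') (Comp C V Y' S (Comp C Y' Y S j j') l'))
    (Comp C S Y X' p' q)
    (hadd C S V (Comp C S X V k p) (Comp C S Y' V l (Comp C S Y Y' q' q)))"
proof -
  note bs = biproduct_simps[OF b] biproduct_simps[OF b'] biproduct_simps[OF c]
  let ?i = "Comp C X' Y S j i'"
  let ?j = "hadd C V S (Comp C V X S i k') (Comp C V Y' S (Comp C Y' Y S j j') l')"
  let ?q = "hadd C S V (Comp C S X V k p) (Comp C S Y' V l (Comp C S Y Y' q' q))"
  have 1: "Comp C V S V ?q ?j = Ident C V"
    using bs biproductD(12)[OF c] by (simp add: hom_simps)
  have d: "hadd C S Y (Comp C S X' Y i' (Comp C S Y X' p' q)) (Comp C S Y' Y j' (Comp C S Y Y' q' q)) = q"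
    using biproduct_decomp[OF b', of S q] bs by simp
  have "hadd C S S (Comp C S X' S ?i (Comp C S Y X' p' q)) (Comp C S V S ?j ?q)
    = hadd C S S (Comp C S X S i p) (Comp C S Y S j
      (hadd C S Y (Comp C S X' Y i' (Comp C S Y X' p' q)) (Comp C S Y' Y j' (Comp C S Y Y' q' q))))"
    using bs by (simp add: hom_simps hadd_ac)
  also have "\<dots> = Ident C S" using biproductD(12)[OF b] d by simp
  finally show ?thesis
    using 1 bs by (simp add: biproduct_def hom_simps)
qed

end

section \<open>Krull-Schmidt decompositions\<close>

text \<open>Locality of the endomorphism ring in the form in which it is applied: of s and 1 - s,
  one is invertible.\<close>

definition local_object :: "('o, 'm, 'z) pcat_scheme \<Rightarrow> 'o \<Rightarrow> bool" where
  "local_object C X \<longleftrightarrow> X \<in> Ob C \<and> \<not> zero_object C X \<and>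
     (\<forall>s\<in>Hom C X X. is_iso C X X s \<or> is_iso C X X (hadd C X X (Ident C X) (hneg C X X s)))"

text \<open>A Krull-Schmidt decomposition with its local summands peeled off one at a time, so that
  inductions need no indexed families. Uniqueness of the length is not claimed.\<close>

inductive local_length :: "('o, 'm, 'z) pcat_scheme \<Rightarrow> nat \<Rightarrow> 'o \<Rightarrow> bool"
  for C :: "('o, 'm, 'z) pcat_scheme" where
  zero: "zero_object C Z \<Longrightarrow> local_length C 0 Z"
| add: "\<lbrakk>biproduct C X Y S i j p q; local_object C X; local_length C n Y\<rbrakk>
    \<Longrightarrow> local_length C (Suc n) S"

context preadditive_category
begin

lemma local_length_ob: "local_length C n S \<Longrightarrow> S \<in> Ob C"
  by (cases rule: local_length.cases) (auto simp: zero_object_def biproduct_def)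

text \<open>If e is invertible, cancel it in e e = e; if 1 - e is invertible, cancel it in (1 - e) e
  = 0.\<close>

lemma local_object_idempotent:
  assumes X: "local_object C X" and e: "e \<in> Hom C X X" "Comp C X X X e e = e"
  shows "e = Ident C X \<or> e = hzero C X X"
proof -
  have ob: "X \<in> Ob C" using X by (simp add: local_object_def)
  have inj: "a = b" if "is_iso C X X s" "a \<in> Hom C X X" "b \<in> Hom C X X"
    "Comp C X X X s a = Comp C X X X s b" for s a b
  proof -
    note a = that
    obtain t where t: "t \<in> Hom C X X" "s \<in> Hom C X X" "Comp C X X X t s = Ident C X"
      using a(1) by (auto simp: is_iso_def)
    have "a = Comp C X X X (Comp C X X X t s) a" using t ob a by (simp add: hom_simps)
    also have "\<dots> = Comp C X X X (Comp C X X X t s) b"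
      using t(1,2) ob a by (simp add: hom_simps)
    also have "\<dots> = b" using t ob a by (simp add: hom_simps)
    finally show ?thesis .
  qed
  consider "is_iso C X X e" | "is_iso C X X (hadd C X X (Ident C X) (hneg C X X e))"
    using X e by (auto simp: local_object_def)
  then show ?thesis
  proof cases
    case 1
    then show ?thesis using inj[OF 1 e(1), of "Ident C X"] ob e by (simp add: hom_simps)
  next
    case 2
    then show ?thesis using inj[OF 2 e(1), of "hzero C X X"] ob e by (simp add: hom_simps)
  qed
qed

text \<open>For a decomposition into U and V the idempotent i p is 1 or 0, which annihilates the
  identity of V or of U.\<close>

lemma local_object_indecomposable:
  assumes X: "local_object C X"
  shows "indecomposable C X"
proof -
  have ob: "X \<in> Ob C" "\<not> zero_object C X" using X by (simp_all add: local_object_def)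
  have "zero_object C U \<or> zero_object C V" if "biproduct C U V X i j p q" for U V i j p q
  proof -
    note bs = biproduct_simps[OF that]
    let ?e = "Comp C X U X i p"
    have "Comp C X X X ?e ?e = ?e" using bs by (simp add: hom_simps)
    then consider "?e = Ident C X" | "?e = hzero C X X"
      using local_object_idempotent[OF X, of ?e] bs by (auto simp: hom_simps)
    then show ?thesis
    proof cases
      case 1
      have "Comp C V X V q (Comp C V X X ?e j) = hzero C V V"
        using bs by (simp add: hom_simps)
      then have "Ident C V = hzero C V V" using 1 bs by (simp add: hom_simps)
      then show ?thesis using zero_object_iff bs by blast
    next
      case 2
      have "Comp C U X U p (Comp C U X X ?e i) = Ident C U"
        using bs by (simp add: hom_simps)
      then have "Ident C U = hzero C U U" using 2 bs by (simp add: hom_simps)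
      then show ?thesis using zero_object_iff bs by blast
    qed
  qed
  then show ?thesis using ob unfolding indecomposable_def direct_sum_def by blast
qed

lemma local_object_iso:
  assumes X: "local_object C X" and Y: "Y \<in> Ob C"
    and t: "t \<in> Hom C X Y" "t' \<in> Hom C Y X" "Comp C X Y X t' t = Ident C X"
      "Comp C Y X Y t t' = Ident C Y"
  shows "local_object C Y"
proof -
  have ob: "X \<in> Ob C" "Ident C X \<noteq> hzero C X X" using X zero_object_iff by (auto simp: local_object_def)
  have "Ident C Y \<noteq> hzero C Y Y"
  proof
    assume "Ident C Y = hzero C Y Y"
    then have "Comp C X Y Y (Ident C Y) t = hzero C X Y" using ob Y t by (simp add: comp_zero_left)
    then have "t = hzero C X Y" using ob Y t by (simp add: hom_simps)
    then show False using t(3) ob Y t(2) by (simp add: hom_simps)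
  qed
  moreover have "is_iso C Y Y s \<or> is_iso C Y Y (hadd C Y Y (Ident C Y) (hneg C Y Y s))"
    if s: "s \<in> Hom C Y Y" for s
  proof -
    have tr: "is_iso C Y Y (Comp C Y X Y t (Comp C Y X X r t'))" if "is_iso C X X r" for r
    proof -
      have "is_iso C X Y t" "is_iso C Y X t'" using t by (auto simp: is_iso_def)
      then show ?thesis using ob Y that by (intro is_iso_comp[of Y X Y] is_iso_comp[of Y X X]) auto
    qed
    let ?s = "Comp C X Y X t' (Comp C X Y Y s t)"
    have "is_iso C X X ?s \<or> is_iso C X X (hadd C X X (Ident C X) (hneg C X X ?s))"
      using X ob Y t s by (auto simp: local_object_def hom_closed)
    moreover have "Comp C Y X Y t (Comp C Y X X ?s t') = s"
      using ob Y t s by (simp add: hom_simps comp_reassoc[OF t(4)])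
    moreover have "Comp C Y X Y t (Comp C Y X X (hadd C X X (Ident C X) (hneg C X X ?s)) t')
      = hadd C Y Y (Ident C Y) (hneg C Y Y s)"
      using ob Y t s by (simp add: hom_simps comp_reassoc[OF t(4)])
    ultimately show ?thesis using tr by metis
  qed
  ultimately show ?thesis using Y zero_object_iff by (auto simp: local_object_def)
qed

lemma local_length_iso:
  assumes S: "local_length C n S" and S': "S' \<in> Ob C"
    and t: "t \<in> Hom C S S'" "t' \<in> Hom C S' S" "Comp C S S' S t' t = Ident C S"
      "Comp C S' S S' t t' = Ident C S'"
  shows "local_length C n S'"
  using S
proof cases
  case zero
  have "Comp C S' S' S' (Ident C S') (Ident C S') = Comp C S' S S' t t'" using S' t by (simp add: hom_simps)
  moreover have "t = hzero C S S'" using zero_object_hom(2)[OF zero(2)] S' t by blast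
  ultimately have "Ident C S' = hzero C S' S'"
    using S' t zero_object_ob[OF zero(2)] by (simp add: hom_simps)
  then show ?thesis using zero(1) S' zero_object_iff local_length.zero by metis
next
  case (add X Y i j p q n)
  then show ?thesis using local_length.add[OF biproduct_iso_sum[OF add(2) S' t]] by simp
qed

text \<open>Since r sends i to i', its matrix from the first biproduct to the second is triangular
  with diagonal entries 1 and q' r j. Both biproducts share the inclusion \<open>j\<close>.\<close>

lemma iso_triangular:
  assumes b: "biproduct C X Y S i j p q" and b': "biproduct C X Y S i' j p' q'"
    and r: "r \<in> Hom C S S" "Comp C X S S r i = i'"
    and m: "is_iso C Y Y (Comp C Y S Y q' (Comp C Y S S r j))"
  shows "is_iso C S S r"
proof -
  note bs = biproduct_simps[OF b] biproduct_simps[OF b']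
  obtain m where m: "m \<in> Hom C Y Y"
      "Comp C Y Y Y m (Comp C Y S Y q' (Comp C Y S S r j)) = Ident C Y"
      "Comp C Y Y Y (Comp C Y S Y q' (Comp C Y S S r j)) m = Ident C Y"
    using m by (auto simp: is_iso_def)
  have rj: "Comp C Y S S r j = hadd C Y S (Comp C Y X S i' (Comp C Y S X p' (Comp C Y S S r j)))
      (Comp C Y Y S j (Comp C Y S Y q' (Comp C Y S S r j)))"
    using biproduct_decomp[OF b', of Y "Comp C Y S S r j"] bs r by (simp add: hom_simps)
  define k where "k = Comp C Y S X p' (Comp C Y S S r j)"
  define l where "l = Comp C Y S Y q' (Comp C Y S S r j)"
  have kl: "k \<in> Hom C Y X" "l \<in> Hom C Y Y" using bs r by (simp_all add: k_def l_def hom_simps)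
  have rj: "Comp C Y S S r j = hadd C Y S (Comp C Y X S i' k) (Comp C Y Y S j l)"
    using rj by (simp add: k_def l_def)
  have lm: "Comp C Y Y Y m l = Ident C Y" "Comp C Y Y Y l m = Ident C Y"
    using m by (simp_all add: l_def)
  \<comment> \<open>The off-diagonal entry k is removed by changing the second inclusion: v = j - i
    k satisfies r v = j l.\<close>
  define v where "v = hadd C Y S j (hneg C Y S (Comp C Y X S i k))"
  have v: "v \<in> Hom C Y S" using bs kl by (simp add: v_def hom_simps)
  have rv: "Comp C Y S S r v = Comp C Y Y S j l"
  proof -
    have "Comp C Y S S r v
      = hadd C Y S (hadd C Y S (Comp C Y X S i' k) (Comp C Y Y S j l)) (hneg C Y S (Comp C Y X S i' k))"
      using bs r(1) kl by (simp add: v_def hom_simps comp_reassoc[OF r(2)] flip: rj)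
    then show ?thesis
      using bs kl by (simp add: hom_simps hadd_assoc hadd_comm[of Y S "Comp C Y Y S j l"])
  qed
  \<comment> \<open>The inverse is forced by r i = i' and r v = j l, where m inverts l.\<close>
  let ?w = "hadd C S S (Comp C S X S i p') (Comp C S Y S v (Comp C S Y Y m q'))"
  have 1: "Comp C S S S r ?w = Ident C S"
  proof -
    have "Comp C S S S r ?w = hadd C S S (Comp C S X S i' p') (Comp C S Y S j q')"
      using bs r(1) v m(1) kl by (simp add: hom_simps comp_reassoc[OF r(2)] comp_reassoc[OF rv]
        comp_reassoc[OF lm(2)])
    then show ?thesis using biproductD(12)[OF b'] by simp
  qed
  have 2: "Comp C S S S ?w r = Ident C S"
  proof (rule biproduct_ext_dom[OF b])
    show "Comp C X S S (Comp C S S S ?w r) i = Comp C X S S (Ident C S) i"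
      using bs r v m(1) kl by (simp add: hom_simps)
    have "Comp C Y S S (Comp C S S S ?w r) j = hadd C Y S (Comp C Y X S i k) v"
      using bs r(1) v m(1) kl by (simp add: hom_simps rj comp_reassoc[OF lm(1)] lm(1))
    also have "\<dots> = j" using bs kl by (simp add: v_def hom_simps hadd_left_comm[of Y S "Comp C Y X S i k" j])
    finally show "Comp C Y S S (Comp C S S S ?w r) j = Comp C Y S S (Ident C S) j"
      using bs by (simp add: hom_simps)
  qed (use bs r v m(1) in \<open>simp_all add: hom_simps\<close>)
  show ?thesis using 1 2 bs r v m(1) by (intro is_isoI[where g = ?w]) (simp_all add: hom_simps)
qed

end

context additive_category
begin

text \<open>An endomorphism \<open>s\<close> such that \<open>1 - s\<close> is not invertible lies outside the radical, so it has an
  invertible component between two local summands.\<close>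

lemma exchange:
  assumes "local_length C n S" and "s \<in> Hom C S S"
  shows "is_iso C S S (hadd C S S (Ident C S) (hneg C S S s)) \<or>
    (\<exists>m X S' w w' j p q. n = Suc m \<and> local_object C X \<and> local_length C m S' \<and>
       biproduct C X S' S w j p q \<and> w' \<in> Hom C X S \<and> w = Comp C X S S s w')"
  using assms
proof (induction arbitrary: s rule: local_length.induct)
  case (zero Z)
  have Z: "Z \<in> Ob C" using zero by (simp add: zero_object_def)
  have "hadd C Z Z (Ident C Z) (hneg C Z Z s) = Ident C Z"
    using zero_object_hom(1)[OF zero(1) Z] Z zero(2) by (metis hom_closed(2,4,5))
  then show ?case using is_iso_Ident[OF Z] by simp
next
  case (add X Y S i j p q n)
  note s = \<open>s \<in> Hom C S S\<close>
  note bs = biproduct_simps[OF add(1)]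
  let ?s = "Comp C X S X p (Comp C X S S s i)"
  let ?r = "hadd C S S (Ident C S) (hneg C S S s)"
  have r: "?r \<in> Hom C S S" using bs s by (simp add: hom_simps)
  have "?s \<in> Hom C X X" using bs s by (simp add: hom_closed)
  then consider "is_iso C X X ?s" | "is_iso C X X (hadd C X X (Ident C X) (hneg C X X ?s))"
    using add(2) unfolding local_object_def by blast
  then show ?case
  proof cases
    case 1
    then obtain t where t: "t \<in> Hom C X X" "Comp C X X X ?s t = Ident C X"
      by (auto simp: is_iso_def)
    \<comment> \<open>Normalised by t so that p s w' = 1: then s w' is a section of p and can
      replace the inclusion i.\<close>
    let ?w' = "Comp C X X S i t"
    let ?w = "Comp C X S S s ?w'"
    have w: "?w \<in> Hom C X S" "Comp C X S X p ?w = Ident C X" "?w' \<in> Hom C X S"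
      using t bs s by (simp_all add: hom_simps)
    show ?thesis
      using biproduct_change_inclusion[OF add(1) w(1,2)] add(2,3) w by blast
  next
    case 2
    \<comment> \<open>Here r = 1 - s has an invertible entry on X, so r i is again the inclusion of
      a complement of \<open>j\<close>, up to rescaling the projection by the inverse k of that
      entry.\<close>
    let ?i = "Comp C X S S ?r i"
    have "Comp C X S X p ?i = hadd C X X (Ident C X) (hneg C X X ?s)"
      using bs s by (simp add: hom_simps)
    then obtain k where k: "k \<in> Hom C X X" "Comp C X X X k (Comp C X S X p ?i) = Ident C X"
      "Comp C X X X (Comp C X S X p ?i) k = Ident C X"
      using 2 by (auto simp: is_iso_def)
    define i' where "i' = ?i"
    define p' where "p' = Comp C S X X k p"
    have i': "i' \<in> Hom C X S" and p': "p' \<in> Hom C S X" using bs r k by (simp_all add: i'_def p'_def hom_closed)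
    have ri: "Comp C X S S ?r i = i'" by (simp add: i'_def)
    have pi: "Comp C X S X p i' \<in> Hom C X X" using bs i' by (simp add: hom_simps)
    have b2: "biproduct C X Y S (Comp C X X S i (Comp C X S X p i')) j p' q"
      using biproduct_iso_summand[OF add(1) bs(1) pi k(1)] k(2,3) by (simp add: i'_def p'_def)
    have pi': "Comp C X S X p' i' = Ident C X"
      using bs k i' by (simp add: p'_def hom_simps i'_def[symmetric])
    obtain q' where b': "biproduct C X Y S i' j p' q'"
      using biproduct_change_inclusion[OF b2 i' pi'] by blast
    note bs' = biproduct_simps[OF b']
    \<comment> \<open>The remaining diagonal entry of r (its Schur complement). The induction
      hypothesis is applied to s' = 1 - u: either u, and with it r, is invertible, or s' yields a
      local summand of Y.\<close>
    define u where "u = Comp C Y S Y q' (Comp C Y S S ?r j)"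
    have u: "u \<in> Hom C Y Y" using bs bs' r by (simp add: u_def hom_closed)
    define s' where "s' = hadd C Y Y (Ident C Y) (hneg C Y Y u)"
    have s': "s' \<in> Hom C Y Y" using bs u by (simp add: s'_def hom_closed)
    have us': "hadd C Y Y (Ident C Y) (hneg C Y Y s') = u"
      using bs u by (simp add: s'_def hom_simps)
    show ?thesis
      using add.IH[OF s']
    proof (elim disjE exE conjE)
      assume "is_iso C Y Y (hadd C Y Y (Ident C Y) (hneg C Y Y s'))"
      then have "is_iso C Y Y u" by (simp add: us')
      then have "is_iso C S S ?r"
        using iso_triangular[OF add(1) b' r ri] by (simp add: u_def)
      then show ?thesis by blast
    next
      fix m X' Y' w w' j' p1 q1
      assume n: "n = Suc m" and loc: "local_object C X'" "local_length C m Y'"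
        and c: "biproduct C X' Y' Y w j' p1 q1" and w': "w' \<in> Hom C X' Y" "w = Comp C X' Y Y s' w'"
      note cs = biproduct_simps[OF c]
      obtain V kk l k' l' where V: "biproduct C X Y' V kk l k' l'"
        using ex_direct_sum[OF bs(1) cs(2)] by (auto simp: direct_sum_def)
      have lenV: "local_length C n V" using local_length.add[OF V add(2) loc(2)] n by simp
      note dec = biproduct_assoc[OF add(1) c V]
      \<comment> \<open>A factorisation through s' on Y has to become one through s on S. With y = j
        - i z and r y = j u one gets s y = y - j u, whose Y-component is 1 - u = s'.\<close>
      have "\<exists>z\<in>Hom C Y X. \<exists>y\<in>Hom C Y S. Comp C Y S S s y = hadd C Y S (Comp C Y Y S j s') (Comp C Y X S i z)"
      proof -
        define z where "z = Comp C Y S X p' (Comp C Y S S ?r j)"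
        have z: "z \<in> Hom C Y X" using bs bs' r by (simp add: z_def hom_closed)
        define y where "y = hadd C Y S j (hneg C Y S (Comp C Y X S i z))"
        have y: "y \<in> Hom C Y S" using bs z by (simp add: y_def hom_closed)
        have rj: "Comp C Y S S ?r j = hadd C Y S (Comp C Y X S i' z) (Comp C Y Y S j u)"
          using biproduct_decomp[OF b', of Y "Comp C Y S S ?r j"] bs r
          by (simp add: z_def u_def comp_closed)
        have "Comp C Y S S ?r y = hadd C Y S (Comp C Y S S ?r j)
            (hneg C Y S (Comp C Y S S ?r (Comp C Y X S i z)))"
          using bs r z by (simp add: y_def comp_add_right comp_neg_right hom_closed)
        also have "\<dots> = hadd C Y S (hadd C Y S (Comp C Y X S i' z) (Comp C Y Y S j u))
            (hneg C Y S (Comp C Y X S i' z))"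
          using comp_reassoc[OF ri bs(2) bs(1) bs(3) bs(3) bs(4) r z] rj by simp
        also have "\<dots> = Comp C Y Y S j u"
          using bs i' z u by (simp add: hadd_assoc hadd_comm[of Y S "Comp C Y Y S j u"] hom_simps)
        finally have ry: "Comp C Y S S ?r y = Comp C Y Y S j u" .
        have "Comp C Y S S ?r y = hadd C Y S y (hneg C Y S (Comp C Y S S s y))"
          using bs s y by (simp add: comp_add_left comp_neg_left hom_closed comp_ident_left)
        then have "y = hadd C Y S (Comp C Y S S s y) (Comp C Y Y S j u)"
          using eq_add_neg_iff[of Y S y "Comp C Y S S s y" "Comp C Y Y S j u"] ry bs s y u
          by (simp add: hom_closed)
        then have "Comp C Y S S s y = hadd C Y S y (hneg C Y S (Comp C Y Y S j u))"
          using eq_add_neg_iff[of Y S y "Comp C Y Y S j u" "Comp C Y S S s y"]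
            hadd_comm[of Y S "Comp C Y Y S j u" "Comp C Y S S s y"] bs s y u
          by (simp add: hom_closed)
        also have "\<dots> = hadd C Y S (Comp C Y Y S j s') (Comp C Y X S i (hneg C Y X z))"
          using bs z u by (simp add: y_def s'_def hom_simps hadd_ac)
        finally show ?thesis using y z bs by (meson hneg_closed)
      qed
      then obtain z y where zy: "z \<in> Hom C Y X" "y \<in> Hom C Y S"
        "Comp C Y S S s y = hadd C Y S (Comp C Y Y S j s') (Comp C Y X S i z)" by blast
      let ?W' = "Comp C X' Y S y w'"
      let ?W = "Comp C X' S S s ?W'"
      have W': "?W' \<in> Hom C X' S" "?W \<in> Hom C X' S"
        using bs cs zy w' s by (simp_all add: hom_closed)
      have "Comp C X' S Y q ?W = w"
        using bs cs zy(1,2) w' s s' by (simp add: comp_reassoc[OF zy(3)] hom_simps)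
      then have "Comp C X' S X' (Comp C S Y X' p1 q) ?W = Ident C X'"
        using bs cs W' by (simp add: comp_assoc_right)
      then show ?thesis
        using biproduct_change_inclusion[OF dec W'(2)] loc(1) lenV W'(1) by blast
    qed
  qed
qed

text \<open>Splitting of idempotents is not assumed, so the complement comes from
  \<open>exchange\<close> applied to e = i p: 1 - e kills the nonzero map i and is not invertible.
  The summand X so obtained has an inclusion factoring through e, hence through A, and is then
  identified with A.\<close>

lemma local_retract_complement:
  assumes A: "local_object C A" and S: "local_length C n S"
    and i: "i \<in> Hom C A S" and p: "p \<in> Hom C S A" and pi: "Comp C A S A p i = Ident C A"
  shows "\<exists>S' j p' q. biproduct C A S' S i j p' q"
proof -
  have ob: "A \<in> Ob C" "S \<in> Ob C" using A local_length_ob[OF S] by (simp_all add: local_object_def)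
  have A0: "Ident C A \<noteq> hzero C A A" using A zero_object_iff by (auto simp: local_object_def)
  let ?e = "Comp C S A S i p"
  have e: "?e \<in> Hom C S S" using ob i p by (simp add: hom_closed)
  have "\<not> is_iso C S S (hadd C S S (Ident C S) (hneg C S S ?e))"
  proof
    assume "is_iso C S S (hadd C S S (Ident C S) (hneg C S S ?e))"
    then obtain t where t: "t \<in> Hom C S S"
      "Comp C S S S t (hadd C S S (Ident C S) (hneg C S S ?e)) = Ident C S"
      by (auto simp: is_iso_def)
    have "i = Comp C A S S (Comp C S S S t (hadd C S S (Ident C S) (hneg C S S ?e))) i"
      using t ob i by (simp add: hom_simps)
    also have "\<dots> = hzero C A S" using t(1) ob i p by (simp add: hom_simps pi)
    finally have "i = hzero C A S" .
    then show False using pi A0 ob p by (simp add: hom_simps)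
  qed
  then obtain X S' w w' j \<pi> q where X: "local_object C X" and b: "biproduct C X S' S w j \<pi> q"
    and w': "w' \<in> Hom C X S" "w = Comp C X S S ?e w'"
    using exchange[OF S e] by blast
  note bs = biproduct_simps[OF b]
  have X0: "Ident C X \<noteq> hzero C X X" using X zero_object_iff by (auto simp: local_object_def)
  let ?v = "Comp C X S A p w" and ?u = "Comp C A S X \<pi> i"
  have iv: "Comp C X A S i ?v = w"
    using ob bs i p w' by (simp add: hom_simps comp_reassoc[OF pi])
  have uv: "Comp C X A X ?u ?v = Ident C X" using ob bs i p iv by (simp add: hom_simps)
  \<comment> \<open>From u v = 1 the map v u is idempotent, so it is 1 or 0 because A is local; it
    is not 0, since u (v u) v = 1 on a nonzero object.\<close>
  have vu: "Comp C A X A ?v ?u = Ident C A"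
  proof -
    have "Comp C A A A (Comp C A X A ?v ?u) (Comp C A X A ?v ?u)
      = Comp C A X A ?v (Comp C A X X (Comp C X A X ?u ?v) ?u)"
      using ob bs(1-7) i p by (simp add: hom_simps)
    also have "\<dots> = Comp C A X A ?v ?u" using uv ob bs(1-7) i p by (simp add: hom_simps)
    finally consider "Comp C A X A ?v ?u = Ident C A" | "Comp C A X A ?v ?u = hzero C A A"
      using local_object_idempotent[OF A, of "Comp C A X A ?v ?u"] ob bs i p by (auto simp: hom_closed)
    then show ?thesis
    proof cases
      case 2
      have "Comp C X A X ?u (Comp C X A A (Comp C A X A ?v ?u) ?v)
        = Comp C X X X (Comp C X A X ?u ?v) (Comp C X A X ?u ?v)"
        using ob bs(1-7) i p by (simp add: hom_simps)
      also have "\<dots> = Ident C X" using uv ob bs(1-7) by (simp add: hom_simps)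
      finally show ?thesis using 2 X0 ob bs(1-7) i p by (simp add: hom_simps)
    qed
  qed
  have "biproduct C A S' S (Comp C A X S w ?u) j (Comp C S X A ?v \<pi>) q"
    using biproduct_iso_summand[OF b ob(1) _ _ vu uv] ob bs i p by (simp add: hom_closed)
  moreover have "Comp C A X S w ?u = i"
  proof -
    have "Comp C A X S w ?u = Comp C A A S i (Comp C A X A ?v ?u)"
      using ob bs i p w'(1) by (simp add: comp_assoc comp_closed iv del: w'(2))
    then show ?thesis using vu ob i by (simp add: hom_simps)
  qed
  ultimately show ?thesis by metis
qed

text \<open>The first local summand peeled off is nonzero, so its complement is zero and the summand
  is isomorphic to A.\<close>

lemma indecomposable_local:
  assumes A: "indecomposable C A" and S: "local_length C n A"
  shows "local_object C A"
  using S
proof cases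
  case zero
  then show ?thesis using A by (simp add: indecomposable_def)
next
  case (add X Y i j p q n)
  note bs = biproduct_simps[OF add(2)]
  have "zero_object C Y"
    using A add(2,3) unfolding indecomposable_def direct_sum_def local_object_def by blast
  then have "j = hzero C Y A" using zero_object_hom(2) bs by blast
  then have "Comp C A X A i p = Ident C A"
    using biproductD(12)[OF add(2)] bs(1-7) by (simp add: hom_simps)
  then show ?thesis using local_object_iso[OF add(3) bs(3,4,6,8)] by simp
qed

end

section \<open>From indexed sums of objects with local endomorphism rings to
  \<open>local_length\<close>\<close>

lemma (in preadditive_category) local_object_if_local_ring:
  assumes X: "X \<in> Ob C" and loc: "local_ring (End_ring C X)"
  shows "local_object C X"
proof -
  have U: "x \<in> Units (End_ring C X) \<longleftrightarrow> is_iso C X X x" for x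
    by (auto simp: Units_def End_ring_def is_iso_def)
  have "is_iso C X X s \<or> is_iso C X X (hadd C X X (Ident C X) (hneg C X X s))"
    if s: "s \<in> Hom C X X" for s
  proof (rule ccontr)
    assume n: "\<not> ?thesis"
    let ?t = "hadd C X X (Ident C X) (hneg C X X s)"
    have c: "carrier (End_ring C X) = Hom C X X" by (simp add: End_ring_def)
    have "s \<in> carrier (End_ring C X) - Units (End_ring C X)"
      "?t \<in> carrier (End_ring C X) - Units (End_ring C X)"
      using n s X by (simp_all add: U c hom_closed)
    then have "s \<oplus>\<^bsub>End_ring C X\<^esub> ?t \<notin> Units (End_ring C X)"
      using loc by (simp add: local_ring_def)
    moreover have "s \<oplus>\<^bsub>End_ring C X\<^esub> ?t = Ident C X"
      using X s by (simp add: End_ring_def hom_simps hadd_left_comm[of X X s "Ident C X"])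
    ultimately show False using U is_iso_Ident[OF X] by simp
  qed
  moreover have "Ident C X \<noteq> hzero C X X" using loc by (simp add: local_ring_def End_ring_def)
  ultimately show ?thesis using X zero_object_iff by (simp add: local_object_def)
qed

lemma (in abelian_group_hom) hom_finsum_lessThan:
  assumes "\<And>a. a < (n::nat) \<Longrightarrow> f a \<in> carrier G"
  shows "h (\<Oplus>\<^bsub>G\<^esub>a\<in>{..<n}. f a) = (\<Oplus>\<^bsub>H\<^esub>a\<in>{..<n}. h (f a))"
  using assms
proof (induction n)
  case (Suc n)
  have "h (\<Oplus>\<^bsub>G\<^esub>a\<in>insert n {..<n}. f a) = h (f n) \<oplus>\<^bsub>H\<^esub> h (\<Oplus>\<^bsub>G\<^esub>a\<in>{..<n}. f a)"
    using Suc.prems by (subst G.finsum_insert) (auto intro!: hom_add G.finsum_closed)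
  also have "\<dots> = (\<Oplus>\<^bsub>H\<^esub>a\<in>insert n {..<n}. h (f a))"
    using Suc by (subst H.finsum_insert) auto
  finally show ?case by (simp add: lessThan_Suc)
qed simp

context preadditive_category
begin

lemma comp_right_hom:
  assumes "X \<in> Ob C" "Y \<in> Ob C" "Z \<in> Ob C" "g \<in> Hom C Y Z"
  shows "abelian_group_hom (HomG C X Y) (HomG C X Z) (Comp C X Y Z g)"
proof (rule abelian_group_homI)
  interpret G: abelian_group "HomG C X Y" using abelian_group_Hom assms by blast
  interpret H: abelian_group "HomG C X Z" using abelian_group_Hom assms by blast
  show "abelian_group (HomG C X Y)" "abelian_group (HomG C X Z)" by unfold_locales
  show "group_hom (add_monoid (HomG C X Y)) (add_monoid (HomG C X Z)) (Comp C X Y Z g)"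
    using assms by unfold_locales (simp add: hom_def comp_closed comp_add_right)
qed

lemma comp_left_hom:
  assumes "X \<in> Ob C" "Y \<in> Ob C" "Z \<in> Ob C" "f \<in> Hom C X Y"
  shows "abelian_group_hom (HomG C Y Z) (HomG C X Z) (\<lambda>g. Comp C X Y Z g f)"
proof (rule abelian_group_homI)
  interpret G: abelian_group "HomG C Y Z" using abelian_group_Hom assms by blast
  interpret H: abelian_group "HomG C X Z" using abelian_group_Hom assms by blast
  show "abelian_group (HomG C Y Z)" "abelian_group (HomG C X Z)" by unfold_locales
  show "group_hom (add_monoid (HomG C Y Z)) (add_monoid (HomG C X Z)) (\<lambda>g. Comp C X Y Z g f)"
    using assms by unfold_locales (simp add: hom_def comp_closed comp_add_left)
qed

lemma finsum_closed_Hom: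
  assumes "X \<in> Ob C" "Y \<in> Ob C" "\<And>a. a < (n::nat) \<Longrightarrow> f a \<in> Hom C X Y"
  shows "(\<Oplus>\<^bsub>HomG C X Y\<^esub>a\<in>{..<n}. f a) \<in> Hom C X Y"
proof -
  interpret G: abelian_group "HomG C X Y" using abelian_group_Hom assms by blast
  show ?thesis using G.finsum_closed[of f "{..<n}"] assms by auto
qed

lemma comp_finsum_right:
  assumes ob: "X \<in> Ob C" "Y \<in> Ob C" "Z \<in> Ob C" "g \<in> Hom C Y Z"
    and f: "\<And>a. a < (n::nat) \<Longrightarrow> f a \<in> Hom C X Y"
  shows "Comp C X Y Z g (\<Oplus>\<^bsub>HomG C X Y\<^esub>a\<in>{..<n}. f a)
    = (\<Oplus>\<^bsub>HomG C X Z\<^esub>a\<in>{..<n}. Comp C X Y Z g (f a))"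
proof -
  interpret h: abelian_group_hom "HomG C X Y" "HomG C X Z" "Comp C X Y Z g"
    by (rule comp_right_hom[OF ob])
  show ?thesis using f by (intro h.hom_finsum_lessThan) simp
qed

lemma comp_finsum_left:
  assumes ob: "X \<in> Ob C" "Y \<in> Ob C" "Z \<in> Ob C" "f \<in> Hom C X Y"
    and g: "\<And>a. a < (n::nat) \<Longrightarrow> g a \<in> Hom C Y Z"
  shows "Comp C X Y Z (\<Oplus>\<^bsub>HomG C Y Z\<^esub>a\<in>{..<n}. g a) f
    = (\<Oplus>\<^bsub>HomG C X Z\<^esub>a\<in>{..<n}. Comp C X Y Z (g a) f)"
proof -
  interpret h: abelian_group_hom "HomG C Y Z" "HomG C X Z" "\<lambda>g. Comp C X Y Z g f"
    by (rule comp_left_hom[OF ob])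
  show ?thesis using g by (intro h.hom_finsum_lessThan) simp
qed

lemma finsum_delta_Hom:
  assumes "X \<in> Ob C" "Y \<in> Ob C" "b < (n::nat)" "f b \<in> Hom C X Y"
    and "\<And>a. a < n \<Longrightarrow> a \<noteq> b \<Longrightarrow> f a = hzero C X Y"
  shows "(\<Oplus>\<^bsub>HomG C X Y\<^esub>a\<in>{..<n}. f a) = f b"
proof -
  interpret G: abelian_group "HomG C X Y" using abelian_group_Hom assms by blast
  have f: "f \<in> {..<n} \<rightarrow> carrier (HomG C X Y)"
    using assms hzero_closed[of X Y] by (auto, metis)
  have "(\<Oplus>\<^bsub>HomG C X Y\<^esub>a\<in>{..<n}. f a) = (\<Oplus>\<^bsub>HomG C X Y\<^esub>a\<in>{..<n}. if b = a then f a else \<zero>\<^bsub>HomG C X Y\<^esub>)"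
    by (rule G.finsum_cong') (use f assms hzero_closed[of X Y] in auto)
  also have "\<dots> = f b" by (rule G.finsum_singleton) (use f in \<open>auto simp: assms\<close>)
  finally show ?thesis .
qed

lemma finsum_cong_Hom:
  assumes "X \<in> Ob C" "Y \<in> Ob C" "\<And>a. a < (n::nat) \<Longrightarrow> f a = g a" "\<And>a. a < n \<Longrightarrow> g a \<in> Hom C X Y"
  shows "(\<Oplus>\<^bsub>HomG C X Y\<^esub>a\<in>{..<n}. f a) = (\<Oplus>\<^bsub>HomG C X Y\<^esub>a\<in>{..<n}. g a)"
proof -
  interpret G: abelian_group "HomG C X Y" using abelian_group_Hom assms by blast
  show ?thesis by (rule G.finsum_cong') (use assms in auto)
qed

text \<open>The data behind \<open>finite_direct_sum\<close> with inclusions and projections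
  exposed, so that two sums of the same summands can be compared.\<close>

definition sum_system where
  "sum_system n X S i p \<longleftrightarrow> S \<in> Ob C \<and> (\<forall>a<n. X a \<in> Ob C) \<and>
     (\<forall>a<n. i a \<in> Hom C (X a) S \<and> p a \<in> Hom C S (X a)) \<and>
     (\<forall>a<n. \<forall>b<n. Comp C (X b) S (X a) (p a) (i b) =
        (if a = b then Ident C (X a) else hzero C (X b) (X a))) \<and>
     (\<Oplus>\<^bsub>HomG C S S\<^esub>a\<in>{..<n::nat}. Comp C S (X a) S (i a) (p a)) = Ident C S"

lemma sum_systemD:
  assumes "sum_system n X S i p"
  shows "S \<in> Ob C" "a < n \<Longrightarrow> X a \<in> Ob C" "a < n \<Longrightarrow> i a \<in> Hom C (X a) S"
    "a < n \<Longrightarrow> p a \<in> Hom C S (X a)"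
    "\<lbrakk>a < n; b < n\<rbrakk> \<Longrightarrow> Comp C (X b) S (X a) (p a) (i b) =
      (if a = b then Ident C (X a) else hzero C (X b) (X a))"
    "(\<Oplus>\<^bsub>HomG C S S\<^esub>a\<in>{..<n}. Comp C S (X a) S (i a) (p a)) = Ident C S"
  using assms by (simp_all add: sum_system_def)

text \<open>Both maps match the summands by index, so the second carries the inclusion i'_b back to
  i_b. The other composite is the same statement with the systems exchanged.\<close>

lemma sum_system_iso:
  assumes s: "sum_system n X S i p" and s': "sum_system n X S' i' p'"
  shows "Comp C S S' S (\<Oplus>\<^bsub>HomG C S' S\<^esub>a\<in>{..<n}. Comp C S' (X a) S (i a) (p' a))
      (\<Oplus>\<^bsub>HomG C S S'\<^esub>a\<in>{..<n}. Comp C S (X a) S' (i' a) (p a)) = Ident C S"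
proof -
  note D = sum_systemD[OF s] and D' = sum_systemD[OF s']
  let ?t = "\<Oplus>\<^bsub>HomG C S S'\<^esub>a\<in>{..<n}. Comp C S (X a) S' (i' a) (p a)"
  let ?t' = "\<Oplus>\<^bsub>HomG C S' S\<^esub>a\<in>{..<n}. Comp C S' (X a) S (i a) (p' a)"
  have t': "?t' \<in> Hom C S' S" using D(1-4) D'(1-4) by (intro finsum_closed_Hom) (simp_all add: hom_closed)
  have ti: "Comp C (X b) S' S ?t' (i' b) = i b" if b: "b < n" for b
  proof -
    have *: "Comp C (X b) S' S (Comp C S' (X a) S (i a) (p' a)) (i' b)
        = (if a = b then i b else hzero C (X b) S)" if "a < n" for a
      using that b D(1-4) D'(1-5) by (simp add: hom_simps)
    have "Comp C (X b) S' S ?t' (i' b)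
      = (\<Oplus>\<^bsub>HomG C (X b) S\<^esub>a\<in>{..<n}. Comp C (X b) S' S (Comp C S' (X a) S (i a) (p' a)) (i' b))"
      using D(1-4) D'(1-4) b by (intro comp_finsum_left) (simp_all add: hom_closed)
    also have "\<dots> = Comp C (X b) S' S (Comp C S' (X b) S (i b) (p' b)) (i' b)"
      using D(1-4) D'(1-4) b by (intro finsum_delta_Hom) (simp_all add: hom_closed *)
    also have "\<dots> = i b" using * b by simp
    finally show ?thesis .
  qed
  have "Comp C S S' S ?t' ?t
    = (\<Oplus>\<^bsub>HomG C S S\<^esub>a\<in>{..<n}. Comp C S S' S ?t' (Comp C S (X a) S' (i' a) (p a)))"
    using D(1-4) D'(1-4) t' by (intro comp_finsum_right) (simp_all add: hom_closed)
  also have "\<dots> = (\<Oplus>\<^bsub>HomG C S S\<^esub>a\<in>{..<n}. Comp C S (X a) S (i a) (p a))"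
    using D(1-4) D'(1-4) t' ti
    by (intro finsum_cong_Hom) (simp_all add: comp_assoc hom_closed)
  finally show ?thesis using D(6) by simp
qed

end

context additive_category
begin

text \<open>Rather than peel summands off the given indexed sum, a second sum of the same summands
  is built from binary ones, where \<open>local_length\<close> is immediate;
  \<open>sum_system_iso\<close> then carries it over.\<close>

lemma ex_sum_system:
  assumes "\<And>a. a < n \<Longrightarrow> local_object C (X a)"
  shows "\<exists>S i p. sum_system n X S i p \<and> local_length C n S"
  using assms
proof (induction n)
  case 0
  obtain Z where Z: "zero_object C Z" using ex_zero_object by blast
  then have "Z \<in> Ob C" by (rule zero_object_ob)
  then interpret G: abelian_group "HomG C Z Z" using abelian_group_Hom by blast
  \<comment> \<open>For n = 0 the empty sum is the zero map, which is the identity of a zero object;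
    the inclusions and projections are arbitrary values.\<close>
  have "sum_system 0 X Z (\<lambda>_. undefined) (\<lambda>_. undefined)"
    using Z zero_object_iff[of Z] by (simp add: sum_system_def zero_object_ob)
  with local_length.zero[OF Z]
  have "sum_system 0 X Z (\<lambda>_. undefined) (\<lambda>_. undefined) \<and> local_length C 0 Z" by simp
  then show ?case by (intro exI)
next
  case (Suc n)
  have Xn: "local_object C (X n)" using Suc by simp
  then have obn: "X n \<in> Ob C" by (simp add: local_object_def)
  obtain S i p where S: "sum_system n X S i p" "local_length C n S"
    using Suc by (metis less_Suc_eq)
  note D = sum_systemD[OF S(1)]
  obtain S' k l k' l' where b: "biproduct C (X n) S S' k l k' l'"
    using ex_direct_sum[OF obn D(1)] by (auto simp: direct_sum_def)
  note bs = biproduct_simps[OF b]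
  define i' where "i' = (\<lambda>a. if a < n then Comp C (X a) S S' l (i a) else k)"
  define p' where "p' = (\<lambda>a. if a < n then Comp C S' S (X a) (p a) l' else k')"
  have ip: "i' a \<in> Hom C (X a) S'" "p' a \<in> Hom C S' (X a)" "X a \<in> Ob C" if "a < Suc n" for a
    using that D bs by (auto simp: i'_def p'_def less_Suc_eq hom_closed)
  interpret G: abelian_group "HomG C S' S'" using abelian_group_Hom bs by blast
  have "(\<Oplus>\<^bsub>HomG C S' S'\<^esub>a\<in>{..<n}. Comp C S' (X a) S' (i' a) (p' a))
    = (\<Oplus>\<^bsub>HomG C S' S'\<^esub>a\<in>{..<n}. Comp C S' S S' (Comp C S S S' l (Comp C S (X a) S (i a) (p a))) l')"
    using D(1-4) bs(1-7) by (intro finsum_cong_Hom) (simp_all add: i'_def p'_def hom_simps)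
  also have "\<dots> = Comp C S' S S' (\<Oplus>\<^bsub>HomG C S S'\<^esub>a\<in>{..<n}. Comp C S S S' l (Comp C S (X a) S (i a) (p a))) l'"
    using D(1-4) bs(1-7) by (intro comp_finsum_left[symmetric]) (simp_all add: hom_closed)
  also have "(\<Oplus>\<^bsub>HomG C S S'\<^esub>a\<in>{..<n}. Comp C S S S' l (Comp C S (X a) S (i a) (p a))) = l"
    using D(1-4,6) bs(1-7) by (subst comp_finsum_right[symmetric]) (simp_all add: hom_simps)
  finally have 1: "(\<Oplus>\<^bsub>HomG C S' S'\<^esub>a\<in>{..<n}. Comp C S' (X a) S' (i' a) (p' a)) = Comp C S' S S' l l'" .
  have "(\<Oplus>\<^bsub>HomG C S' S'\<^esub>a\<in>insert n {..<n}. Comp C S' (X a) S' (i' a) (p' a))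
      = Comp C S' (X n) S' (i' n) (p' n) \<oplus>\<^bsub>HomG C S' S'\<^esub>
        (\<Oplus>\<^bsub>HomG C S' S'\<^esub>a\<in>{..<n}. Comp C S' (X a) S' (i' a) (p' a))"
    using ip bs(3) by (intro G.finsum_insert) (auto simp: hom_closed)
  also have "\<dots> = Ident C S'" using 1 biproductD(12)[OF b] by (simp add: i'_def p'_def)
  finally have "(\<Oplus>\<^bsub>HomG C S' S'\<^esub>a\<in>{..<Suc n}. Comp C S' (X a) S' (i' a) (p' a)) = Ident C S'"
    by (simp add: lessThan_Suc)
  moreover have "Comp C (X b) S' (X a) (p' a) (i' b) =
      (if a = b then Ident C (X a) else hzero C (X b) (X a))" if "a < Suc n" "b < Suc n" for a b
    using that D bs by (auto simp: i'_def p'_def less_Suc_eq hom_simps)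
  ultimately have "sum_system (Suc n) X S' i' p'"
    using ip bs(3) by (simp add: sum_system_def)
  then show ?case using local_length.add[OF b Xn S(2)] by blast
qed

lemma krull_schmidt_local_length:
  assumes "krull_schmidt C" and S: "S \<in> Ob C"
  shows "\<exists>n. local_length C n S"
proof -
  obtain n X where X: "finite_direct_sum C n X S" "\<forall>a<n. local_ring (End_ring C (X a))"
    using assms by (auto simp: krull_schmidt_def)
  obtain i p where s: "sum_system n X S i p"
    using X(1) by (auto simp: finite_direct_sum_def sum_system_def)
  have "local_object C (X a)" if "a < n" for a
    using that X(2) sum_systemD(2)[OF s] local_object_if_local_ring by blast
  then obtain S' i' p' where s': "sum_system n X S' i' p'" and l: "local_length C n S'"
    using ex_sum_system by blast
  note D = sum_systemD[OF s] and D' = sum_systemD[OF s']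
  have "local_length C n S"
    using D(1-4) D'(1-4)
    by (intro local_length_iso[OF l S _ _ sum_system_iso[OF s' s] sum_system_iso[OF s s']]
        finsum_closed_Hom) (simp_all add: hom_closed)
  then show ?thesis by blast
qed

end

section \<open>Extensions and triangles\<close>

context ext_bifunctor
begin

lemma
  assumes "C \<in> Ob B" "A \<in> Ob B" "A' \<in> Ob B" "a \<in> Hom B A A'"
  shows push_closed: "\<delta> \<in> carrier (Ext B C A) \<Longrightarrow> push B C A A' a \<delta> \<in> carrier (Ext B C A')"
    and push_zero: "push B C A A' a \<zero>\<^bsub>Ext B C A\<^esub> = \<zero>\<^bsub>Ext B C A'\<^esub>"
proof -
  interpret h: abelian_group_hom "Ext B C A" "Ext B C A'" "push B C A A' a"
    using push_hom assms .
  show "\<delta> \<in> carrier (Ext B C A) \<Longrightarrow> push B C A A' a \<delta> \<in> carrier (Ext B C A')"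
    "push B C A A' a \<zero>\<^bsub>Ext B C A\<^esub> = \<zero>\<^bsub>Ext B C A'\<^esub>"
    by (simp_all add: h.hom_closed h.hom_zero)
qed

lemma
  assumes "C \<in> Ob B" "C' \<in> Ob B" "A \<in> Ob B" "c \<in> Hom B C' C"
  shows pull_closed: "\<delta> \<in> carrier (Ext B C A) \<Longrightarrow> pull B C' C A c \<delta> \<in> carrier (Ext B C' A)"
    and pull_zero: "pull B C' C A c \<zero>\<^bsub>Ext B C A\<^esub> = \<zero>\<^bsub>Ext B C' A\<^esub>"
proof -
  interpret h: abelian_group_hom "Ext B C A" "Ext B C' A" "pull B C' C A c"
    using pull_hom assms .
  show "\<delta> \<in> carrier (Ext B C A) \<Longrightarrow> pull B C' C A c \<delta> \<in> carrier (Ext B C' A)"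
    "pull B C' C A c \<zero>\<^bsub>Ext B C A\<^esub> = \<zero>\<^bsub>Ext B C' A\<^esub>"
    by (simp_all add: h.hom_closed h.hom_zero)
qed

lemma Ext_zero_closed: "\<lbrakk>C \<in> Ob B; A \<in> Ob B\<rbrakk> \<Longrightarrow> \<zero>\<^bsub>Ext B C A\<^esub> \<in> carrier (Ext B C A)"
  by (rule abelian_monoid.zero_closed[OF abelian_group.axioms(1)[OF abelian_group_Ext]])

lemma Ext_add_zero: "\<lbrakk>C \<in> Ob B; A \<in> Ob B; \<delta> \<in> carrier (Ext B C A)\<rbrakk>
  \<Longrightarrow> \<delta> \<oplus>\<^bsub>Ext B C A\<^esub> \<zero>\<^bsub>Ext B C A\<^esub> = \<delta>"
  by (rule abelian_monoid.r_zero[OF abelian_group.axioms(1)[OF abelian_group_Ext]])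

lemma Ext_add_eq_self:
  assumes "C \<in> Ob B" "A \<in> Ob B" "\<delta> \<in> carrier (Ext B C A)" "\<epsilon> \<in> carrier (Ext B C A)"
    and "\<epsilon> \<oplus>\<^bsub>Ext B C A\<^esub> \<delta> = \<delta>"
  shows "\<epsilon> = \<zero>\<^bsub>Ext B C A\<^esub>"
proof -
  interpret G: abelian_group "Ext B C A" using abelian_group_Ext assms by blast
  show ?thesis using assms G.a_comm[of \<epsilon> \<delta>] G.r_neg1[of \<delta> \<epsilon>] G.l_neg[of \<delta>] by simp
qed

lemma push_diff_zero:
  assumes ob: "C \<in> Ob B" "A \<in> Ob B" "A' \<in> Ob B" and k: "k \<in> Hom B A A'" "k' \<in> Hom B A A'"
    and \<delta>: "\<delta> \<in> carrier (Ext B C A)" and eq: "push B C A A' k \<delta> = push B C A A' k' \<delta>"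
  shows "push B C A A' (hadd B A A' k (hneg B A A' k')) \<delta> = \<zero>\<^bsub>Ext B C A'\<^esub>"
proof (rule Ext_add_eq_self[OF ob(1,3)])
  let ?d = "hadd B A A' k (hneg B A A' k')"
  have d: "?d \<in> Hom B A A'" using ob k by (simp add: hom_closed)
  have "hadd B A A' ?d k' = k" using ob k by (simp add: hom_simps hadd_assoc)
  then show "push B C A A' ?d \<delta> \<oplus>\<^bsub>Ext B C A'\<^esub> push B C A A' k' \<delta> = push B C A A' k' \<delta>"
    using push_add[OF ob d k(2) \<delta>] eq by simp
  show "push B C A A' k' \<delta> \<in> carrier (Ext B C A')" "push B C A A' ?d \<delta> \<in> carrier (Ext B C A')"
    using push_closed ob k d \<delta> by simp_all
qed

lemma pull_diff_zero:
  assumes ob: "C \<in> Ob B" "C' \<in> Ob B" "A \<in> Ob B" and k: "k \<in> Hom B C' C" "k' \<in> Hom B C' C"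
    and \<delta>: "\<delta> \<in> carrier (Ext B C A)" and eq: "pull B C' C A k \<delta> = pull B C' C A k' \<delta>"
  shows "pull B C' C A (hadd B C' C k (hneg B C' C k')) \<delta> = \<zero>\<^bsub>Ext B C' A\<^esub>"
proof (rule Ext_add_eq_self[OF ob(2,3)])
  let ?d = "hadd B C' C k (hneg B C' C k')"
  have d: "?d \<in> Hom B C' C" using ob k by (simp add: hom_closed)
  have "hadd B C' C ?d k' = k" using ob k by (simp add: hom_simps hadd_assoc)
  then show "pull B C' C A ?d \<delta> \<oplus>\<^bsub>Ext B C' A\<^esub> pull B C' C A k' \<delta> = pull B C' C A k' \<delta>"
    using pull_add[OF ob d k(2) \<delta>] eq by simp
  show "pull B C' C A k' \<delta> \<in> carrier (Ext B C' A)" "pull B C' C A ?d \<delta> \<in> carrier (Ext B C' A)"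
    using pull_closed ob k d \<delta> by simp_all
qed

end

section \<open>Exactness, comparison and splitting of triangles\<close>

context extriangulated
begin

text \<open>\<open>realizes\<close> does not mention the types of M, x and y; they follow because
  the realization is a class of \<open>seq_equiv\<close>, which relates only well-typed
  sequences.\<close>

lemma realizesD:
  assumes "realizes B A M C x y \<delta>"
  shows "A \<in> Ob B" "M \<in> Ob B" "C \<in> Ob B" "x \<in> Hom B A M" "y \<in> Hom B M C" "\<delta> \<in> carrier (Ext B C A)"
proof -
  have 1: "A \<in> Ob B" "C \<in> Ob B" "\<delta> \<in> carrier (Ext B C A)" "(M, x, y) \<in> realz B C A \<delta>"
    using assms by (simp_all add: realizes_def)
  obtain s where "realz B C A \<delta> = seq_equiv B A C `` {s}"
    using realz_class[OF 1(2,1,3)] by (auto simp: quotient_def)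
  then have "(s, (M, x, y)) \<in> seq_equiv B A C" using 1(4) by auto
  then have "(M, x, y) \<in> sequences B A C" by (auto simp: seq_equiv_def)
  then show "A \<in> Ob B" "M \<in> Ob B" "C \<in> Ob B" "x \<in> Hom B A M" "y \<in> Hom B M C" "\<delta> \<in> carrier (Ext B C A)"
    using 1 by (auto simp: sequences_def)
qed

lemma E_triangleD:
  assumes "E_triangle B A M C x y"
  shows "A \<in> Ob B" "M \<in> Ob B" "C \<in> Ob B" "x \<in> Hom B A M" "y \<in> Hom B M C"
proof -
  obtain \<delta> where "realizes B A M C x y \<delta>" using assms by (auto simp: E_triangle_def)
  from realizesD[OF this]
  show "A \<in> Ob B" "M \<in> Ob B" "C \<in> Ob B" "x \<in> Hom B A M" "y \<in> Hom B M C" by simp_all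
qed

text \<open>The class is nonempty: its representative is related to itself by the identity of the
  middle term.\<close>

lemma ex_realization:
  assumes ob: "C \<in> Ob B" "A \<in> Ob B" and d: "\<delta> \<in> carrier (Ext B C A)"
  shows "\<exists>M x y. realizes B A M C x y \<delta>"
proof -
  obtain s where s: "realz B C A \<delta> = seq_equiv B A C `` {s}" "s \<in> sequences B A C"
    using realz_class[OF ob d] by (auto simp: quotient_def)
  obtain M x y where sd: "s = (M, x, y)" by (cases s)
  have m: "M \<in> Ob B" "x \<in> Hom B A M" "y \<in> Hom B M C" using s(2) sd by (auto simp: sequences_def)
  have "(s, s) \<in> seq_equiv B A C"
  proof -
    have "is_iso B M M (Ident B M) \<and> Comp B A M M (Ident B M) x = x \<and> Comp B M M C y (Ident B M) = y"
      using m ob is_iso_Ident[OF m(1)] by (simp add: comp_simps)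
    then show ?thesis using s(2) unfolding sd seq_equiv_def by blast
  qed
  then have "(M, x, y) \<in> realz B C A \<delta>" using s(1) sd by simp
  then show ?thesis using ob d by (auto simp: realizes_def)
qed

text \<open>The degenerate triangle A = A -> 0. Comparing a triangle with it, or with its dual 0 ->
  A = A, turns (ET3) and its dual into exactness statements.\<close>

lemma realizes_Ident_left:
  assumes "zero_object B Z" "A \<in> Ob B"
  shows "realizes B A A Z (Ident B A) (hzero B A Z) \<zero>\<^bsub>Ext B Z A\<^esub>"
  using realz_zero[OF biproduct_zero_right[OF assms]] .

lemma realizes_Ident_right:
  assumes "zero_object B Z" "A \<in> Ob B"
  shows "realizes B Z A A (hzero B Z A) (Ident B A) \<zero>\<^bsub>Ext B A Z\<^esub>"
  using realz_zero[OF biproduct_swap[OF biproduct_zero_right[OF assms]]] .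

text \<open>Each claim compares the triangle with a degenerate one along x or y. The induced third
  map starts or ends at a zero object, and the zero extension there forces the vanishing.\<close>

lemma
  assumes r: "realizes B A M C x y \<delta>"
  shows comp_triangle: "Comp B A M C y x = hzero B A C"
    and push_inflation: "push B C A M x \<delta> = \<zero>\<^bsub>Ext B C M\<^esub>"
    and pull_deflation: "pull B M C A y \<delta> = \<zero>\<^bsub>Ext B M A\<^esub>"
proof -
  note D = realizesD[OF r]
  obtain Z where Z: "zero_object B Z" using ex_zero_object by blast
  have Zo: "Z \<in> Ob B" using Z by (rule zero_object_ob)
  note hz = zero_object_hom[OF Z]
  obtain c where "c \<in> Hom B Z C" "Comp B A Z C c (hzero B A Z) = Comp B A M C y x"
    using ET3[OF realizes_Ident_left[OF Z D(1)] r ident_closed[OF D(1)] D(4)] D by auto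
  then show "Comp B A M C y x = hzero B A C" using D Zo by (simp add: hom_simps)
  obtain c where c: "c \<in> Hom B C Z" "push B C A M x \<delta> = pull B C Z M c \<zero>\<^bsub>Ext B Z M\<^esub>"
    using ET3[OF r realizes_Ident_left[OF Z D(2)] D(4) ident_closed[OF D(2)]] D by auto
  then show "push B C A M x \<delta> = \<zero>\<^bsub>Ext B C M\<^esub>" using pull_zero[OF Zo D(3,2)] by simp
  obtain a where a: "a \<in> Hom B Z A" "push B M Z A a \<zero>\<^bsub>Ext B M Z\<^esub> = pull B M C A y \<delta>"
    using ET3_op[OF realizes_Ident_right[OF Z D(2)] r ident_closed[OF D(2)] D(5)] D by auto
  then show "pull B M C A y \<delta> = \<zero>\<^bsub>Ext B M A\<^esub>" using push_zero[OF D(2) Zo D(1)] by simp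
qed

text \<open>If k pushes \<delta> to 0, there is a morphism of triangles to the split sequence X -> X
  + C -> C; its middle component followed by the projection to X extends k.\<close>

lemma extend_along_inflation:
  assumes r: "realizes B A M C x y \<delta>" and X: "X \<in> Ob B" and k: "k \<in> Hom B A X"
    and 0: "push B C A X k \<delta> = \<zero>\<^bsub>Ext B C X\<^esub>"
  shows "\<exists>k'\<in>Hom B M X. k = Comp B A M X k' x"
proof -
  note D = realizesD[OF r]
  obtain S i j p q where b: "biproduct B X C S i j p q"
    using ex_direct_sum[OF X D(3)] by (auto simp: direct_sum_def)
  note bs = biproduct_simps[OF b]
  have "pull B C C X (Ident B C) \<zero>\<^bsub>Ext B C X\<^esub> = \<zero>\<^bsub>Ext B C X\<^esub>"
    using D X by (simp add: pull_ident Ext_zero_closed)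
  then obtain k' where k': "k' \<in> Hom B M S" "Comp B A M S k' x = Comp B A X S i k"
    using realz_morphism[OF r realz_zero[OF b] k ident_closed[OF D(3)]] 0 by auto
  have "Comp B A M X (Comp B M S X p k') x = k"
    using k' k bs D by (simp add: hom_simps)
  then show ?thesis using bs k'(1) D by (metis comp_closed)
qed

lemma lift_along_deflation:
  assumes r: "realizes B A M C x y \<delta>" and X: "X \<in> Ob B" and k: "k \<in> Hom B X C"
    and 0: "pull B X C A k \<delta> = \<zero>\<^bsub>Ext B X A\<^esub>"
  shows "\<exists>k'\<in>Hom B X M. k = Comp B X M C y k'"
proof -
  note D = realizesD[OF r]
  obtain S i j p q where b: "biproduct B A X S i j p q"
    using ex_direct_sum[OF D(1) X] by (auto simp: direct_sum_def)
  note bs = biproduct_simps[OF b]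
  have "push B X A A (Ident B A) \<zero>\<^bsub>Ext B X A\<^esub> = \<zero>\<^bsub>Ext B X A\<^esub>"
    using D X by (simp add: push_ident Ext_zero_closed)
  then obtain k' where k': "k' \<in> Hom B S M" "Comp B S M C y k' = Comp B S X C k q"
    using realz_morphism[OF realz_zero[OF b] r ident_closed[OF D(1)] k] 0 by auto
  have "Comp B X M C y (Comp B X S M k' j) = k"
    using k' k bs D by (simp add: comp_reassoc[OF k'(2)] hom_simps)
  then show ?thesis using bs k'(1) D X by (metis comp_closed)
qed

lemma inflation_factor_diff:
  assumes r: "realizes B A M C x y \<delta>" and X: "X \<in> Ob B" and k: "k \<in> Hom B A X" "k' \<in> Hom B A X"
    and eq: "push B C A X k \<delta> = push B C A X k' \<delta>"
  shows "\<exists>b\<in>Hom B M X. k = hadd B A X k' (Comp B A M X b x)"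
proof -
  note D = realizesD[OF r]
  have "push B C A X (hadd B A X k (hneg B A X k')) \<delta> = \<zero>\<^bsub>Ext B C X\<^esub>"
    using push_diff_zero D X k eq by simp
  then obtain b where b: "b \<in> Hom B M X" "hadd B A X k (hneg B A X k') = Comp B A M X b x"
    using extend_along_inflation[OF r X, of "hadd B A X k (hneg B A X k')"] D X k by (auto simp: hom_closed)
  then show ?thesis using eq_add_neg_iff[of A X k k'] D X k by (metis comp_closed)
qed

lemma deflation_factor_diff:
  assumes r: "realizes B A M C x y \<delta>" and X: "X \<in> Ob B" and k: "k \<in> Hom B X C" "k' \<in> Hom B X C"
    and eq: "pull B X C A k \<delta> = pull B X C A k' \<delta>"
  shows "\<exists>b\<in>Hom B X M. k = hadd B X C k' (Comp B X M C y b)"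
proof -
  note D = realizesD[OF r]
  have "pull B X C A (hadd B X C k (hneg B X C k')) \<delta> = \<zero>\<^bsub>Ext B X A\<^esub>"
    using pull_diff_zero D X k eq by simp
  then obtain b where b: "b \<in> Hom B X M" "hadd B X C k (hneg B X C k') = Comp B X M C y b"
    using lift_along_deflation[OF r X, of "hadd B X C k (hneg B X C k')"] D X k by (auto simp: hom_closed)
  then show ?thesis using eq_add_neg_iff[of X C k k'] D X k by (metis comp_closed)
qed

text \<open>The difference k - k' vanishes on x, so together with 0 it is a morphism to the
  degenerate triangle 0 -> X = X, and (ET3) completes it. The factor c is not unique.\<close>

lemma weak_cokernel:
  assumes r: "realizes B A M C x y \<delta>" and X: "X \<in> Ob B" and k: "k \<in> Hom B M X" "k' \<in> Hom B M X"
    and eq: "Comp B A M X k x = Comp B A M X k' x"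
  shows "\<exists>c\<in>Hom B C X. k = hadd B M X k' (Comp B M C X c y)"
proof -
  note D = realizesD[OF r]
  obtain Z where Z: "zero_object B Z" using ex_zero_object by blast
  have Zo: "Z \<in> Ob B" using Z by (rule zero_object_ob)
  let ?k = "hadd B M X k (hneg B M X k')"
  have kk: "?k \<in> Hom B M X" using D X k by (simp add: hom_closed)
  have "Comp B A M X ?k x = Comp B A Z X (hzero B Z X) (hzero B A Z)"
    using D X Zo k eq by (simp add: hom_simps)
  then obtain c where c: "c \<in> Hom B C X" "Comp B M C X c y = Comp B M X X (Ident B X) ?k"
    using ET3[OF r realizes_Ident_right[OF Z X] hzero_closed[OF D(1) Zo] kk] by auto
  then have "?k = Comp B M C X c y" using kk D X by (simp add: hom_simps)
  then show ?thesis using eq_add_neg_iff[of M X k k'] D X k c by (metis comp_closed)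
qed

lemma weak_kernel:
  assumes r: "realizes B A M C x y \<delta>" and X: "X \<in> Ob B" and k: "k \<in> Hom B X M" "k' \<in> Hom B X M"
    and eq: "Comp B X M C y k = Comp B X M C y k'"
  shows "\<exists>a\<in>Hom B X A. k = hadd B X M k' (Comp B X A M x a)"
proof -
  note D = realizesD[OF r]
  obtain Z where Z: "zero_object B Z" using ex_zero_object by blast
  have Zo: "Z \<in> Ob B" using Z by (rule zero_object_ob)
  let ?k = "hadd B X M k (hneg B X M k')"
  have kk: "?k \<in> Hom B X M" using D X k by (simp add: hom_closed)
  have "Comp B X Z C (hzero B Z C) (hzero B X Z) = Comp B X M C y ?k"
    using D X Zo k eq by (simp add: hom_simps)
  then obtain a where a: "a \<in> Hom B X A" "Comp B X X M ?k (Ident B X) = Comp B X A M x a"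
    using ET3_op[OF realizes_Ident_left[OF Z X] r kk hzero_closed[OF Zo D(3)]] by auto
  then have "?k = Comp B X A M x a" using kk D X by (simp add: hom_simps)
  then show ?thesis using eq_add_neg_iff[of X M k k'] D X k a by (metis comp_closed)
qed

text \<open>Fixing \<delta> gives c = 1 + y z, and c y = y gives y z y = 0. So y z squares to
  zero.\<close>

lemma cone_endo_iso:
  assumes r: "realizes B A M C x y \<delta>" and c: "c \<in> Hom B C C" "Comp B M C C c y = y"
    and p: "pull B C C A c \<delta> = \<delta>"
  shows "is_iso B C C c"
proof -
  note D = realizesD[OF r]
  obtain z where z: "z \<in> Hom B C M" "c = hadd B C C (Ident B C) (Comp B C M C y z)"
    using deflation_factor_diff[OF r D(3) c(1) ident_closed[OF D(3)]] p pull_ident[OF D(3,1,6)] by auto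
  have "hadd B M C y (Comp B M M C y (Comp B M C M z y)) = y"
    using c(2) z(1) D by (subst (asm) z(2)) (simp add: hom_simps)
  then have 0: "Comp B M M C y (Comp B M C M z y) = hzero B M C"
    using add_eq_self_iff[of M C y] D z by (simp add: hom_closed)
  have "Comp B C M C y (Comp B C M M (Comp B M C M z y) z) = Comp B C M C (hzero B M C) z"
    using D z(1) by (intro comp_reassoc[OF 0]) (simp_all add: hom_closed)
  then have "Comp B C C C (Comp B C M C y z) (Comp B C M C y z) = hzero B C C"
    using D z(1) by (simp add: hom_simps)
  then show ?thesis using is_iso_add_square_zero[of C "Comp B C M C y z"] D z by (simp add: hom_closed)
qed

text \<open>The two triangles may realize different classes. (ET3) over the identities gives maps c
  and c' that exchange these classes, so both composites of c and c' fall under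
  \<open>cone_endo_iso\<close>.\<close>

lemma cone_unique:
  assumes t: "E_triangle B A M C x y" and t': "E_triangle B A M C' x y'"
  shows "isomorphic B C C'"
proof -
  obtain \<delta> \<delta>' where r: "realizes B A M C x y \<delta>" and r': "realizes B A M C' x y' \<delta>'"
    using t t' by (auto simp: E_triangle_def)
  note D = realizesD[OF r] and D' = realizesD[OF r']
  have sq: "Comp B A M M (Ident B M) x = Comp B A A M x (Ident B A)"
    using D by (simp add: hom_simps)
  have y: "Comp B M M C y (Ident B M) = y" "Comp B M M C' y' (Ident B M) = y'"
    using D D' by (simp_all add: hom_simps)
  have id: "push B C A A (Ident B A) \<delta> = \<delta>" "push B C' A A (Ident B A) \<delta>' = \<delta>'"
    using D D' by (simp_all add: push_ident)
  obtain c where c: "c \<in> Hom B C C'" "Comp B M C C' c y = y'" "pull B C C' A c \<delta>' = \<delta>"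
    using ET3[OF r r' ident_closed[OF D(1)] ident_closed[OF D(2)] sq] unfolding y id by metis
  obtain c' where c': "c' \<in> Hom B C' C" "Comp B M C' C c' y' = y" "pull B C' C A c' \<delta> = \<delta>'"
    using ET3[OF r' r ident_closed[OF D(1)] ident_closed[OF D(2)] sq] unfolding y id by metis
  have "is_iso B C C (Comp B C C' C c' c)"
  proof (rule cone_endo_iso[OF r])
    show "pull B C C A (Comp B C C' C c' c) \<delta> = \<delta>"
      using pull_comp[of C C' C A c' c \<delta>] c c' D D' by simp
  qed (use c c' D D' in \<open>simp_all add: hom_simps\<close>)
  moreover have "is_iso B C' C' (Comp B C' C C' c c')"
  proof (rule cone_endo_iso[OF r'])
    show "pull B C' C' A (Comp B C' C C' c c') \<delta>' = \<delta>'"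
      using pull_comp[of C' C C' A c c' \<delta>'] c c' D D' by simp
  qed (use c c' D D' in \<open>simp_all add: hom_simps\<close>)
  ultimately have "is_iso B C C' c" using is_iso_if_both_sides c c' D D' by blast
  then show ?thesis by (auto simp: isomorphic_def)
qed

text \<open>A zero class gives a retraction p0 of x and a section j of y, but p0 j need not vanish.
  The weak kernel property corrects p0 to a map p with 1 = j y + x p, that is p = p0 - p0 j
  y.\<close>

lemma split_triangle:
  assumes r: "realizes B A M C x y \<zero>\<^bsub>Ext B C A\<^esub>"
  shows "direct_sum B A C M"
proof -
  note D = realizesD[OF r]
  obtain p0 where p0: "p0 \<in> Hom B M A" "Comp B A M A p0 x = Ident B A"
    using extend_along_inflation[OF r D(1) ident_closed[OF D(1)]] D
    by (auto simp: push_ident Ext_zero_closed)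
  obtain j where j: "j \<in> Hom B C M" "Comp B C M C y j = Ident B C"
    using lift_along_deflation[OF r D(3) ident_closed[OF D(3)]] D
    by (auto simp: pull_ident Ext_zero_closed)
  have "Comp B M M C y (Ident B M) = Comp B M M C y (Comp B M C M j y)"
    using D j by (simp add: hom_simps comp_reassoc[OF j(2)])
  then obtain p where p: "p \<in> Hom B M A"
    "Ident B M = hadd B M M (Comp B M C M j y) (Comp B M A M x p)"
    using weak_kernel[OF r D(2) ident_closed[OF D(2)], of "Comp B M C M j y"] D j by (auto simp: hom_closed)
  have p': "p0 = hadd B M A (Comp B M C A (Comp B C M A p0 j) y) p"
  proof -
    have "p0 = Comp B M M A p0 (Ident B M)" using p0 D by (simp add: hom_simps)
    also have "\<dots> = hadd B M A (Comp B M C A (Comp B C M A p0 j) y) p"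
      using p0 D j(1) p(1) by (simp add: p(2) hom_simps comp_reassoc[OF p0(2)])
    finally show ?thesis .
  qed
  have k: "Comp B C M A p0 j \<in> Hom B C A" using D p0 j by (simp add: hom_closed)
  have "Comp B A M A p0 x = Comp B A M A p x"
    using D p0(1) j(1) p(1) comp_triangle[OF r] k
    by (subst p') (simp add: comp_add_left comp_assoc_right[of A M C A x y] hom_closed comp_zero_right hadd_zero_left)
  then have px: "Comp B A M A p x = Ident B A" using p0 by simp
  have "Comp B C M A p0 j = hadd B C A (Comp B C M A p0 j) (Comp B C M A p j)"
    using D p0(1) j p(1) k
    by (subst (1) p') (simp add: comp_add_left comp_assoc_right[of C M C A j y] hom_closed comp_ident_right)
  then have pj: "Comp B C M A p j = hzero B C A"
    using add_eq_self_iff[of C A "Comp B C M A p0 j" "Comp B C M A p j"] D p j k by (simp add: hom_closed)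
  have "biproduct B A C M x j p y"
    using D p j px pj comp_triangle[OF r] hadd_comm[of M M "Comp B M A M x p" "Comp B M C M j y"]
    by (simp add: biproduct_def hom_closed)
  then show ?thesis by (auto simp: direct_sum_def)
qed

text \<open>This is the sum of the triangle with the degenerate triangle 0 -> M' = M', where A
  itself serves as the sum of A and a zero object.\<close>

lemma triangle_add_identity:
  assumes t: "E_triangle B A M C x y" and b: "biproduct B M M' S w j \<pi> \<kappa>"
  shows "\<exists>C' y'. direct_sum B C M' C' \<and> E_triangle B A S C' (Comp B A M S w x) y'"
proof -
  obtain \<delta> where r: "realizes B A M C x y \<delta>" using t by (auto simp: E_triangle_def)
  note D = realizesD[OF r]
  note bs = biproduct_simps[OF b]
  obtain Z where Z: "zero_object B Z" using ex_zero_object by blast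
  have Zo: "Z \<in> Ob B" using Z by (rule zero_object_ob)
  obtain C' k l m n where c: "biproduct B C M' C' k l m n"
    using ex_direct_sum[OF D(3) bs(2)] by (auto simp: direct_sum_def)
  have "hadd B A S (Comp B A M S w (Comp B A A M x (Ident B A)))
      (Comp B A M' S j (Comp B A Z M' (hzero B Z M') (hzero B A Z))) = Comp B A M S w x"
    using D bs(1-7) Zo by (simp add: hom_simps)
  then show ?thesis
    using realz_sum[OF r realizes_Ident_right[OF Z bs(2)] biproduct_zero_right[OF Z D(1)] b c] c
    unfolding E_triangle_def direct_sum_def by metis
qed

end

section \<open>Stable equality of morphisms\<close>

text \<open>Congruence modulo the ideal, stated for representatives, so that the homological
  arguments never handle cosets; \<open>stable_mor_eq_iff\<close> translates at the end.\<close>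

definition stably_equal :: "('o, 'm, 'e, 'z) excat_scheme \<Rightarrow> 'o \<Rightarrow> 'o \<Rightarrow> 'm \<Rightarrow> 'm \<Rightarrow> bool" where
  "stably_equal B X Y f g \<longleftrightarrow> X \<in> Ob B \<and> Y \<in> Ob B \<and> f \<in> Hom B X Y \<and> g \<in> Hom B X Y \<and>
     (\<exists>w\<in>factors_through B (projectives B) X Y. f = hadd B X Y g w)"

text \<open>The substitute, on the inflation side, for lifting of projectives: a map out of X that
  factors through a projective then factors through f as well.\<close>

definition extends_to_projectives :: "('o, 'm, 'e, 'z) excat_scheme \<Rightarrow> 'o \<Rightarrow> 'o \<Rightarrow> 'm \<Rightarrow> bool" where
  "extends_to_projectives B X Y f \<longleftrightarrow>
     (\<forall>Q\<in>projectives B. \<forall>k\<in>Hom B X Q. \<exists>k'\<in>Hom B Y Q. k = Comp B X Y Q k' f)"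

text \<open>\<open>right_minimal\<close> in the stable category, with the isomorphism spelled out as
  a two-sided stable inverse in B.\<close>

definition stably_right_minimal :: "('o, 'm, 'e, 'z) excat_scheme \<Rightarrow> 'o \<Rightarrow> 'o \<Rightarrow> 'm \<Rightarrow> bool" where
  "stably_right_minimal B X Y f \<longleftrightarrow>
     (\<forall>r\<in>Hom B X X. stably_equal B X Y (Comp B X X Y f r) f \<longrightarrow>
       (\<exists>r'\<in>Hom B X X. stably_equal B X X (Comp B X X X r r') (Ident B X) \<and>
          stably_equal B X X (Comp B X X X r' r) (Ident B X)))"

context extriangulated
begin

abbreviation "Fac \<equiv> factors_through B (projectives B)"

lemma projective_ob: "P \<in> projectives B \<Longrightarrow> P \<in> Ob B"
  by (simp add: projectives_def)

lemma projective_lift: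
  assumes "P \<in> projectives B" "E_triangle B A M C x y" "f \<in> Hom B P C"
  shows "\<exists>f'\<in>Hom B P M. f = Comp B P M C y f'"
proof -
  have "deflation B M C y" using assms(2) by (auto simp: deflation_def)
  then have "\<exists>f'\<in>Hom B P M. Comp B P M C y f' = f" using assms(1,3) by (simp add: projectives_def)
  then show ?thesis by metis
qed

lemma projectiveI:
  assumes "P \<in> Ob B"
    and "\<And>A M C x y f. \<lbrakk>E_triangle B A M C x y; f \<in> Hom B P C\<rbrakk> \<Longrightarrow> \<exists>f'\<in>Hom B P M. Comp B P M C y f' = f"
  shows "P \<in> projectives B"
  using assms unfolding projectives_def deflation_def by blast

lemma projective_zero:
  assumes Z: "zero_object B Z"
  shows "Z \<in> projectives B"
proof (rule projectiveI[OF zero_object_ob[OF Z]])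
  fix A M C x y f assume t: "E_triangle B A M C x y" and "f \<in> Hom B Z C"
  then have "Comp B Z M C y (hzero B Z M) = f"
    using E_triangleD[OF t] zero_object_hom(2)[OF Z] zero_object_ob[OF Z] by (metis comp_zero_right)
  then show "\<exists>f'\<in>Hom B Z M. Comp B Z M C y f' = f"
    using E_triangleD(2)[OF t] zero_object_ob[OF Z] hzero_closed by blast
qed

lemma projective_direct_sum:
  assumes P: "P \<in> projectives B" and Q: "Q \<in> projectives B" and b: "biproduct B P Q S i j p q"
  shows "S \<in> projectives B"
proof -
  note bs = biproduct_simps[OF b]
  have "\<exists>f'\<in>Hom B S M. Comp B S M C y f' = f" if t: "E_triangle B A M C x y" and f: "f \<in> Hom B S C"
    for A M C x y f
  proof -
    note D = E_triangleD[OF t]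
    obtain a where a: "a \<in> Hom B P M" "Comp B P S C f i = Comp B P M C y a"
      using projective_lift[OF P t, of "Comp B P S C f i"] bs D f by (auto simp: hom_closed)
    obtain b where b': "b \<in> Hom B Q M" "Comp B Q S C f j = Comp B Q M C y b"
      using projective_lift[OF Q t, of "Comp B Q S C f j"] bs D f by (auto simp: hom_closed)
    have "Comp B S M C y (hadd B S M (Comp B S P M a p) (Comp B S Q M b q)) = f"
      using biproduct_decomp_dom[OF b D(3) f] bs(1-7) D a(1) b'(1)
      unfolding a(2) b'(2) by (simp add: hom_simps)
    moreover have "hadd B S M (Comp B S P M a p) (Comp B S Q M b q) \<in> Hom B S M"
      using bs(1-7) D a(1) b'(1) by (simp add: hom_closed)
    ultimately show ?thesis by blast
  qed
  then show ?thesis using projectiveI[OF bs(3)] by blast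
qed

section \<open>The ideal of morphisms factoring through projectives\<close>

lemma FacI:
  "\<lbrakk>W \<in> projectives B; a \<in> Hom B X W; b \<in> Hom B W Y; X \<in> Ob B; Y \<in> Ob B\<rbrakk> \<Longrightarrow> Comp B X W Y b a \<in> Fac X Y"
  using projective_ob comp_closed by (auto simp: factors_through_def)

lemma FacE:
  assumes "w \<in> Fac X Y"
  obtains W a b where "W \<in> projectives B" "W \<in> Ob B" "a \<in> Hom B X W" "b \<in> Hom B W Y" "w = Comp B X W Y b a"
  using assms projective_ob by (auto simp: factors_through_def)

lemma Fac_Hom: "w \<in> Fac X Y \<Longrightarrow> w \<in> Hom B X Y"
  by (simp add: factors_through_def)

lemma Fac_comp_left:
  assumes "w \<in> Fac X Y" "g \<in> Hom B Y Z" "X \<in> Ob B" "Y \<in> Ob B" "Z \<in> Ob B"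
  shows "Comp B X Y Z g w \<in> Fac X Z"
  by (rule FacE[OF assms(1)]) (use assms in \<open>simp add: comp_assoc FacI hom_closed\<close>)

lemma Fac_comp_right:
  assumes "w \<in> Fac Y Z" "f \<in> Hom B X Y" "X \<in> Ob B" "Y \<in> Ob B" "Z \<in> Ob B"
  shows "Comp B X Y Z w f \<in> Fac X Z"
  by (rule FacE[OF assms(1)]) (use assms in \<open>simp add: comp_assoc_right FacI hom_closed\<close>)

lemma Fac_zero: "\<lbrakk>X \<in> Ob B; Y \<in> Ob B\<rbrakk> \<Longrightarrow> hzero B X Y \<in> Fac X Y"
proof -
  assume ob: "X \<in> Ob B" "Y \<in> Ob B"
  obtain Z where Z: "zero_object B Z" using ex_zero_object by blast
  have "Comp B X Z Y (hzero B Z Y) (hzero B X Z) \<in> Fac X Y"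
    using ob Z zero_object_ob[OF Z] by (intro FacI projective_zero) (simp_all add: hom_closed)
  then show ?thesis using ob zero_object_ob[OF Z] by (simp add: hom_simps)
qed

lemma Fac_neg: "\<lbrakk>w \<in> Fac X Y; X \<in> Ob B; Y \<in> Ob B\<rbrakk> \<Longrightarrow> hneg B X Y w \<in> Fac X Y"
  by (erule FacE) (simp add: comp_neg_left[symmetric] FacI hom_closed)

text \<open>b a + b' a' factors through W + W' as the row (b, b') after the column (a, a'), and W +
  W' is projective.\<close>

lemma Fac_add:
  assumes "w \<in> Fac X Y" "w' \<in> Fac X Y" "X \<in> Ob B" "Y \<in> Ob B"
  shows "hadd B X Y w w' \<in> Fac X Y"
proof -
  obtain W a b where W: "W \<in> projectives B" "W \<in> Ob B" "a \<in> Hom B X W" "b \<in> Hom B W Y" "w = Comp B X W Y b a"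
    using assms by (elim FacE)
  obtain W' a' b' where W': "W' \<in> projectives B" "W' \<in> Ob B" "a' \<in> Hom B X W'" "b' \<in> Hom B W' Y"
      "w' = Comp B X W' Y b' a'"
    using assms by (elim FacE)
  obtain S i j p q where s: "biproduct B W W' S i j p q"
    using ex_direct_sum[OF W(2) W'(2)] by (auto simp: direct_sum_def)
  note bs = biproduct_simps[OF s]
  have "Comp B X S Y (hadd B S Y (Comp B S W Y b p) (Comp B S W' Y b' q))
      (hadd B X S (Comp B X W S i a) (Comp B X W' S j a')) \<in> Fac X Y"
    using bs W W' assms by (intro FacI projective_direct_sum[OF W(1) W'(1) s]) (simp_all add: hom_closed)
  then show ?thesis using bs W W' assms by (simp add: hom_simps)
qed

section \<open>Calculus of stable equality\<close>

abbreviation "st \<equiv> stably_equal B"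

lemma stD: "st X Y f g \<Longrightarrow> X \<in> Ob B" "st X Y f g \<Longrightarrow> Y \<in> Ob B" "st X Y f g \<Longrightarrow> f \<in> Hom B X Y"
  "st X Y f g \<Longrightarrow> g \<in> Hom B X Y"
  by (simp_all add: stably_equal_def)

lemma stI: "\<lbrakk>X \<in> Ob B; Y \<in> Ob B; g \<in> Hom B X Y; w \<in> Fac X Y\<rbrakk> \<Longrightarrow> st X Y (hadd B X Y g w) g"
  using Fac_Hom hadd_closed unfolding stably_equal_def by blast

lemma stI': "\<lbrakk>X \<in> Ob B; Y \<in> Ob B; g \<in> Hom B X Y; w \<in> Fac X Y\<rbrakk> \<Longrightarrow> st X Y (hadd B X Y w g) g"
  using stI[of X Y g w] hadd_comm[of X Y g w] Fac_Hom by simp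

lemma st_refl: "\<lbrakk>X \<in> Ob B; Y \<in> Ob B; f \<in> Hom B X Y\<rbrakk> \<Longrightarrow> st X Y f f"
  using stI[OF _ _ _ Fac_zero] by (simp add: hadd_zero_right)

lemma st_sym:
  assumes "st X Y f g"
  shows "st X Y g f"
proof -
  obtain w where w: "X \<in> Ob B" "Y \<in> Ob B" "g \<in> Hom B X Y" "w \<in> Fac X Y" "f = hadd B X Y g w"
    using assms by (auto simp: stably_equal_def)
  have "st X Y (hadd B X Y f (hneg B X Y w)) f"
    using w stD[OF assms] Fac_neg by (intro stI) auto
  then show ?thesis using w Fac_Hom by (simp add: hom_simps hadd_assoc)
qed

lemma st_trans [trans]:
  assumes fg: "st X Y f g" and gh: "st X Y g h"
  shows "st X Y f h"
proof -
  obtain w w' where w: "w \<in> Fac X Y" "f = hadd B X Y g w" "w' \<in> Fac X Y" "g = hadd B X Y h w'"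
    using assms by (auto simp: stably_equal_def)
  note D = stD[OF gh]
  have "st X Y (hadd B X Y h (hadd B X Y w' w)) h" using D w by (intro stI Fac_add) auto
  then show ?thesis using w D Fac_Hom by (simp add: hadd_assoc)
qed

lemma st_comp:
  assumes f: "st X Y f f'" and g: "st Y Z g g'"
  shows "st X Z (Comp B X Y Z g f) (Comp B X Y Z g' f')"
proof -
  obtain w w' where w: "w \<in> Fac X Y" "f = hadd B X Y f' w" "w' \<in> Fac Y Z" "g = hadd B Y Z g' w'"
    using assms by (auto simp: stably_equal_def)
  note D = stD[OF f] stD[OF g]
  have wh: "w \<in> Hom B X Y" "w' \<in> Hom B Y Z" using w Fac_Hom by auto
  have "st X Z (hadd B X Z (Comp B X Y Z g' f')
    (hadd B X Z (Comp B X Y Z g' w) (Comp B X Y Z w' f))) (Comp B X Y Z g' f')"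
    using D w by (intro stI Fac_add Fac_comp_left Fac_comp_right hom_closed) auto
  also have "hadd B X Z (Comp B X Y Z g' f') (hadd B X Z (Comp B X Y Z g' w) (Comp B X Y Z w' f))
    = Comp B X Y Z g f"
  proof -
    have "Comp B X Y Z g f = hadd B X Z (Comp B X Y Z g' f) (Comp B X Y Z w' f)"
      unfolding w(4) using D wh by (simp add: comp_add_left)
    moreover have "Comp B X Y Z g' f = hadd B X Z (Comp B X Y Z g' f') (Comp B X Y Z g' w)"
      unfolding w(2) using D wh by (simp add: comp_add_right)
    ultimately show ?thesis using D wh by (simp add: hadd_assoc hom_closed)
  qed
  finally show ?thesis .
qed

lemma st_comp_left: "\<lbrakk>st X Y f f'; g \<in> Hom B Y Z; Z \<in> Ob B\<rbrakk> \<Longrightarrow> st X Z (Comp B X Y Z g f) (Comp B X Y Z g f')"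
  using st_comp st_refl stD by metis

lemma st_comp_right: "\<lbrakk>st Y Z g g'; f \<in> Hom B X Y; X \<in> Ob B\<rbrakk> \<Longrightarrow> st X Z (Comp B X Y Z g f) (Comp B X Y Z g' f)"
  using st_comp st_refl stD by metis

lemma st_add:
  assumes f: "st X Y f f'" and g: "st X Y g g'"
  shows "st X Y (hadd B X Y f g) (hadd B X Y f' g')"
proof -
  obtain w w' where w: "w \<in> Fac X Y" "f = hadd B X Y f' w" "w' \<in> Fac X Y" "g = hadd B X Y g' w'"
    using assms by (auto simp: stably_equal_def)
  note D = stD[OF f] stD[OF g]
  have wh: "w \<in> Hom B X Y" "w' \<in> Hom B X Y" using w Fac_Hom by auto
  have "st X Y (hadd B X Y (hadd B X Y f' g') (hadd B X Y w w')) (hadd B X Y f' g')"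
    using D w by (intro stI Fac_add hom_closed) auto
  then show ?thesis unfolding w(2,4) using D wh by (simp add: hadd_ac hom_closed)
qed

lemma st_neg:
  assumes f: "st X Y f f'"
  shows "st X Y (hneg B X Y f) (hneg B X Y f')"
proof -
  note D = stD[OF f]
  have "st X Y (Comp B X Y Y (hneg B Y Y (Ident B Y)) f) (Comp B X Y Y (hneg B Y Y (Ident B Y)) f')"
    using D by (intro st_comp_left[OF f]) (simp_all add: hom_closed)
  then show ?thesis using D by (simp add: comp_neg_left comp_ident_left ident_closed)
qed

lemma st_zero_iff: "\<lbrakk>X \<in> Ob B; Y \<in> Ob B\<rbrakk> \<Longrightarrow> st X Y f (hzero B X Y) \<longleftrightarrow> f \<in> Fac X Y"
  unfolding stably_equal_def using Fac_Hom hadd_zero_left hzero_closed by metis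

lemma st_zeroE:
  assumes "st X Y f (hzero B X Y)"
  obtains W a b where "W \<in> projectives B" "W \<in> Ob B" "a \<in> Hom B X W" "b \<in> Hom B W Y" "f = Comp B X W Y b a"
  using assms FacE st_zero_iff stD by metis

lemma st_diff_zero:
  assumes f: "st X Y f g"
  shows "st X Y (hadd B X Y f (hneg B X Y g)) (hzero B X Y)"
  using st_add[OF f st_neg[OF st_refl]] stD[OF f] by (metis hadd_neg_right)

lemma st_if_diff_zero:
  assumes "f \<in> Hom B X Y" "g \<in> Hom B X Y" and z: "st X Y (hadd B X Y f (hneg B X Y g)) (hzero B X Y)"
  shows "st X Y f g"
proof -
  note D = stD[OF z]
  have "st X Y (hadd B X Y (hadd B X Y f (hneg B X Y g)) g) (hadd B X Y (hzero B X Y) g)"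
    using D assms by (intro st_add[OF z] st_refl) auto
  then show ?thesis using D assms by (simp add: hom_simps hadd_assoc)
qed

section \<open>Exactness of triangles up to stable equality\<close>

lemma projective_if_stably_zero:
  assumes X: "X \<in> Ob B" and z: "st X X (Ident B X) (hzero B X X)"
  shows "X \<in> projectives B"
proof -
  obtain W a b where W: "W \<in> projectives B" "W \<in> Ob B" "a \<in> Hom B X W" "b \<in> Hom B W X" "Ident B X = Comp B X W X b a"
    using z by (rule st_zeroE)
  have "\<exists>f'\<in>Hom B X M. Comp B X M C y f' = f" if t: "E_triangle B A M C x y" and f: "f \<in> Hom B X C"
    for A M C x y f
  proof -
    note D = E_triangleD[OF t]
    obtain k where k: "k \<in> Hom B W M" "Comp B W X C f b = Comp B W M C y k"
      using projective_lift[OF W(1) t, of "Comp B W X C f b"] W X D f by (auto simp: hom_closed)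
    have "Comp B X M C y (Comp B X W M k a) = Comp B X X C f (Comp B X W X b a)"
      using k W(2-4) X D f by (simp add: comp_assoc)
    also have "\<dots> = f" using X D f by (simp add: W(5)[symmetric] comp_simps)
    finally have "Comp B X M C y (Comp B X W M k a) = f" .
    moreover have "Comp B X W M k a \<in> Hom B X M" using k W X D by (simp add: comp_closed)
    ultimately show ?thesis by blast
  qed
  then show ?thesis using projectiveI[OF X] by blast
qed

text \<open>A factorisation of y \<rho> through a projective W lifts along the deflation y.
  Subtracting the lift from \<rho>, a stably trivial change, makes the composite honestly
  zero.\<close>

lemma stable_kernel:
  assumes r: "realizes B A M C x y \<delta>" and R: "R \<in> Ob B" "\<rho> \<in> Hom B R M"
    and z: "st R C (Comp B R M C y \<rho>) (hzero B R C)"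
  shows "\<exists>\<sigma>\<in>Hom B R A. st R M \<rho> (Comp B R A M x \<sigma>)"
proof -
  note D = realizesD[OF r]
  obtain W a b where W: "W \<in> projectives B" "W \<in> Ob B" "a \<in> Hom B R W" "b \<in> Hom B W C"
    "Comp B R M C y \<rho> = Comp B R W C b a"
    using z by (rule st_zeroE)
  obtain b' where b': "b' \<in> Hom B W M" "b = Comp B W M C y b'"
    using projective_lift[OF W(1) _ W(4)] r unfolding E_triangle_def by blast
  have "Comp B R M C y \<rho> = Comp B R M C y (Comp B R W M b' a)"
    using W b' D R by (simp add: comp_assoc)
  moreover have "Comp B R W M b' a \<in> Hom B R M" using W b' D R by (simp add: comp_closed)
  ultimately obtain \<sigma> where "\<sigma> \<in> Hom B R A" "\<rho> = hadd B R M (Comp B R W M b' a) (Comp B R A M x \<sigma>)"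
    using weak_kernel[OF r R] by blast
  then show ?thesis using stI'[OF R(1) D(2)] FacI[OF W(1,3) b'(1) R(1) D(2)] D R by (metis comp_closed)
qed

text \<open>Dual to \<open>stable_kernel\<close>: here the map A -> W has to extend along x, which
  is what \<open>extends_to_projectives\<close> provides.\<close>

lemma stable_cokernel:
  assumes r: "realizes B A M C x y \<delta>" and e: "extends_to_projectives B A M x"
    and X: "X \<in> Ob B" "k \<in> Hom B M X" and z: "st A X (Comp B A M X k x) (hzero B A X)"
  shows "\<exists>c\<in>Hom B C X. st M X k (Comp B M C X c y)"
proof -
  note D = realizesD[OF r]
  obtain W a b where W: "W \<in> projectives B" "W \<in> Ob B" "a \<in> Hom B A W" "b \<in> Hom B W X"
    "Comp B A M X k x = Comp B A W X b a"
    using z by (rule st_zeroE)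
  obtain a' where a': "a' \<in> Hom B M W" "a = Comp B A M W a' x"
    using e W unfolding extends_to_projectives_def by blast
  have "Comp B A M X k x = Comp B A M X (Comp B M W X b a') x"
    using W a' D X by (simp add: comp_assoc)
  moreover have "Comp B M W X b a' \<in> Hom B M X" using W a' D X by (simp add: comp_closed)
  ultimately obtain c where "c \<in> Hom B C X" "k = hadd B M X (Comp B M W X b a') (Comp B M C X c y)"
    using weak_cokernel[OF r X] by blast
  then show ?thesis using stI'[OF D(2) X(1)] FacI[OF W(1) a'(1) W(4) D(2) X(1)] D X by (metis comp_closed)
qed

text \<open>The obstruction to lifting \<phi> along g is the pullback of \<delta> along h \<phi>. As
  h \<phi> factors through a projective it factors through the deflation p, and p pulls \<delta>
  back to 0. The resulting lift is strict.\<close>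

lemma lift_if_pullback_projective:
  assumes r: "realizes B R1 R2 A f g (pull B A T1 R1 h \<delta>)" and u: "realizes B R1 P T1 u p \<delta>"
    and h: "h \<in> Hom B A T1" and R: "R \<in> Ob B" "\<phi> \<in> Hom B R A"
    and z: "st R T1 (Comp B R A T1 h \<phi>) (hzero B R T1)"
  shows "\<exists>\<rho>\<in>Hom B R R2. \<phi> = Comp B R R2 A g \<rho>"
proof -
  note D = realizesD[OF r] and U = realizesD[OF u]
  obtain W a b where W: "W \<in> projectives B" "W \<in> Ob B" "a \<in> Hom B R W" "b \<in> Hom B W T1"
    "Comp B R A T1 h \<phi> = Comp B R W T1 b a"
    using z by (rule st_zeroE)
  obtain b' where b': "b' \<in> Hom B W P" "b = Comp B W P T1 p b'"
    using projective_lift[OF W(1) _ W(4)] u unfolding E_triangle_def by blast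
  have k: "Comp B R W P b' a \<in> Hom B R P" using W b' R U by (simp add: comp_closed)
  have hp: "Comp B R A T1 h \<phi> = Comp B R P T1 p (Comp B R W P b' a)"
    using W b' U R by (simp add: comp_assoc)
  have "pull B R A R1 \<phi> (pull B A T1 R1 h \<delta>) = pull B R T1 R1 (Comp B R A T1 h \<phi>) \<delta>"
    using D U R h by (intro pull_comp[symmetric]) simp_all
  also have "\<dots> = pull B R P R1 (Comp B R W P b' a) (pull B P T1 R1 p \<delta>)"
    unfolding hp using U R k by (intro pull_comp) simp_all
  also have "\<dots> = \<zero>\<^bsub>Ext B R R1\<^esub>" using pull_deflation[OF u] pull_zero k U R by simp
  finally show ?thesis using lift_along_deflation[OF r R] by simp
qed

lemma ident_add_Fac:
  assumes "X \<in> Ob B" "w \<in> Fac X X"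
  shows "st X X (hadd B X X (Ident B X) w) (Ident B X)"
  using assms by (intro stI) (simp_all add: ident_closed)

text \<open>An endomorphism of the cone that is stably the identity on \<open>M\<close> lifts, up to right minimality,
  to a stable automorphism of the first term; this makes it stably split epi.\<close>

lemma cone_endo_split_epi:
  assumes r: "realizes B A M C x y \<delta>" and e: "extends_to_projectives B A M x"
    and m: "stably_right_minimal B A M x"
    and c: "c \<in> Hom B C C" and cy: "st M C (Comp B M C C c y) y"
  shows "\<exists>d\<in>Hom B C C. st C C (Comp B C C C c d) (Ident B C)"
proof -
  note D = realizesD[OF r]
  obtain w where w: "w \<in> Fac M C" "Comp B M C C c y = hadd B M C y w"
    using cy by (auto simp: stably_equal_def)
  obtain W a b where W: "W \<in> projectives B" "W \<in> Ob B" "a \<in> Hom B M W" "b \<in> Hom B W C"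
    "w = Comp B M W C b a"
    using w by (elim FacE)
  obtain b' where b': "b' \<in> Hom B W M" "b = Comp B W M C y b'"
    using projective_lift[OF W(1) _ W(4)] r unfolding E_triangle_def by blast
  \<comment> \<open>The error term of c y lifts along y, so c y = y (1 + w1). Thus (1 + w1, c)
    extends to an endomorphism of the triangle, with a first component \<open>a1\<close> that x
    fixes stably.\<close>
  define w1 where "w1 = Comp B M W M b' a"
  have w1: "w1 \<in> Fac M M" "w1 \<in> Hom B M M" using FacI[OF W(1,3) b'(1) D(2,2)] Fac_Hom by (auto simp: w1_def)
  let ?b = "hadd B M M (Ident B M) w1"
  have bb: "?b \<in> Hom B M M" using D w1 by (simp add: hom_closed)
  have "Comp B M C C c y = Comp B M M C y ?b"
    using w W b' D w1 by (simp add: comp_add_right comp_ident_right ident_closed w1_def comp_assoc)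
  then obtain a1 where a1: "a1 \<in> Hom B A A" "Comp B A M M ?b x = Comp B A A M x a1"
    "push B C A A a1 \<delta> = pull B C C A c \<delta>"
    using ET3_op[OF r r bb c] by metis
  have "st A M (Comp B A M M ?b x) (Comp B A M M (Ident B M) x)"
    using ident_add_Fac[OF D(2) w1(1)] D by (intro st_comp_right) simp_all
  then have xa1: "st A M (Comp B A A M x a1) x" using a1 D by (simp add: comp_ident_left)
  obtain a2 where a2: "a2 \<in> Hom B A A" "st A A (Comp B A A A a1 a2) (Ident B A)"
    "st A A (Comp B A A A a2 a1) (Ident B A)"
    using m a1(1) xa1 unfolding stably_right_minimal_def by blast
  have "st A M (Comp B A A M (Comp B A A M x a1) a2) (Comp B A A M x a2)"
    using st_comp_right[OF xa1 a2(1) D(1)] .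
  from st_sym[OF this] have "st A M (Comp B A A M x a2) (Comp B A A M x (Comp B A A A a1 a2))"
    using D a1 a2 by (simp add: comp_assoc)
  also have "st A M \<dots> (Comp B A A M x (Ident B A))"
    using st_comp_left[OF a2(2) D(4) D(2)] .
  finally have "st A M (Comp B A A M x a2) x" using D by (simp add: comp_ident_right)
  then obtain v where v: "v \<in> Fac A M" "Comp B A A M x a2 = hadd B A M x v"
    by (auto simp: stably_equal_def)
  obtain V k l where V: "V \<in> projectives B" "V \<in> Ob B" "k \<in> Hom B A V" "l \<in> Hom B V M"
    "v = Comp B A V M l k"
    using v by (elim FacE)
  obtain k' where k': "k' \<in> Hom B M V" "k = Comp B A M V k' x"
    using e V unfolding extends_to_projectives_def by blast
  \<comment> \<open>The error term of x a2 extends along x, so x a2 = (1 + v1) x strictly, and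
    \<open>a2\<close> induces an endomorphism c2 of the cone.\<close>
  define v1 where "v1 = Comp B M V M l k'"
  have v1: "v1 \<in> Hom B M M" using V k' D by (simp add: v1_def comp_closed)
  let ?b2 = "hadd B M M (Ident B M) v1"
  have b2: "?b2 \<in> Hom B M M" using D v1 by (simp add: hom_closed)
  have "Comp B A M M ?b2 x = Comp B A A M x a2"
    using v V k' D v1 by (simp add: comp_add_left comp_ident_left ident_closed v1_def comp_assoc)
  then obtain c2 where c2: "c2 \<in> Hom B C C" "push B C A A a2 \<delta> = pull B C C A c2 \<delta>"
    using ET3[OF r r a2(1) b2] by metis
  have "pull B C C A (Comp B C C C c c2) \<delta> = pull B C C A c2 (push B C A A a1 \<delta>)"
    using pull_comp[of C C C A c c2 \<delta>] c c2 a1(3) D by simp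
  also have "\<dots> = push B C A A a1 (push B C A A a2 \<delta>)"
    using push_pull[of C C A A a1 c2 \<delta>] c2 a1(1) D by simp
  also have "\<dots> = push B C A A (Comp B A A A a1 a2) \<delta>"
    using push_comp[of C A A A a2 a1 \<delta>] a1(1) a2(1) D by simp
  \<comment> \<open>a1 a2 is the identity plus a map through a projective. That map extends along x,
    so it pushes \<delta> to 0 because x does.\<close>
  also have "\<dots> = \<delta>"
  proof -
    obtain z where z: "z \<in> Fac A A" "Comp B A A A a1 a2 = hadd B A A (Ident B A) z"
      using a2(2) by (auto simp: stably_equal_def)
    obtain Z s t where Z: "Z \<in> projectives B" "Z \<in> Ob B" "s \<in> Hom B A Z" "t \<in> Hom B Z A" "z = Comp B A Z A t s"
      using z by (elim FacE)
    obtain s' where s': "s' \<in> Hom B M Z" "s = Comp B A M Z s' x"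
      using e Z unfolding extends_to_projectives_def by blast
    have ts: "Comp B M Z A t s' \<in> Hom B M A" using Z s' D by (simp add: comp_closed)
    have "z = Comp B A M A (Comp B M Z A t s') x" using Z s' D by (simp add: comp_assoc)
    then have "push B C A A z \<delta> = push B C M A (Comp B M Z A t s') (push B C A M x \<delta>)"
      using push_comp[of C A M A x "Comp B M Z A t s'" \<delta>] D ts by simp
    then have "push B C A A z \<delta> = \<zero>\<^bsub>Ext B C A\<^esub>"
      using push_inflation[OF r] push_zero[of C M A "Comp B M Z A t s'"] D ts by simp
    then show ?thesis
      using push_add[of C A A "Ident B A" z \<delta>] z D Fac_Hom[OF z(1)]
      by (simp add: ident_closed push_ident Ext_add_zero)
  qed
  finally have "pull B C C A (Comp B C C C c c2) \<delta> = pull B C C A (Ident B C) \<delta>"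
    using D by (simp add: pull_ident)
  then obtain n where n: "n \<in> Hom B C M" "Comp B C C C c c2 = hadd B C C (Ident B C) (Comp B C M C y n)"
    using deflation_factor_diff[OF r D(3), of "Comp B C C C c c2" "Ident B C"] c c2 D
    by (auto simp: hom_closed)
  \<comment> \<open>c c2 = 1 + y n, and c fixes y n stably because it fixes y; subtracting y n from
    c2 removes the error.\<close>
  let ?d = "hadd B C C c2 (hneg B C C (Comp B C M C y n))"
  have d: "?d \<in> Hom B C C" using c2 n D by (simp add: hom_closed)
  have yn: "Comp B C M C y n \<in> Hom B C C" using n D by (simp add: comp_closed)
  have "st C C (Comp B C M C (Comp B M C C c y) n) (Comp B C M C y n)"
    using st_comp_right[OF cy n(1) D(3)] .
  then have "st C C (Comp B C C C c (Comp B C M C y n)) (Comp B C M C y n)"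
    using D n c by (simp add: comp_assoc)
  then have "st C C (hadd B C C (hadd B C C (Ident B C) (Comp B C M C y n))
      (hneg B C C (Comp B C C C c (Comp B C M C y n))))
    (hadd B C C (hadd B C C (Ident B C) (Comp B C M C y n)) (hneg B C C (Comp B C M C y n)))"
    using D yn by (intro st_add[OF st_refl st_neg]) (simp_all add: hom_closed)
  moreover have "hadd B C C (hadd B C C (Ident B C) (Comp B C M C y n)) (hneg B C C (Comp B C M C y n)) = Ident B C"
    using D yn by (simp add: hadd_assoc hom_simps)
  moreover have "Comp B C C C c ?d = hadd B C C (hadd B C C (Ident B C) (Comp B C M C y n))
      (hneg B C C (Comp B C C C c (Comp B C M C y n)))"
    using D yn c c2 by (simp add: comp_add_right comp_neg_right hneg_closed flip: n(2))
  ultimately show ?thesis using d by (intro bexI[of _ ?d]) simp_all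
qed

end

section \<open>Syzygies\<close>

locale syzygy_setting = extriangulated B for B :: "('o, 'm, 'e, 'z) excat_scheme" +
  fixes T :: "'o set"
  assumes krull_schmidt: "krull_schmidt B"
    and enough_projectives: "enough_projectives B"
    and enough_injectives: "enough_injectives B"
    and replete: "replete_subcat B T"
    and contravariantly_finite: "contravariantly_finite B T"
    and closed_under_sums: "closed_under_sums B T"
    and closed_under_summands: "closed_under_summands B T"
    and projectives_subset: "projectives B \<subseteq> T"
    and Ext_vanishes: "Ext_vanishes B T (projectives B)"
begin

abbreviation "S \<equiv> syzygies B T"

lemma T_ob: "X \<in> T \<Longrightarrow> X \<in> Ob B"
  using replete by (auto simp: replete_subcat_def)

lemma T_iso: "\<lbrakk>X \<in> T; isomorphic B X Y; Y \<in> Ob B\<rbrakk> \<Longrightarrow> Y \<in> T"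
  using replete unfolding replete_subcat_def by blast

lemma T_sum: "\<lbrakk>X \<in> T; Y \<in> T; direct_sum B X Y Z\<rbrakk> \<Longrightarrow> Z \<in> T"
  using closed_under_sums unfolding closed_under_sums_def by blast

lemma T_summand: "\<lbrakk>Z \<in> T; direct_sum B X Y Z\<rbrakk> \<Longrightarrow> X \<in> T"
  using closed_under_summands unfolding closed_under_summands_def by blast

lemma T_cone: "\<lbrakk>E_triangle B A M C x y; C \<in> T; E_triangle B A M C' x y'\<rbrakk> \<Longrightarrow> C' \<in> T"
  using cone_unique T_iso E_triangleD(3) by blast

lemma syzygyI: "\<lbrakk>E_triangle B X P C x y; P \<in> projectives B; C \<in> T\<rbrakk> \<Longrightarrow> X \<in> S"
  using E_triangleD(1) by (auto simp: syzygies_def)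

lemma syzygyE:
  assumes "X \<in> S"
  obtains P C x y \<delta> where "realizes B X P C x y \<delta>" "P \<in> projectives B" "C \<in> T"
  using assms by (auto simp: syzygies_def E_triangle_def)

lemma syzygy_ob: "X \<in> S \<Longrightarrow> X \<in> Ob B"
  by (simp add: syzygies_def)

text \<open>The obstruction to extending k lies in the extension group of C by the projective Q,
  which vanishes.\<close>

lemma extends_if_cone_in_T:
  assumes "E_triangle B X P C x y" "C \<in> T"
  shows "extends_to_projectives B X P x"
  unfolding extends_to_projectives_def
proof (intro ballI)
  fix Q k assume Q: "Q \<in> projectives B" and k: "k \<in> Hom B X Q"
  obtain \<delta> where r: "realizes B X P C x y \<delta>" using assms by (auto simp: E_triangle_def)
  note D = realizesD[OF r]
  have "push B C X Q k \<delta> \<in> carrier (Ext B C Q)" using push_closed D projective_ob[OF Q] k by simp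
  then have "push B C X Q k \<delta> = \<zero>\<^bsub>Ext B C Q\<^esub>"
    using Ext_vanishes Q assms(2) by (auto simp: Ext_vanishes_def)
  then show "\<exists>k'\<in>Hom B P Q. k = Comp B X P Q k' x"
    using extend_along_inflation[OF r projective_ob[OF Q] k] by blast
qed

lemma extends_if_comp_extends:
  assumes e: "extends_to_projectives B X P u" and u: "u = Comp B X Y P q f"
    and ob: "X \<in> Ob B" "Y \<in> Ob B" "P \<in> Ob B" "f \<in> Hom B X Y" "q \<in> Hom B Y P"
  shows "extends_to_projectives B X Y f"
  unfolding extends_to_projectives_def
proof (intro ballI)
  fix Q k assume Q: "Q \<in> projectives B" and k: "k \<in> Hom B X Q"
  obtain k' where k': "k' \<in> Hom B P Q" "k = Comp B X P Q k' u"
    using e Q k unfolding extends_to_projectives_def by blast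
  have "k = Comp B X Y Q (Comp B Y P Q k' q) f" using k' u ob projective_ob[OF Q] by (simp add: comp_assoc)
  moreover have "Comp B Y P Q k' q \<in> Hom B Y Q" using k' ob projective_ob[OF Q] by (simp add: comp_closed)
  ultimately show "\<exists>k'\<in>Hom B Y Q. k = Comp B X Y Q k' f" by blast
qed

text \<open>Schanuel's lemma: the inflations into \<open>P \<oplus> Q\<close> built from \<open>u\<close> and from \<open>w\<close> agree up to
  automorphisms, since \<open>u\<close> and \<open>w\<close> factor through each other.\<close>

lemma cone_in_T_if_factor:
  assumes t: "E_triangle B X P C u p" "C \<in> T" "P \<in> projectives B"
    and t': "E_triangle B X Q D w v" "Q \<in> projectives B"
    and fac: "k \<in> Hom B Q P" "u = Comp B X Q P k w"
  shows "D \<in> T"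
proof -
  note E = E_triangleD[OF t(1)] E_triangleD[OF t'(1)]
  obtain l where l: "l \<in> Hom B P Q" "w = Comp B X P Q l u"
    using extends_if_cone_in_T[OF t(1,2)] t'(2) E unfolding extends_to_projectives_def by blast
  obtain Y i j r s where b: "biproduct B P Q Y i j r s"
    using ex_direct_sum[OF E(2) E(7)] by (auto simp: direct_sum_def)
  note bs = biproduct_simps[OF b]
  \<comment> \<open>The graphs (1, l) and (k, 1) are split inclusions into P + Q and both turn the
    given inflations into (u, w). The cones C + Q and D + P of this one inflation are
    isomorphic.\<close>
  let ?a = "hadd B P Y i (Comp B P Q Y j l)" and ?b = "hadd B Q Y j (Comp B Q P Y i k)"
  have a: "?a \<in> Hom B P Y" "Comp B P Y P r ?a = Ident B P"
    using bs E l(1) by (simp_all add: hom_simps)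
  have b2: "?b \<in> Hom B Q Y" "Comp B Q Y Q s ?b = Ident B Q"
    using bs E fac(1) by (simp_all add: hom_simps)
  have "Comp B X P Y ?a u = hadd B X Y (Comp B X P Y i u) (Comp B X Q Y j w)"
    using bs(1-7) E l(1) by (simp add: comp_add_left comp_assoc_right comp_closed flip: l(2))
  also have "\<dots> = Comp B X Q Y ?b w"
    using bs(1-7) E fac(1)
    by (simp add: comp_add_left comp_assoc_right comp_closed hadd_comm[of X Y "Comp B X Q Y j w"] flip: fac(2))
  finally have eq: "Comp B X P Y ?a u = Comp B X Q Y ?b w" .
  obtain G g where G: "direct_sum B C Q G" "E_triangle B X Y G (Comp B X P Y ?a u) g"
    using triangle_add_identity[OF t(1) biproduct_change_inclusion[OF b a]] by blast
  obtain H h where H: "direct_sum B D P H" "E_triangle B X Y H (Comp B X Q Y ?b w) h"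
    using triangle_add_identity[OF t'(1) biproduct_change_inclusion[OF biproduct_swap[OF b] b2]] by blast
  have "G \<in> T" using T_sum[OF t(2) _ G(1)] t'(2) projectives_subset by blast
  then have "H \<in> T" using T_cone[OF G(2)] H(2) unfolding eq by blast
  then show ?thesis using T_summand H(1) by blast
qed

text \<open>X -> R -> P and Y -> R -> P are inflations with some cones C1 and C2. Their sum is an
  inflation of R into P + P through which u factors, so C1 + C2 lies in \<open>T\<close>, and so
  does C1.\<close>

lemma syzygy_summand:
  assumes R: "R \<in> S" and b: "biproduct B X Y R i j p q"
  shows "X \<in> S"
proof -
  note bs = biproduct_simps[OF b]
  obtain P C u v \<delta> where r: "realizes B R P C u v \<delta>" and P: "P \<in> projectives B" and C: "C \<in> T"
    using R by (rule syzygyE)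
  note D = realizesD[OF r]
  obtain C1 y1 where 1: "E_triangle B X P C1 (Comp B X R P u i) y1"
    using ET4[OF realz_zero[OF b] r] unfolding E_triangle_def by blast
  obtain C2 y2 where 2: "E_triangle B Y P C2 (Comp B Y R P u j) y2"
    using ET4[OF realz_zero[OF biproduct_swap[OF b]] r] unfolding E_triangle_def by blast
  obtain d1 d2 where r1: "realizes B X P C1 (Comp B X R P u i) y1 d1"
    and r2: "realizes B Y P C2 (Comp B Y R P u j) y2 d2" using 1 2 by (auto simp: E_triangle_def)
  obtain Q k l m n where Q: "biproduct B P P Q k l m n"
    using ex_direct_sum[OF D(2,2)] by (auto simp: direct_sum_def)
  note qs = biproduct_simps[OF Q]
  obtain G g where G: "direct_sum B C1 C2 G"
    and t: "E_triangle B R Q G (hadd B R Q (Comp B R P Q k (Comp B R X P (Comp B X R P u i) p))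
        (Comp B R P Q l (Comp B R Y P (Comp B Y R P u j) q))) g"
  proof -
    obtain G a b c d where "biproduct B C1 C2 G a b c d"
      using ex_direct_sum[of C1 C2] realizesD(3)[OF r1] realizesD(3)[OF r2] by (auto simp: direct_sum_def)
    then show ?thesis using realz_sum[OF r1 r2 b Q] that unfolding E_triangle_def direct_sum_def by blast
  qed
  let ?U = "hadd B R Q (Comp B R P Q k (Comp B R X P (Comp B X R P u i) p))
        (Comp B R P Q l (Comp B R Y P (Comp B Y R P u j) q))"
  \<comment> \<open>The codiagonal P + P -> P carries the summed inflation back to u.\<close>
  have "Comp B R Q P (hadd B Q P m n) ?U
    = hadd B R P (Comp B R X P (Comp B X R P u i) p) (Comp B R Y P (Comp B Y R P u j) q)"
    using qs bs(1-7) D by (simp add: hom_simps hadd_ac)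
  also have "\<dots> = u" using biproduct_decomp_dom[OF b D(2,4)] .
  finally have "G \<in> T"
    using cone_in_T_if_factor[OF _ C P t projective_direct_sum[OF P P Q], of u v "hadd B Q P m n"]
      r qs by (auto simp: E_triangle_def hom_closed)
  then have "C1 \<in> T" using T_summand G by blast
  then show ?thesis using syzygyI[OF 1 P] by blast
qed

section \<open>Right minimal versions of maps between syzygies\<close>

lemma ex_local_length: "X \<in> Ob B \<Longrightarrow> \<exists>n. local_length B n X"
  using krull_schmidt_local_length[OF krull_schmidt] .

text \<open>Induction on the local length of R1. If f is not minimal, some summand of R1 is stably
  annihilated by f and can be discarded without changing the stable image of f; the last clause
  records this equality of images.\<close>

lemma ex_right_minimal:
  assumes R1: "R1 \<in> S" and R2: "R2 \<in> S" and f: "f \<in> Hom B R1 R2"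
  shows "\<exists>R1'\<in>S. \<exists>j\<in>Hom B R1' R1. stably_right_minimal B R1' R2 (Comp B R1' R1 R2 f j) \<and>
    (\<forall>R\<in>Ob B. \<forall>\<sigma>\<in>Hom B R R1. \<exists>\<sigma>'\<in>Hom B R R1'.
       st R R2 (Comp B R R1 R2 f \<sigma>) (Comp B R R1' R2 (Comp B R1' R1 R2 f j) \<sigma>'))"
proof -
  have trivial: "\<exists>R1'\<in>S. \<exists>j\<in>Hom B R1' R1. stably_right_minimal B R1' R2 (Comp B R1' R1 R2 f j) \<and>
    (\<forall>R\<in>Ob B. \<forall>\<sigma>\<in>Hom B R R1. \<exists>\<sigma>'\<in>Hom B R R1'.
       st R R2 (Comp B R R1 R2 f \<sigma>) (Comp B R R1' R2 (Comp B R1' R1 R2 f j) \<sigma>'))"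
    if R1: "R1 \<in> S" and f: "f \<in> Hom B R1 R2" and m: "stably_right_minimal B R1 R2 f" for R1 f
  proof -
    note ob = syzygy_ob[OF R1] syzygy_ob[OF R2]
    have "Comp B R1 R1 R2 f (Ident B R1) = f" using ob f by (simp add: comp_ident_right)
    moreover have "st R R2 (Comp B R R1 R2 f \<sigma>) (Comp B R R1 R2 f \<sigma>)"
      if "R \<in> Ob B" "\<sigma> \<in> Hom B R R1" for R \<sigma>
      using that ob f by (intro st_refl comp_closed)
    ultimately show ?thesis
      using R1 m ident_closed[OF ob(1)] by (intro bexI[of _ R1] bexI[of _ "Ident B R1"]) auto
  qed
  obtain n where "local_length B n R1" using ex_local_length syzygy_ob[OF R1] by blast
  then show ?thesis using R1 f
  proof (induction n arbitrary: R1 f)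
    case (0 R1 f)
    have Z: "zero_object B R1" using "0.prems"(1) by (cases rule: local_length.cases)
    note ob = syzygy_ob[OF 0(2)] syzygy_ob[OF R2]
    have "stably_right_minimal B R1 R2 f"
      unfolding stably_right_minimal_def
    proof (intro ballI impI bexI[of _ "Ident B R1"] conjI)
      fix r assume "r \<in> Hom B R1 R1"
      then have r: "r = Ident B R1"
        using zero_object_hom(1)[OF Z ob(1)] ident_closed[OF ob(1)] by metis
      show "st R1 R1 (Comp B R1 R1 R1 r (Ident B R1)) (Ident B R1)"
        "st R1 R1 (Comp B R1 R1 R1 (Ident B R1) r) (Ident B R1)"
        using ob by (simp_all add: r comp_ident_left ident_closed st_refl)
    qed (use ob in \<open>simp add: ident_closed\<close>)
    then show ?case using trivial 0(2,3) by blast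
  next
    case (Suc n R1 f)
    note f = Suc.prems(3)
    note ob = syzygy_ob[OF Suc.prems(2)] syzygy_ob[OF R2]
    show ?case
    proof (cases "stably_right_minimal B R1 R2 f")
      case True
      then show ?thesis using trivial Suc.prems(2,3) by blast
    next
      case False
      then obtain r where r: "r \<in> Hom B R1 R1" "st R1 R2 (Comp B R1 R1 R2 f r) f"
        "\<not> (\<exists>r'\<in>Hom B R1 R1. st R1 R1 (Comp B R1 R1 R1 r r') (Ident B R1) \<and>
          st R1 R1 (Comp B R1 R1 R1 r' r) (Ident B R1))"
        unfolding stably_right_minimal_def by blast
      have "\<not> is_iso B R1 R1 r"
      proof
        assume "is_iso B R1 R1 r"
        then obtain r' where "r' \<in> Hom B R1 R1" "Comp B R1 R1 R1 r r' = Ident B R1"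
          "Comp B R1 R1 R1 r' r = Ident B R1" by (auto simp: is_iso_def)
        then show False using r(3) st_refl[OF ob(1,1) ident_closed[OF ob(1)]] by metis
      qed
      \<comment> \<open>f r ~ f makes f (1 - r) stably zero. Since r is not invertible in B,
        \<open>exchange\<close> gives a summand whose inclusion factors through 1 - r and is
        therefore killed by f.\<close>
      let ?s = "hadd B R1 R1 (Ident B R1) (hneg B R1 R1 r)"
      have s: "?s \<in> Hom B R1 R1" using ob r by (simp add: hom_closed)
      have "hadd B R1 R1 (Ident B R1) (hneg B R1 R1 ?s) = r"
        using ob r(1) by (simp add: hom_simps)
      then obtain m X S' w w' j p q where X: "local_length B n S'" and b: "biproduct B X S' R1 w j p q"
        and w': "w' \<in> Hom B X R1" "w = Comp B X R1 R1 ?s w'"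
        using exchange[OF Suc.prems(1) s] \<open>\<not> is_iso B R1 R1 r\<close> by auto
      note bs = biproduct_simps[OF b]
      have "Comp B R1 R1 R2 f ?s = hadd B R1 R2 f (hneg B R1 R2 (Comp B R1 R1 R2 f r))"
        using ob r(1) f by (simp add: hom_simps)
      then have "st R1 R2 (Comp B R1 R1 R2 f ?s) (hzero B R1 R2)"
        using st_diff_zero[OF st_sym[OF r(2)]] by simp
      then have "st X R2 (Comp B X R1 R2 (Comp B R1 R1 R2 f ?s) w') (Comp B X R1 R2 (hzero B R1 R2) w')"
        using st_comp_right w'(1) bs(1) by blast
      then have fw: "st X R2 (Comp B X R1 R2 f w) (hzero B X R2)"
        using ob bs(1) w' s f by (simp add: comp_assoc_right comp_zero_left)
      have S': "S' \<in> S" using syzygy_summand[OF Suc.prems(2) biproduct_swap[OF b]] .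
      let ?f = "Comp B S' R1 R2 f j"
      have fj: "?f \<in> Hom B S' R2" using bs ob f by (simp add: comp_closed)
      obtain R1' j' where R1': "R1' \<in> S" "j' \<in> Hom B R1' S'"
        and min: "stably_right_minimal B R1' R2 (Comp B R1' S' R2 ?f j')"
        and im: "\<And>R \<sigma>. \<lbrakk>R \<in> Ob B; \<sigma> \<in> Hom B R S'\<rbrakk> \<Longrightarrow> \<exists>\<sigma>'\<in>Hom B R R1'.
           st R R2 (Comp B R S' R2 ?f \<sigma>) (Comp B R R1' R2 (Comp B R1' S' R2 ?f j') \<sigma>')"
        using Suc.IH[OF X S' fj] by blast
      note ob' = syzygy_ob[OF R1'(1)]
      have eq: "Comp B R1' S' R2 ?f j' = Comp B R1' R1 R2 f (Comp B R1' S' R1 j j')"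
        using ob ob' bs(1-7) R1'(2) f by (simp add: comp_assoc_right)
      have "\<exists>\<sigma>'\<in>Hom B R R1'. st R R2 (Comp B R R1 R2 f \<sigma>) (Comp B R R1' R2 (Comp B R1' S' R2 ?f j') \<sigma>')"
        if R: "R \<in> Ob B" and \<sigma>: "\<sigma> \<in> Hom B R R1" for R \<sigma>
      proof -
        let ?p = "Comp B R R1 X p \<sigma>" and ?q = "Comp B R R1 S' q \<sigma>"
        have pq: "?p \<in> Hom B R X" "?q \<in> Hom B R S'" using bs R \<sigma> by (simp_all add: comp_closed)
        have "Comp B R R1 R2 f \<sigma> = Comp B R R1 R2 f (hadd B R R1 (Comp B R X R1 w ?p) (Comp B R S' R1 j ?q))"
          using biproduct_decomp[OF b R \<sigma>] by simp
        also have "\<dots> = hadd B R R2 (Comp B R X R2 (Comp B X R1 R2 f w) ?p) (Comp B R S' R2 ?f ?q)"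
          using ob bs(1-7) R pq f by (simp add: comp_add_right comp_assoc_right comp_closed)
        finally have 1: "Comp B R R1 R2 f \<sigma>
          = hadd B R R2 (Comp B R X R2 (Comp B X R1 R2 f w) ?p) (Comp B R S' R2 ?f ?q)" .
        have "st R R2 (Comp B R X R2 (Comp B X R1 R2 f w) ?p) (Comp B R X R2 (hzero B X R2) ?p)"
          using st_comp_right[OF fw pq(1) R] .
        then have "st R R2 (Comp B R X R2 (Comp B X R1 R2 f w) ?p) (hzero B R R2)"
          using R bs(1) ob pq by (simp add: comp_zero_left)
        then have "st R R2 (hadd B R R2 (Comp B R X R2 (Comp B X R1 R2 f w) ?p) (Comp B R S' R2 ?f ?q))
          (hadd B R R2 (hzero B R R2) (Comp B R S' R2 ?f ?q))"
          using R bs(1,2) ob pq fj by (intro st_add st_refl) (simp_all add: comp_closed)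
        then have 2: "st R R2 (Comp B R R1 R2 f \<sigma>) (Comp B R S' R2 ?f ?q)"
          using 1 R bs(1,2) ob pq fj by (simp add: hadd_zero_left comp_closed)
        show ?thesis using im[OF R pq(2)] 2 st_trans by blast
      qed
      moreover have "Comp B R1' S' R1 j j' \<in> Hom B R1' R1" using ob ob' bs R1' by (simp add: comp_closed)
      ultimately show ?thesis using R1'(1) min unfolding eq by blast
    qed
  qed
qed

text \<open>The octahedral axiom for f and q yields everything except membership of the new cone in
  \<open>T\<close>. That cone is isomorphic to \<open>T'\<close>, the cone of q f in another
  triangle.\<close>

lemma complete_diagram:
  assumes r: "realizes B R1 R2 A f g \<delta>" and q: "E_triangle B R2 P T2 q v"
    and P: "P \<in> projectives B" and T2: "T2 \<in> T"
    and u: "E_triangle B R1 P T' (Comp B R1 R2 P q f) p'" and T': "T' \<in> T"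
  shows "\<exists>T1 p h t \<delta>u. syzygy_diagram B T R1 R2 A P T1 T2 f g (Comp B R1 R2 P q f) p q v h t \<and>
    realizes B R1 P T1 (Comp B R1 R2 P q f) p \<delta>u \<and> h \<in> Hom B A T1 \<and> \<delta> = pull B A T1 R1 h \<delta>u"
proof -
  obtain \<delta>q where rq: "realizes B R2 P T2 q v \<delta>q" using q by (auto simp: E_triangle_def)
  obtain E p h t \<delta>u where E: "p \<in> Hom B P E" "h \<in> Hom B A E" "t \<in> Hom B E T2"
    "Comp B R2 A E h g = Comp B R2 P E p q" "Comp B P E T2 t p = v"
    "realizes B R1 P E (Comp B R1 R2 P q f) p \<delta>u"
    "realizes B A E T2 h t (push B T2 R2 A g \<delta>q)" "pull B A E R1 h \<delta>u = \<delta>"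
    using ET4[OF r rq] by blast
  have tE: "E_triangle B R1 P E (Comp B R1 R2 P q f) p" using E(6) by (auto simp: E_triangle_def)
  have "E \<in> T" using T_cone[OF u T' tE] .
  then have "syzygy_diagram B T R1 R2 A P E T2 f g (Comp B R1 R2 P q f) p q v h t"
    using E P T2 q r tE unfolding syzygy_diagram_def E_triangle_def by auto
  then show ?thesis using E by blast
qed

text \<open>R2' is R2 + P1 and f' is (f, u1), which is an inflation as the graph R1 -> R2 + R1
  followed by 1 + u1. Stably, i and \<pi> identify R2' with R2 and f' with f.\<close>

lemma ex_diagram:
  assumes R1: "R1 \<in> S" and R2: "R2 \<in> S" and f: "f \<in> Hom B R1 R2"
  shows "\<exists>R2' A P T1 T2 f' g u p q v h t i \<pi> \<delta>.
    syzygy_diagram B T R1 R2' A P T1 T2 f' g u p q v h t \<and>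
    i \<in> Hom B R2 R2' \<and> \<pi> \<in> Hom B R2' R2 \<and> Comp B R2 R2' R2 \<pi> i = Ident B R2 \<and>
    st R2' R2' (Comp B R2' R2 R2' i \<pi>) (Ident B R2') \<and> Comp B R1 R2' R2 \<pi> f' = f \<and>
    realizes B R1 R2' A f' g (pull B A T1 R1 h \<delta>) \<and> realizes B R1 P T1 u p \<delta>"
proof -
  obtain P1 C1 u1 p1 d1 where r1: "realizes B R1 P1 C1 u1 p1 d1" and P1: "P1 \<in> projectives B" and C1: "C1 \<in> T"
    using R1 by (rule syzygyE)
  obtain P2 C2 q2 v2 d2 where r2: "realizes B R2 P2 C2 q2 v2 d2" and P2: "P2 \<in> projectives B" and C2: "C2 \<in> T"
    using R2 by (rule syzygyE)
  note D1 = realizesD[OF r1] and D2 = realizesD[OF r2]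
  have t1: "E_triangle B R1 P1 C1 u1 p1" using r1 by (auto simp: E_triangle_def)
  obtain Z where Z: "zero_object B Z" using ex_zero_object by blast
  have Zo: "Z \<in> Ob B" using Z by (rule zero_object_ob)
  obtain R2' i j \<pi> \<kappa> where b: "biproduct B R2 P1 R2' i j \<pi> \<kappa>"
    using ex_direct_sum[OF D2(1) D1(2)] by (auto simp: direct_sum_def)
  note bs = biproduct_simps[OF b]
  obtain V i0 j0 p0 q0 where c: "biproduct B R2 R1 V i0 j0 p0 q0"
    using ex_direct_sum[OF D2(1) D1(1)] by (auto simp: direct_sum_def)
  note cs = biproduct_simps[OF c]
  obtain P k l m n where d: "biproduct B P2 P1 P k l m n"
    using ex_direct_sum[OF D2(2) D1(2)] by (auto simp: direct_sum_def)
  note ds = biproduct_simps[OF d]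
  have P: "P \<in> projectives B" using projective_direct_sum[OF P2 P1 d] .
  let ?f = "hadd B R1 R2' (Comp B R1 R2 R2' i f) (Comp B R1 P1 R2' j u1)"
  obtain A g \<delta> where rf: "realizes B R1 R2' A ?f g \<delta>"
  proof -
    \<comment> \<open>The graph (f, 1), a split inflation, so that the composite with 1 + u1 falls
      under (ET4).\<close>
    let ?w = "hadd B R1 V (Comp B R1 R2 V i0 f) j0"
    have w: "?w \<in> Hom B R1 V" "Comp B R1 V R1 q0 ?w = Ident B R1"
      using cs f by (simp_all add: hom_simps)
    obtain x where x: "biproduct B R1 R2 V ?w i0 q0 x"
      using biproduct_change_inclusion[OF biproduct_swap[OF c] w] by blast
    have "realizes B V R2' C1
      (hadd B V R2' (Comp B V R2 R2' i (Comp B V R2 R2 (Ident B R2) p0))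
        (Comp B V P1 R2' j (Comp B V R1 P1 u1 q0)))
      (hadd B R2' C1 (Comp B R2' Z C1 (hzero B Z C1) (Comp B R2' R2 Z (hzero B R2 Z) \<pi>))
         (Comp B R2' C1 C1 (Ident B C1) (Comp B R2' P1 C1 p1 \<kappa>)))
      (push B C1 R2 V i0 (pull B C1 Z R2 (hzero B C1 Z) \<zero>\<^bsub>Ext B Z R2\<^esub>) \<oplus>\<^bsub>Ext B C1 V\<^esub>
       push B C1 R1 V j0 (pull B C1 C1 R1 (Ident B C1) d1))"
      by (rule realz_sum[OF realizes_Ident_left[OF Z D2(1)] r1 c b
          biproduct_swap[OF biproduct_zero_right[OF Z D1(3)]]])
    from ET4[OF realz_zero[OF x] this] obtain A g \<delta> where
      "realizes B R1 R2' A (Comp B R1 V R2' (hadd B V R2' (Comp B V R2 R2' i (Comp B V R2 R2 (Ident B R2) p0))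
        (Comp B V P1 R2' j (Comp B V R1 P1 u1 q0))) ?w) g \<delta>" by blast
    moreover have "Comp B R1 V R2' (hadd B V R2' (Comp B V R2 R2' i (Comp B V R2 R2 (Ident B R2) p0))
        (Comp B V P1 R2' j (Comp B V R1 P1 u1 q0))) ?w = ?f"
      using cs bs(1-7) D1 D2 f by (simp add: hom_simps)
    ultimately show ?thesis using that by simp
  qed
  \<comment> \<open>q2 + 1 : R2 + P1 -> P2 + P1, an inflation into a projective with the same cone
    C2 as q2.\<close>
  let ?q = "hadd B R2' P (Comp B R2' P2 P k (Comp B R2' R2 P2 q2 \<pi>)) (Comp B R2' P1 P l (Comp B R2' P1 P1 (Ident B P1) \<kappa>))"
  obtain v where tq: "E_triangle B R2' P C2 ?q v"
    using realz_sum[OF r2 realizes_Ident_left[OF Z D1(2)] b d biproduct_zero_right[OF Z D2(3)]]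
    unfolding E_triangle_def by blast
  \<comment> \<open>Since C1 lies in \<open>T\<close>, the map q2 f extends along u1 to some s. So
    (q2 f, u1) is u1 followed by the split inclusion (s, 1), and C1 + P2 in \<open>T\<close> is a
    cone of it.\<close>
  have "Comp B R1 R2 P2 q2 f \<in> Hom B R1 P2" using D1 D2 f by (simp add: comp_closed)
  then obtain s where s: "s \<in> Hom B P1 P2" "Comp B R1 R2 P2 q2 f = Comp B R1 P1 P2 s u1"
    using extends_if_cone_in_T[OF t1 C1] P2 unfolding extends_to_projectives_def by blast
  let ?w = "hadd B P1 P l (Comp B P1 P2 P k s)"
  have w: "?w \<in> Hom B P1 P" "Comp B P1 P P1 n ?w = Ident B P1" using ds s(1) by (simp_all add: hom_simps)
  obtain G y where G: "direct_sum B C1 P2 G" "E_triangle B R1 P G (Comp B R1 P1 P ?w u1) y"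
    using triangle_add_identity[OF t1 biproduct_change_inclusion[OF biproduct_swap[OF d] w]] by blast
  have GT: "G \<in> T" using T_sum[OF C1 _ G(1)] P2 projectives_subset by blast
  have eq: "Comp B R1 P1 P ?w u1 = Comp B R1 R2' P ?q ?f"
  proof -
    have "Comp B R1 R2' P ?q ?f = hadd B R1 P (Comp B R1 P2 P k (Comp B R1 R2 P2 q2 f)) (Comp B R1 P1 P l u1)"
      using bs ds(1-7) D1 D2 f by (simp add: hom_simps)
    then show ?thesis
      using ds(1-7) D1 D2 s by (simp add: hom_simps hadd_comm[of R1 P "Comp B R1 P1 P l u1"])
  qed
  obtain T1 p h t \<delta>u where dg: "syzygy_diagram B T R1 R2' A P T1 C2 ?f g (Comp B R1 R2' P ?q ?f) p ?q v h t"
    "realizes B R1 P T1 (Comp B R1 R2' P ?q ?f) p \<delta>u" "\<delta> = pull B A T1 R1 h \<delta>u"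
    using complete_diagram[OF rf tq P C2 G(2)[unfolded eq] GT] by blast
  have pf: "Comp B R1 R2' R2 \<pi> ?f = f" using bs D1 D2 f by (simp add: hom_simps)
  \<comment> \<open>1 - i \<pi> = j \<kappa> factors through P1, so i and \<pi> are stably
    inverse.\<close>
  have "Comp B R2' P1 R2' j \<kappa> \<in> Fac R2' R2'" using bs FacI[OF P1] by simp
  then have "st R2' R2' (hadd B R2' R2' (Comp B R2' R2 R2' i \<pi>) (Comp B R2' P1 R2' j \<kappa>)) (Comp B R2' R2 R2' i \<pi>)"
    using bs by (intro stI) (simp_all add: comp_closed)
  then have "st R2' R2' (Comp B R2' R2 R2' i \<pi>) (Ident B R2')"
    using biproductD(12)[OF b] st_sym by simp
  then show ?thesis using dg rf pf bs(4,6,8) by blast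
qed

end

section \<open>Fullness and density in terms of representatives\<close>

context syzygy_setting
begin

definition stable_epi :: "'o \<Rightarrow> 'o \<Rightarrow> 'm \<Rightarrow> bool" where
  "stable_epi Y X c \<longleftrightarrow> (\<forall>R\<in>S. \<forall>\<phi>\<in>Hom B R X. \<exists>\<rho>\<in>Hom B R Y. st R X \<phi> (Comp B R Y X c \<rho>))"

text \<open>Exactness of F R1 -> F R2 -> F X -> 0 on representatives.\<close>

definition stable_coker :: "'o \<Rightarrow> 'o \<Rightarrow> 'o \<Rightarrow> 'm \<Rightarrow> 'm \<Rightarrow> bool" where
  "stable_coker R1 R2 X f c \<longleftrightarrow> f \<in> Hom B R1 R2 \<and> c \<in> Hom B R2 X \<and> X \<in> Ob B \<and> stable_epi R2 X c \<and>
     (\<forall>R\<in>S. \<forall>\<rho>\<in>Hom B R R2. st R X (Comp B R R2 X c \<rho>) (hzero B R X) \<longleftrightarrow>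
        (\<exists>\<sigma>\<in>Hom B R R1. st R R2 \<rho> (Comp B R R1 R2 f \<sigma>)))"

definition stable_zero :: "'o \<Rightarrow> 'o \<Rightarrow> 'm \<Rightarrow> bool" where
  "stable_zero X Y h \<longleftrightarrow> (\<forall>R\<in>S. \<forall>\<phi>\<in>Hom B R X. st R Y (Comp B R X Y h \<phi>) (hzero B R Y))"

text \<open>A natural transformation \<open>Hom(-,X) \<rightarrow> Hom(-,Y)\<close> on the stable category of syzygies, given by
  representatives in \<open>B\<close>.\<close>

definition stable_family :: "'o \<Rightarrow> 'o \<Rightarrow> ('o \<Rightarrow> 'm \<Rightarrow> 'm) \<Rightarrow> bool" where
  "stable_family X Y \<Phi> \<longleftrightarrow>
     (\<forall>R\<in>S. \<forall>\<rho>\<in>Hom B R X. \<Phi> R \<rho> \<in> Hom B R Y) \<and>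
     (\<forall>R\<in>S. \<forall>\<rho> \<rho>'. st R X \<rho> \<rho>' \<longrightarrow> st R Y (\<Phi> R \<rho>) (\<Phi> R \<rho>')) \<and>
     (\<forall>R\<in>S. \<forall>\<rho>\<in>Hom B R X. \<forall>\<rho>'\<in>Hom B R X.
        st R Y (\<Phi> R (hadd B R X \<rho> \<rho>')) (hadd B R Y (\<Phi> R \<rho>) (\<Phi> R \<rho>'))) \<and>
     (\<forall>R\<in>S. \<forall>R'\<in>S. \<forall>r\<in>Hom B R' R. \<forall>\<rho>\<in>Hom B R X.
        st R' Y (\<Phi> R' (Comp B R' R X \<rho> r)) (Comp B R' R Y (\<Phi> R \<rho>) r))"

text \<open>The part of fullness concerning maps out of F X, isolated so that it can be checked on
  indecomposable summands.\<close>

definition full_at :: "'o \<Rightarrow> bool" where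
  "full_at X \<longleftrightarrow> (\<forall>Y\<in>Ob B. \<forall>\<Phi>. stable_family X Y \<Phi> \<longrightarrow>
     (\<exists>c\<in>Hom B X Y. \<forall>R\<in>S. \<forall>\<rho>\<in>Hom B R X. st R Y (\<Phi> R \<rho>) (Comp B R X Y c \<rho>)))"

lemma stable_familyD:
  assumes "stable_family X Y \<Phi>" "R \<in> S"
  shows "\<rho> \<in> Hom B R X \<Longrightarrow> \<Phi> R \<rho> \<in> Hom B R Y"
    "st R X \<rho> \<rho>' \<Longrightarrow> st R Y (\<Phi> R \<rho>) (\<Phi> R \<rho>')"
    "\<lbrakk>\<rho> \<in> Hom B R X; \<rho>' \<in> Hom B R X\<rbrakk> \<Longrightarrow>
        st R Y (\<Phi> R (hadd B R X \<rho> \<rho>')) (hadd B R Y (\<Phi> R \<rho>) (\<Phi> R \<rho>'))"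
    "\<lbrakk>R' \<in> S; r \<in> Hom B R' R; \<rho> \<in> Hom B R X\<rbrakk> \<Longrightarrow>
        st R' Y (\<Phi> R' (Comp B R' R X \<rho> r)) (Comp B R' R Y (\<Phi> R \<rho>) r)"
  using assms unfolding stable_family_def by blast+

lemma stable_family_zero:
  assumes \<Phi>: "stable_family X Y \<Phi>" and R: "R \<in> S" and ob: "X \<in> Ob B" "Y \<in> Ob B"
  shows "st R Y (\<Phi> R (hzero B R X)) (hzero B R Y)"
proof -
  note Ro = syzygy_ob[OF R]
  have "st R Y (\<Phi> R (Comp B R R X (hzero B R X) (hzero B R R))) (Comp B R R Y (\<Phi> R (hzero B R X)) (hzero B R R))"
    using stable_familyD(4)[OF \<Phi> R R] Ro ob by (simp add: hzero_closed)
  then show ?thesis using Ro ob stable_familyD(1)[OF \<Phi> R] by (simp add: comp_zero_right hzero_closed)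
qed

lemma full_at_if_Hom_zero:
  assumes X: "X \<in> Ob B" and z: "\<And>R \<phi>. \<lbrakk>R \<in> S; \<phi> \<in> Hom B R X\<rbrakk> \<Longrightarrow> st R X \<phi> (hzero B R X)"
  shows "full_at X"
  unfolding full_at_def
proof (intro ballI allI impI)
  fix Y \<Phi> assume Y: "Y \<in> Ob B" and \<Phi>: "stable_family X Y \<Phi>"
  have "st R Y (\<Phi> R \<rho>) (Comp B R X Y (hzero B X Y) \<rho>)" if R: "R \<in> S" and \<rho>: "\<rho> \<in> Hom B R X" for R \<rho>
    using st_trans[OF stable_familyD(2)[OF \<Phi> R z[OF R \<rho>]] stable_family_zero[OF \<Phi> R X Y]]
      X Y syzygy_ob[OF R] \<rho> by (simp add: comp_zero_left)
  then show "\<exists>c\<in>Hom B X Y. \<forall>R\<in>S. \<forall>\<rho>\<in>Hom B R X. st R Y (\<Phi> R \<rho>) (Comp B R X Y c \<rho>)"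
    using hzero_closed[OF X Y] by blast
qed

text \<open>A family on the sum restricts along the inclusions i and j; representing maps c and d of
  the restrictions combine to c p + d q.\<close>

lemma full_at_biproduct:
  assumes b: "biproduct B X Y V i j p q" and X: "full_at X" and Y: "full_at Y"
  shows "full_at V"
  unfolding full_at_def
proof (intro ballI allI impI)
  fix W \<Phi> assume W: "W \<in> Ob B" and \<Phi>: "stable_family V W \<Phi>"
  note bs = biproduct_simps[OF b]
  have fam: "stable_family U W (\<lambda>R \<rho>. \<Phi> R (Comp B R U V k \<rho>))" if k: "k \<in> Hom B U V" and U: "U \<in> Ob B" for U k
    unfolding stable_family_def
  proof (intro conjI ballI allI impI)
    fix R \<rho> assume R: "R \<in> S" and \<rho>: "\<rho> \<in> Hom B R U"
    note Ro = syzygy_ob[OF R]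
    have k\<rho>: "Comp B R U V k \<rho> \<in> Hom B R V" using k U Ro bs(3) \<rho> by (simp add: comp_closed)
    then show "\<Phi> R (Comp B R U V k \<rho>) \<in> Hom B R W" using stable_familyD(1)[OF \<Phi> R] by blast
    {
      fix \<rho>' assume \<rho>': "\<rho>' \<in> Hom B R U"
      have "Comp B R U V k \<rho>' \<in> Hom B R V" using k U Ro bs(3) \<rho>' by (simp add: comp_closed)
      then show "st R W (\<Phi> R (Comp B R U V k (hadd B R U \<rho> \<rho>')))
        (hadd B R W (\<Phi> R (Comp B R U V k \<rho>)) (\<Phi> R (Comp B R U V k \<rho>')))"
        using stable_familyD(3)[OF \<Phi> R k\<rho>] k U Ro bs(3) \<rho> \<rho>' by (simp add: comp_add_right)
    }
    fix R' r assume R': "R' \<in> S" and r: "r \<in> Hom B R' R"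
    show "st R' W (\<Phi> R' (Comp B R' U V k (Comp B R' R U \<rho> r))) (Comp B R' R W (\<Phi> R (Comp B R U V k \<rho>)) r)"
      using stable_familyD(4)[OF \<Phi> R R' r k\<rho>] k U Ro syzygy_ob[OF R'] bs(3) \<rho> r by (simp add: comp_assoc)
  next
    fix R \<rho> \<rho>' assume R: "R \<in> S" and e: "st R U \<rho> \<rho>'"
    show "st R W (\<Phi> R (Comp B R U V k \<rho>)) (\<Phi> R (Comp B R U V k \<rho>'))"
      using stable_familyD(2)[OF \<Phi> R st_comp_left[OF e k bs(3)]] .
  qed
  obtain c where c: "c \<in> Hom B X W" "\<And>R \<rho>. \<lbrakk>R \<in> S; \<rho> \<in> Hom B R X\<rbrakk>
      \<Longrightarrow> st R W (\<Phi> R (Comp B R X V i \<rho>)) (Comp B R X W c \<rho>)"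
    using X W fam[OF bs(4,1)] unfolding full_at_def by blast
  obtain d where d: "d \<in> Hom B Y W" "\<And>R \<rho>. \<lbrakk>R \<in> S; \<rho> \<in> Hom B R Y\<rbrakk>
      \<Longrightarrow> st R W (\<Phi> R (Comp B R Y V j \<rho>)) (Comp B R Y W d \<rho>)"
    using Y W fam[OF bs(5,2)] unfolding full_at_def by blast
  let ?e = "hadd B V W (Comp B V X W c p) (Comp B V Y W d q)"
  have "st R W (\<Phi> R \<rho>) (Comp B R V W ?e \<rho>)" if R: "R \<in> S" and \<rho>: "\<rho> \<in> Hom B R V" for R \<rho>
  proof -
    note Ro = syzygy_ob[OF R]
    let ?p = "Comp B R V X p \<rho>" and ?q = "Comp B R V Y q \<rho>"
    have pq: "?p \<in> Hom B R X" "?q \<in> Hom B R Y" using bs Ro \<rho> by (simp_all add: comp_closed)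
    have ij: "Comp B R X V i ?p \<in> Hom B R V" "Comp B R Y V j ?q \<in> Hom B R V"
      using bs(1-7) Ro pq by (simp_all add: comp_closed)
    have "st R W (\<Phi> R \<rho>) (hadd B R W (\<Phi> R (Comp B R X V i ?p)) (\<Phi> R (Comp B R Y V j ?q)))"
      using stable_familyD(3)[OF \<Phi> R ij] biproduct_decomp[OF b Ro \<rho>] by simp
    also have "st R W \<dots> (hadd B R W (Comp B R X W c ?p) (Comp B R Y W d ?q))"
      using c(2)[OF R pq(1)] d(2)[OF R pq(2)] by (rule st_add)
    also have "\<dots> = Comp B R V W ?e \<rho>"
      using bs(1-7) Ro \<rho> c(1) d(1) W by (simp add: comp_add_left comp_assoc_right comp_closed)
    finally show ?thesis .
  qed
  moreover have "?e \<in> Hom B V W" using bs c(1) d(1) W by (simp add: hom_closed)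
  ultimately show "\<exists>c\<in>Hom B V W. \<forall>R\<in>S. \<forall>\<rho>\<in>Hom B R V. st R W (\<Phi> R \<rho>) (Comp B R V W c \<rho>)" by blast
qed

lemma full_at_if_indecomposables:
  assumes ind: "\<And>A. indecomposable B A \<Longrightarrow> full_at A" and X: "X \<in> Ob B"
  shows "full_at X"
proof -
  obtain n where "local_length B n X" using ex_local_length X by blast
  then show ?thesis
  proof (induction rule: local_length.induct)
    case (zero Z)
    note Z = zero_object_ob[OF zero]
    show ?case
    proof (rule full_at_if_Hom_zero[OF Z])
      fix R \<phi> assume "R \<in> S" "\<phi> \<in> Hom B R Z"
      then show "st R Z \<phi> (hzero B R Z)"
        using zero_object_hom(1)[OF zero syzygy_ob] st_refl hzero_closed Z syzygy_ob by metis
    qed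
  next
    case (add X Y S' i j p q n)
    then show ?case using full_at_biproduct ind local_object_indecomposable by blast
  qed
qed

text \<open>Every element of F A is stably g \<rho>, and h g = p q passes through the projective
  P.\<close>

lemma stable_zero_if_epi:
  assumes g: "stable_epi R2 A g" "g \<in> Hom B R2 A" and R2: "R2 \<in> S" and h: "h \<in> Hom B A T1"
    and ob: "A \<in> Ob B" "T1 \<in> Ob B" and P: "P \<in> projectives B" "q \<in> Hom B R2 P" "p \<in> Hom B P T1"
    and eq: "Comp B R2 P T1 p q = Comp B R2 A T1 h g"
  shows "stable_zero A T1 h"
  unfolding stable_zero_def
proof (intro ballI)
  fix R \<phi> assume R: "R \<in> S" and \<phi>: "\<phi> \<in> Hom B R A"
  note Ro = syzygy_ob[OF R] syzygy_ob[OF R2] projective_ob[OF P(1)]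
  obtain \<rho> where \<rho>: "\<rho> \<in> Hom B R R2" "st R A \<phi> (Comp B R R2 A g \<rho>)"
    using g R \<phi> unfolding stable_epi_def by blast
  have "st R T1 (Comp B R A T1 h \<phi>) (Comp B R A T1 h (Comp B R R2 A g \<rho>))"
    using st_comp_left[OF \<rho>(2) h ob(2)] .
  also have "\<dots> = Comp B R P T1 p (Comp B R R2 P q \<rho>)"
    using comp_assoc[OF Ro(1,2) ob \<rho>(1) g(2) h] comp_assoc[OF Ro(1,2,3) ob(2) \<rho>(1) P(2,3)] eq by simp
  also have "st R T1 \<dots> (hzero B R T1)"
    using P Ro ob \<rho>(1) by (subst st_zero_iff) (simp_all add: FacI comp_closed)
  finally show "st R T1 (Comp B R A T1 h \<phi>) (hzero B R T1)" .
qed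

text \<open>A Yoneda argument: R2 is a syzygy, so on composites with g the family is given by its
  value at g. That value vanishes stably on f and descends to A; surjectivity of F g shows that the
  descended map represents the family.\<close>

lemma full_at_if_stable_epi:
  assumes r: "realizes B R1 R2 A f g \<delta>" and R: "R1 \<in> S" "R2 \<in> S"
    and e: "extends_to_projectives B R1 R2 f" and g: "stable_epi R2 A g"
  shows "full_at A"
  unfolding full_at_def
proof (intro ballI allI impI)
  fix Y \<Phi> assume Y: "Y \<in> Ob B" and \<Phi>: "stable_family A Y \<Phi>"
  note D = realizesD[OF r]
  let ?b = "\<Phi> R2 g"
  have b: "?b \<in> Hom B R2 Y" using stable_familyD(1)[OF \<Phi> R(2) D(5)] .
  have 1: "st R' Y (\<Phi> R' (Comp B R' R2 A g \<rho>)) (Comp B R' R2 Y ?b \<rho>)" if "R' \<in> S" "\<rho> \<in> Hom B R' R2" for R' \<rho>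
    using stable_familyD(4)[OF \<Phi> R(2) that D(5)] .
  have "st R1 Y (\<Phi> R1 (hzero B R1 A)) (Comp B R1 R2 Y ?b f)" using 1[OF R(1) D(4)] comp_triangle[OF r] by simp
  then have "st R1 Y (Comp B R1 R2 Y ?b f) (hzero B R1 Y)"
    using stable_family_zero[OF \<Phi> R(1) D(3) Y] st_sym st_trans by blast
  then obtain c where c: "c \<in> Hom B A Y" "st R2 Y ?b (Comp B R2 A Y c g)"
    using stable_cokernel[OF r e Y b] by blast
  have "st R' Y (\<Phi> R' \<phi>) (Comp B R' A Y c \<phi>)" if R': "R' \<in> S" and \<phi>: "\<phi> \<in> Hom B R' A" for R' \<phi>
  proof -
    note Ro = syzygy_ob[OF R']
    obtain \<rho> where \<rho>: "\<rho> \<in> Hom B R' R2" "st R' A \<phi> (Comp B R' R2 A g \<rho>)"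
      using g R' \<phi> unfolding stable_epi_def by blast
    have "st R' Y (\<Phi> R' \<phi>) (\<Phi> R' (Comp B R' R2 A g \<rho>))" using stable_familyD(2)[OF \<Phi> R' \<rho>(2)] .
    also have "st R' Y \<dots> (Comp B R' R2 Y ?b \<rho>)" using 1[OF R' \<rho>(1)] .
    also have "st R' Y \<dots> (Comp B R' R2 Y (Comp B R2 A Y c g) \<rho>)" using st_comp_right[OF c(2) \<rho>(1) Ro] .
    also have "\<dots> = Comp B R' A Y c (Comp B R' R2 A g \<rho>)" using D Y Ro c \<rho> by (simp add: comp_assoc)
    also have "st R' Y \<dots> (Comp B R' A Y c \<phi>)" using st_comp_left[OF st_sym[OF \<rho>(2)] c(1) Y] .
    finally show ?thesis .
  qed
  then show "\<exists>c\<in>Hom B A Y. \<forall>R\<in>S. \<forall>\<rho>\<in>Hom B R A. st R Y (\<Phi> R \<rho>) (Comp B R A Y c \<rho>)" using c(1) by blast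
qed

lemma stable_epi_if_pullback:
  assumes r: "realizes B R1 R2 A f g (pull B A T1 R1 h \<delta>)" and u: "realizes B R1 P T1 u p \<delta>"
    and h: "h \<in> Hom B A T1" and z: "stable_zero A T1 h"
  shows "stable_epi R2 A g"
  unfolding stable_epi_def
proof (intro ballI)
  fix R \<phi> assume R: "R \<in> S" and \<phi>: "\<phi> \<in> Hom B R A"
  note D = realizesD[OF r]
  obtain \<rho> where "\<rho> \<in> Hom B R R2" "\<phi> = Comp B R R2 A g \<rho>"
    using lift_if_pullback_projective[OF r u h syzygy_ob[OF R] \<phi>] z R \<phi> unfolding stable_zero_def by blast
  then show "\<exists>\<rho>\<in>Hom B R R2. st R A \<phi> (Comp B R R2 A g \<rho>)"
    using st_refl[OF syzygy_ob[OF R] D(3) \<phi>] by blast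
qed

text \<open>Only the triangles of u and h are kept, since a given diagram does not say that its
  extension of A by R1 is pulled back along h. The dual octahedral axiom rebuilds a diagram for
  which this holds.\<close>

lemma full_at_if_stable_zero:
  assumes u: "E_triangle B R1 P T1 u p" and h: "E_triangle B A T1 T2 h t" and T: "T1 \<in> T" "T2 \<in> T"
    and P: "P \<in> projectives B" and z: "stable_zero A T1 h"
  shows "full_at A"
proof -
  obtain \<delta> \<delta>' where r: "realizes B R1 P T1 u p \<delta>" "realizes B A T1 T2 h t \<delta>'"
    using u h by (auto simp: E_triangle_def)
  note D = realizesD[OF r(1)] realizesD[OF r(2)]
  obtain E q d e \<epsilon> where E: "q \<in> Hom B E P" "d \<in> Hom B R1 E" "e \<in> Hom B E A"
    "Comp B R1 E P q d = u" "realizes B E P T2 q (Comp B P T1 T2 t p) \<epsilon>"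
    "realizes B R1 E A d e (pull B A T1 R1 h \<delta>)"
    using ET4_op[OF r] by blast
  have "E \<in> S" using syzygyI[OF _ P T(2)] E(5) unfolding E_triangle_def by blast
  moreover have "R1 \<in> S" using syzygyI[OF u P T(1)] .
  moreover have "extends_to_projectives B R1 E d"
    using extends_if_comp_extends[OF extends_if_cone_in_T[OF u T(1)] E(4)[symmetric]]
      realizesD[OF E(6)] D E by simp
  moreover have "stable_epi E A e" using stable_epi_if_pullback[OF E(6) r(1) _ z] D by simp
  ultimately show ?thesis using full_at_if_stable_epi[OF E(6)] by blast
qed

section \<open>Fullness and density imply condition (a)\<close>

lemma stable_epiD:
  "\<lbrakk>stable_epi Y X c; R \<in> S; \<phi> \<in> Hom B R X\<rbrakk> \<Longrightarrow> \<exists>\<rho>\<in>Hom B R Y. st R X \<phi> (Comp B R Y X c \<rho>)"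
  unfolding stable_epi_def by blast

text \<open>F c is epi and k vanishes on its kernel, so k induces a natural transformation F X -> F
  Y; fullness at X represents it by a morphism.\<close>

lemma descend_along_stable_epi:
  assumes R2: "R2 \<in> S" and ob: "X \<in> Ob B" "Y \<in> Ob B" and c: "c \<in> Hom B R2 X" and k: "k \<in> Hom B R2 Y"
    and epi: "stable_epi R2 X c"
    and ker: "\<And>R \<rho>. \<lbrakk>R \<in> S; \<rho> \<in> Hom B R R2; st R X (Comp B R R2 X c \<rho>) (hzero B R X)\<rbrakk>
      \<Longrightarrow> st R Y (Comp B R R2 Y k \<rho>) (hzero B R Y)"
    and full: "full_at X"
  shows "\<exists>x\<in>Hom B X Y. st R2 Y (Comp B R2 X Y x c) k"
proof -
  note R2o = syzygy_ob[OF R2]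
  define \<psi> where "\<psi> R \<phi> = (SOME \<rho>. \<rho> \<in> Hom B R R2 \<and> st R X \<phi> (Comp B R R2 X c \<rho>))" for R \<phi>
  define \<Phi> where "\<Phi> R \<phi> = Comp B R R2 Y k (\<psi> R \<phi>)" for R \<phi>
  have \<psi>: "\<psi> R \<phi> \<in> Hom B R R2" "st R X \<phi> (Comp B R R2 X c (\<psi> R \<phi>))" if "R \<in> S" "\<phi> \<in> Hom B R X" for R \<phi>
    using someI_ex[of "\<lambda>\<rho>. \<rho> \<in> Hom B R R2 \<and> st R X \<phi> (Comp B R R2 X c \<rho>)"] stable_epiD[OF epi that]
    unfolding \<psi>_def by blast+
  \<comment> \<open>Independence of the chosen preimage: two preimages under c differ by an element
    of the stable kernel, on which k vanishes. Additivity and naturality of \<open>\<Phi>\<close>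
    follow from this alone.\<close>
  have key: "st R Y (\<Phi> R \<phi>) (Comp B R R2 Y k \<rho>)"
    if R: "R \<in> S" and \<rho>: "\<rho> \<in> Hom B R R2" and e: "st R X \<phi> (Comp B R R2 X c \<rho>)" for R \<phi> \<rho>
  proof -
    note Ro = syzygy_ob[OF R]
    note p = \<psi>[OF R stD(3)[OF e]]
    let ?d = "hadd B R R2 (\<psi> R \<phi>) (hneg B R R2 \<rho>)"
    have d: "?d \<in> Hom B R R2" using Ro R2o p(1) \<rho> by (simp add: hom_closed)
    have "st R X (Comp B R R2 X c (\<psi> R \<phi>)) (Comp B R R2 X c \<rho>)"
      using st_trans[OF st_sym[OF p(2)] e] .
    from st_diff_zero[OF this] have "st R X (Comp B R R2 X c ?d) (hzero B R X)"
      using Ro R2o ob c p(1) \<rho> by (simp add: comp_add_right comp_neg_right hneg_closed)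
    from ker[OF R d this] have "st R Y (hadd B R Y (Comp B R R2 Y k (\<psi> R \<phi>)) (hneg B R Y (Comp B R R2 Y k \<rho>))) (hzero B R Y)"
      using Ro R2o ob k p(1) \<rho> by (simp add: comp_add_right comp_neg_right hneg_closed)
    then show ?thesis
      using st_if_diff_zero[of "Comp B R R2 Y k (\<psi> R \<phi>)" R Y "Comp B R R2 Y k \<rho>"] Ro R2o ob k p(1) \<rho>
      by (simp add: \<Phi>_def comp_closed)
  qed
  have \<Phi>: "\<Phi> R \<phi> \<in> Hom B R Y" if "R \<in> S" "\<phi> \<in> Hom B R X" for R \<phi>
    using \<psi>(1)[OF that] k ob R2o syzygy_ob[OF that(1)] by (simp add: \<Phi>_def comp_closed)
  have "stable_family X Y \<Phi>"
    unfolding stable_family_def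
  proof (intro conjI ballI allI impI)
    fix R \<phi> \<phi>' assume R: "R \<in> S" and e: "st R X \<phi> \<phi>'"
    note p = \<psi>[OF R stD(4)[OF e]]
    show "st R Y (\<Phi> R \<phi>) (\<Phi> R \<phi>')"
      using key[OF R p(1) st_trans[OF e p(2)]] by (simp add: \<Phi>_def)
  next
    fix R \<phi> \<phi>' assume R: "R \<in> S" and f: "\<phi> \<in> Hom B R X" "\<phi>' \<in> Hom B R X"
    note Ro = syzygy_ob[OF R]
    note p = \<psi>[OF R f(1)] and p' = \<psi>[OF R f(2)]
    have "st R X (hadd B R X \<phi> \<phi>') (Comp B R R2 X c (hadd B R R2 (\<psi> R \<phi>) (\<psi> R \<phi>')))"
      using st_add[OF p(2) p'(2)] Ro R2o ob c p(1) p'(1) by (simp add: comp_add_right)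
    from key[OF R _ this] show "st R Y (\<Phi> R (hadd B R X \<phi> \<phi>')) (hadd B R Y (\<Phi> R \<phi>) (\<Phi> R \<phi>'))"
      using Ro R2o ob k p(1) p'(1) by (simp add: comp_add_right \<Phi>_def hadd_closed)
  next
    fix R R' r \<phi> assume R: "R \<in> S" "R' \<in> S" and r: "r \<in> Hom B R' R" and f: "\<phi> \<in> Hom B R X"
    note Ro = syzygy_ob[OF R(1)] syzygy_ob[OF R(2)]
    note p = \<psi>[OF R(1) f]
    have "st R' X (Comp B R' R X \<phi> r) (Comp B R' R2 X c (Comp B R' R R2 (\<psi> R \<phi>) r))"
      using st_comp_right[OF p(2) r Ro(2)] Ro R2o ob c p(1) r by (simp add: comp_assoc)
    from key[OF R(2) _ this] show "st R' Y (\<Phi> R' (Comp B R' R X \<phi> r)) (Comp B R' R Y (\<Phi> R \<phi>) r)"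
      using Ro R2o ob k p(1) r by (simp add: comp_assoc \<Phi>_def comp_closed)
  qed (rule \<Phi>)
  then obtain x where x: "x \<in> Hom B X Y" "\<And>R \<phi>. \<lbrakk>R \<in> S; \<phi> \<in> Hom B R X\<rbrakk> \<Longrightarrow> st R Y (\<Phi> R \<phi>) (Comp B R X Y x \<phi>)"
    using full ob(2) unfolding full_at_def by blast
  have "st R2 X c (Comp B R2 R2 X c (Ident B R2))"
    using st_refl R2o ob c by (simp add: comp_ident_right)
  from key[OF R2 ident_closed[OF R2o] this] have "st R2 Y (\<Phi> R2 c) k"
    using R2o ob k by (simp add: comp_ident_right)
  then show ?thesis using x(1) x(2)[OF R2 c] st_sym st_trans by blast
qed

lemma stable_coker_comp_zero:
  assumes c: "stable_coker R1 R2 X f c" and R: "R1 \<in> S" "R2 \<in> S"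
  shows "st R1 X (Comp B R1 R2 X c f) (hzero B R1 X)"
proof -
  have f: "f \<in> Hom B R1 R2" using c by (simp add: stable_coker_def)
  note ob = syzygy_ob[OF R(1)] syzygy_ob[OF R(2)]
  have "st R1 R2 f (Comp B R1 R1 R2 f (Ident B R1))" using st_refl ob f by (simp add: comp_ident_right)
  then show ?thesis using c R(1) f ident_closed[OF ob(1)] unfolding stable_coker_def by blast
qed

lemma stable_epi_if_right_minimal:
  assumes full: "\<And>X. X \<in> Ob B \<Longrightarrow> full_at X"
    and dense: "\<exists>X c. stable_coker R1 R2 X f c"
    and r: "realizes B R1 R2 A f g \<delta>" and R: "R1 \<in> S" "R2 \<in> S"
    and e: "extends_to_projectives B R1 R2 f" and m: "stably_right_minimal B R1 R2 f"
  shows "stable_epi R2 A g"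
proof -
  note D = realizesD[OF r]
  obtain X c where co: "stable_coker R1 R2 X f c" using dense by blast
  then have c: "X \<in> Ob B" "c \<in> Hom B R2 X" "stable_epi R2 X c" by (simp_all add: stable_coker_def)
  have "st R A (Comp B R R2 A g \<rho>) (hzero B R A)"
    if R': "R \<in> S" and \<rho>: "\<rho> \<in> Hom B R R2" and z: "st R X (Comp B R R2 X c \<rho>) (hzero B R X)" for R \<rho>
  proof -
    note Ro = syzygy_ob[OF R']
    obtain \<sigma> where s: "\<sigma> \<in> Hom B R R1" "st R R2 \<rho> (Comp B R R1 R2 f \<sigma>)"
      using co R' \<rho> z unfolding stable_coker_def by blast
    have "st R A (Comp B R R2 A g \<rho>) (Comp B R R2 A g (Comp B R R1 R2 f \<sigma>))"
      using st_comp_left[OF s(2) D(5,3)] .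
    also have "\<dots> = hzero B R A"
      using comp_reassoc[OF comp_triangle[OF r] Ro D(1,2,3,4,5) s(1)] Ro D s(1) by (simp add: comp_zero_left)
    finally show ?thesis .
  qed
  \<comment> \<open>Two comparisons: x comes from the cokernel property of F X and fullness, c' from
    the weak stable cokernel property of A. Their composite x c' fixes g stably.\<close>
  then obtain x where x: "x \<in> Hom B X A" "st R2 A (Comp B R2 X A x c) g"
    using descend_along_stable_epi[OF R(2) c(1) D(3) c(2) D(5) c(3) _ full[OF c(1)]] by blast
  obtain c' where c': "c' \<in> Hom B A X" "st R2 X c (Comp B R2 A X c' g)"
    using stable_cokernel[OF r e c(1,2) stable_coker_comp_zero[OF co R]] by blast
  let ?c = "Comp B A X A x c'"
  have xc: "?c \<in> Hom B A A" using D c x c' by (simp add: comp_closed)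
  have "st R2 A (Comp B R2 A A ?c g) (Comp B R2 X A x c)"
    using st_comp_left[OF st_sym[OF c'(2)] x(1) D(3)] D c x(1) c'(1) by (simp add: comp_assoc)
  then have "st R2 A (Comp B R2 A A ?c g) g" using x(2) by (rule st_trans)
  then obtain d where d: "d \<in> Hom B A A" "st A A (Comp B A A A ?c d) (Ident B A)"
    using cone_endo_split_epi[OF r e m xc] by blast
  show ?thesis
    unfolding stable_epi_def
  proof (intro ballI)
    fix R \<phi> assume R': "R \<in> S" and \<phi>: "\<phi> \<in> Hom B R A"
    note Ro = syzygy_ob[OF R']
    \<comment> \<open>x c' d is stably the identity, so it suffices to lift c' d \<phi> along c,
      which is stably epi, and to apply x c ~ g.\<close>
    let ?\<phi> = "Comp B R A X c' (Comp B R A A d \<phi>)"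
    have ph: "?\<phi> \<in> Hom B R X" using D c c' d Ro \<phi> by (simp add: comp_closed)
    obtain \<rho> where \<rho>: "\<rho> \<in> Hom B R R2" "st R X ?\<phi> (Comp B R R2 X c \<rho>)"
      using stable_epiD[OF c(3) R' ph] by blast
    have "st R A (Comp B R A A (Ident B A) \<phi>) (Comp B R A A (Comp B A A A ?c d) \<phi>)"
      using st_comp_right[OF st_sym[OF d(2)] \<phi> Ro] .
    then have "st R A \<phi> (Comp B R X A x ?\<phi>)"
      using D c(1) x(1) c'(1) d(1) Ro \<phi> by (simp add: comp_ident_left comp_assoc_right comp_closed)
    also have "st R A \<dots> (Comp B R X A x (Comp B R R2 X c \<rho>))" using st_comp_left[OF \<rho>(2) x(1) D(3)] .
    also have "\<dots> = Comp B R R2 A (Comp B R2 X A x c) \<rho>" using D c x Ro \<rho> by (simp add: comp_assoc)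
    also have "st R A \<dots> (Comp B R R2 A g \<rho>)" using st_comp_right[OF x(2) \<rho>(1) Ro] .
    finally show "\<exists>\<rho>\<in>Hom B R R2. st R A \<phi> (Comp B R R2 A g \<rho>)" using \<rho>(1) by blast
  qed
qed

lemma syzygy_diagramD:
  assumes d: "syzygy_diagram B T R1 R2 A P T1 T2 f g u p q v h t"
  shows "E_triangle B R1 R2 A f g" "E_triangle B R1 P T1 u p" "E_triangle B R2 P T2 q v"
    "E_triangle B A T1 T2 h t" "T1 \<in> T" "T2 \<in> T" "P \<in> projectives B"
    "u = Comp B R1 R2 P q f" "Comp B R2 P T1 p q = Comp B R2 A T1 h g"
    "R1 \<in> S" "R2 \<in> S" "extends_to_projectives B R1 R2 f"
    "A \<in> Ob B" "P \<in> Ob B" "T1 \<in> Ob B" "T2 \<in> Ob B" "f \<in> Hom B R1 R2" "g \<in> Hom B R2 A" "p \<in> Hom B P T1"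
    "q \<in> Hom B R2 P" "h \<in> Hom B A T1"
proof -
  show *: "E_triangle B R1 R2 A f g" "E_triangle B R1 P T1 u p" "E_triangle B R2 P T2 q v"
    "E_triangle B A T1 T2 h t" "T1 \<in> T" "T2 \<in> T" "P \<in> projectives B"
    "u = Comp B R1 R2 P q f" "Comp B R2 P T1 p q = Comp B R2 A T1 h g"
    using d by (simp_all add: syzygy_diagram_def)
  show "R1 \<in> S" "R2 \<in> S" using syzygyI[OF *(2,7,5)] syzygyI[OF *(3,7,6)] by simp_all
  show **: "A \<in> Ob B" "P \<in> Ob B" "T1 \<in> Ob B" "T2 \<in> Ob B" "f \<in> Hom B R1 R2" "g \<in> Hom B R2 A" "p \<in> Hom B P T1"
    "q \<in> Hom B R2 P" "h \<in> Hom B A T1"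
    using E_triangleD[OF *(1)] E_triangleD[OF *(2)] E_triangleD[OF *(3)] E_triangleD[OF *(4)] by simp_all
  show "extends_to_projectives B R1 R2 f"
    using extends_if_comp_extends[OF extends_if_cone_in_T[OF *(2,5)] *(8)] ** E_triangleD[OF *(1)] by simp
qed

lemma condition_a_if_full_dense:
  assumes full: "\<And>X. X \<in> Ob B \<Longrightarrow> full_at X"
    and dense: "\<And>R1 R2 f. \<lbrakk>R1 \<in> S; R2 \<in> S; f \<in> Hom B R1 R2\<rbrakk> \<Longrightarrow> \<exists>X c. stable_coker R1 R2 X f c"
    and d: "syzygy_diagram B T R1 R2 A P T1 T2 f g u p q v h t"
    and m: "stably_right_minimal B R1 R2 f"
  shows "stable_zero A T1 h"
proof -
  note D = syzygy_diagramD[OF d]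
  obtain \<delta> where r: "realizes B R1 R2 A f g \<delta>" using D(1) by (auto simp: E_triangle_def)
  have "stable_epi R2 A g"
    using stable_epi_if_right_minimal[OF full dense[OF D(10,11,17)] r D(10,11,12) m] .
  then show ?thesis using stable_zero_if_epi D by blast
qed

section \<open>Condition (a) implies density\<close>

lemma stably_right_minimal_if_retract:
  assumes m: "stably_right_minimal B R1 R2 (Comp B R1 R2' R2 \<pi> f')"
    and ob: "R1 \<in> Ob B" "R2' \<in> Ob B" "R2 \<in> Ob B" and f': "f' \<in> Hom B R1 R2'" "\<pi> \<in> Hom B R2' R2"
  shows "stably_right_minimal B R1 R2' f'"
  unfolding stably_right_minimal_def
proof (intro ballI impI)
  fix r assume r: "r \<in> Hom B R1 R1" and e: "st R1 R2' (Comp B R1 R1 R2' f' r) f'"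
  have "st R1 R2 (Comp B R1 R1 R2 (Comp B R1 R2' R2 \<pi> f') r) (Comp B R1 R2' R2 \<pi> f')"
    using st_comp_left[OF e f'(2) ob(3)] ob f' r by (simp add: comp_assoc)
  then show "\<exists>r'\<in>Hom B R1 R1. st R1 R1 (Comp B R1 R1 R1 r r') (Ident B R1) \<and>
      st R1 R1 (Comp B R1 R1 R1 r' r) (Ident B R1)"
    using m r unfolding stably_right_minimal_def by blast
qed

lemma stable_cokerI:
  assumes "f \<in> Hom B R1 R2" "c \<in> Hom B R2 X" "X \<in> Ob B"
    and "\<And>R \<phi>. \<lbrakk>R \<in> S; \<phi> \<in> Hom B R X\<rbrakk> \<Longrightarrow> \<exists>\<rho>\<in>Hom B R R2. st R X \<phi> (Comp B R R2 X c \<rho>)"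
    and "\<And>R \<rho>. \<lbrakk>R \<in> S; \<rho> \<in> Hom B R R2; st R X (Comp B R R2 X c \<rho>) (hzero B R X)\<rbrakk>
      \<Longrightarrow> \<exists>\<sigma>\<in>Hom B R R1. st R R2 \<rho> (Comp B R R1 R2 f \<sigma>)"
    and "\<And>R \<rho> \<sigma>. \<lbrakk>R \<in> S; \<rho> \<in> Hom B R R2; \<sigma> \<in> Hom B R R1; st R R2 \<rho> (Comp B R R1 R2 f \<sigma>)\<rbrakk>
      \<Longrightarrow> st R X (Comp B R R2 X c \<rho>) (hzero B R X)"
  shows "stable_coker R1 R2 X f c"
  using assms unfolding stable_coker_def stable_epi_def by blast

text \<open>Stable exactness of the triangle at R2', transported to R2 along the stably inverse maps
  i and \<pi>.\<close>

lemma stable_kernel_of_retract: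
  assumes r: "realizes B R1 R2' A f2 g \<delta>" and R2: "R2 \<in> Ob B"
    and i: "i \<in> Hom B R2 R2'" "\<pi> \<in> Hom B R2' R2" "Comp B R2 R2' R2 \<pi> i = Ident B R2"
      "st R2' R2' (Comp B R2' R2 R2' i \<pi>) (Ident B R2')" "Comp B R1 R2' R2 \<pi> f2 = f"
    and R: "R \<in> Ob B" "\<rho> \<in> Hom B R R2"
  shows "st R A (Comp B R R2 A (Comp B R2 R2' A g i) \<rho>) (hzero B R A) \<longleftrightarrow>
    (\<exists>\<sigma>\<in>Hom B R R1. st R R2 \<rho> (Comp B R R1 R2 f \<sigma>))"
proof
  note D = realizesD[OF r]
  assume z: "st R A (Comp B R R2 A (Comp B R2 R2' A g i) \<rho>) (hzero B R A)"
  have ir: "Comp B R R2 R2' i \<rho> \<in> Hom B R R2'" using D R2 i R by (simp add: comp_closed)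
  have "st R A (Comp B R R2' A g (Comp B R R2 R2' i \<rho>)) (hzero B R A)"
    using z D R2 i(1) R by (simp add: comp_assoc)
  then obtain \<sigma> where s: "\<sigma> \<in> Hom B R R1" "st R R2' (Comp B R R2 R2' i \<rho>) (Comp B R R1 R2' f2 \<sigma>)"
    using stable_kernel[OF r R(1) ir] by blast
  have "st R R2 (Comp B R R2' R2 \<pi> (Comp B R R2 R2' i \<rho>)) (Comp B R R2' R2 \<pi> (Comp B R R1 R2' f2 \<sigma>))"
    using st_comp_left[OF s(2) i(2) R2] .
  moreover have "Comp B R R2' R2 \<pi> (Comp B R R2 R2' i \<rho>) = \<rho>"
    using D R2 i(1-3) R by (simp add: comp_reassoc[OF i(3)] comp_ident_left)
  moreover have "Comp B R R2' R2 \<pi> (Comp B R R1 R2' f2 \<sigma>) = Comp B R R1 R2 f \<sigma>"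
    using D R2 i(2) R s(1) by (simp add: comp_reassoc[OF i(5)])
  ultimately show "\<exists>\<sigma>\<in>Hom B R R1. st R R2 \<rho> (Comp B R R1 R2 f \<sigma>)" using s(1) by auto
next
  note D = realizesD[OF r]
  assume "\<exists>\<sigma>\<in>Hom B R R1. st R R2 \<rho> (Comp B R R1 R2 f \<sigma>)"
  then obtain \<sigma> where s: "\<sigma> \<in> Hom B R R1" "st R R2 \<rho> (Comp B R R1 R2 f \<sigma>)" by blast
  have gi: "Comp B R2 R2' A g i \<in> Hom B R2 A" using D R2 i by (simp add: comp_closed)
  have fs: "Comp B R R1 R2' f2 \<sigma> \<in> Hom B R R2'" using D R s by (simp add: comp_closed)
  have "st R A (Comp B R R2 A (Comp B R2 R2' A g i) \<rho>) (Comp B R R2 A (Comp B R2 R2' A g i) (Comp B R R1 R2 f \<sigma>))"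
    using st_comp_left[OF s(2) gi D(3)] .
  also have "\<dots> = Comp B R R2' A g (Comp B R R2' R2' (Comp B R2' R2 R2' i \<pi>) (Comp B R R1 R2' f2 \<sigma>))"
    using D R2 i(1,2) R s(1) by (simp add: i(5)[symmetric] comp_assoc_right comp_closed)
  also have "st R A \<dots> (Comp B R R2' A g (Comp B R R2' R2' (Ident B R2') (Comp B R R1 R2' f2 \<sigma>)))"
    using st_comp_left[OF st_comp_right[OF i(4) fs R(1)] D(5,3)] .
  also have "\<dots> = hzero B R A"
    using D R s(1) fs by (simp add: comp_ident_left comp_reassoc[OF comp_triangle[OF r]] comp_zero_left)
  finally show "st R A (Comp B R R2 A (Comp B R2 R2' A g i) \<rho>) (hzero B R A)" .
qed

lemma dense_if_condition_a:
  assumes a: "\<And>R1 R2 A P T1 T2 f g u p q v h t.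
      \<lbrakk>syzygy_diagram B T R1 R2 A P T1 T2 f g u p q v h t; \<not> st R1 R2 f (hzero B R1 R2);
       stably_right_minimal B R1 R2 f\<rbrakk> \<Longrightarrow> stable_zero A T1 h"
    and R1: "R1 \<in> S" and R2: "R2 \<in> S" and f: "f \<in> Hom B R1 R2"
  shows "\<exists>X c. stable_coker R1 R2 X f c"
proof -
  obtain R1' j where R1': "R1' \<in> S" "j \<in> Hom B R1' R1"
    and m: "stably_right_minimal B R1' R2 (Comp B R1' R1 R2 f j)"
    and im: "\<And>R \<sigma>. \<lbrakk>R \<in> Ob B; \<sigma> \<in> Hom B R R1\<rbrakk> \<Longrightarrow> \<exists>\<sigma>'\<in>Hom B R R1'.
       st R R2 (Comp B R R1 R2 f \<sigma>) (Comp B R R1' R2 (Comp B R1' R1 R2 f j) \<sigma>')"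
    using ex_right_minimal[OF R1 R2 f] by blast
  note ob = syzygy_ob[OF R1] syzygy_ob[OF R2] syzygy_ob[OF R1'(1)]
  define f' where "f' = Comp B R1' R1 R2 f j"
  have f': "f' \<in> Hom B R1' R2" using ob f R1' by (simp add: f'_def comp_closed)
  note m = m[folded f'_def] and im = im[folded f'_def]
  show ?thesis
  proof (cases "st R1' R2 f' (hzero B R1' R2)")
    \<comment> \<open>Condition (a) speaks only of stably nonzero maps. Here f has stably zero image
      on syzygies, and R2 itself is the cokernel.\<close>
    case True
    have fz: "st R R2 (Comp B R R1 R2 f \<sigma>) (hzero B R R2)" if R: "R \<in> S" and \<sigma>: "\<sigma> \<in> Hom B R R1" for R \<sigma>
    proof -
      note Ro = syzygy_ob[OF R]
      obtain \<sigma>' where s: "\<sigma>' \<in> Hom B R R1'" "st R R2 (Comp B R R1 R2 f \<sigma>) (Comp B R R1' R2 f' \<sigma>')"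
        using im[OF Ro \<sigma>] by blast
      note s(2)
      also have "st R R2 (Comp B R R1' R2 f' \<sigma>') (Comp B R R1' R2 (hzero B R1' R2) \<sigma>')"
        using st_comp_right[OF True s(1) Ro] .
      finally show ?thesis using Ro ob s(1) by (simp add: comp_zero_left)
    qed
    have "stable_coker R1 R2 R2 f (Ident B R2)"
    proof (rule stable_cokerI[OF f ident_closed[OF ob(2)] ob(2)])
      fix R \<rho> assume R: "R \<in> S" and \<rho>: "\<rho> \<in> Hom B R R2"
      note Ro = syzygy_ob[OF R]
      show "\<exists>\<rho>'\<in>Hom B R R2. st R R2 \<rho> (Comp B R R2 R2 (Ident B R2) \<rho>')"
        using \<rho> Ro ob by (intro bexI[of _ \<rho>]) (simp_all add: comp_ident_left st_refl)
      show "\<exists>\<sigma>\<in>Hom B R R1. st R R2 \<rho> (Comp B R R1 R2 f \<sigma>)"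
        if "st R R2 (Comp B R R2 R2 (Ident B R2) \<rho>) (hzero B R R2)"
        using that \<rho> Ro ob f
        by (intro bexI[of _ "hzero B R R1"]) (simp_all add: comp_ident_left comp_zero_right hzero_closed)
      show "st R R2 (Comp B R R2 R2 (Ident B R2) \<rho>) (hzero B R R2)"
        if "\<sigma> \<in> Hom B R R1" "st R R2 \<rho> (Comp B R R1 R2 f \<sigma>)" for \<sigma>
        using st_trans[OF that(2) fz[OF R that(1)]] \<rho> Ro ob by (simp add: comp_ident_left)
    qed
    then show ?thesis by blast
  next
    case False
    obtain R2' A P T1 T2 f2 g u p q v h t i \<pi> \<delta>
      where dg: "syzygy_diagram B T R1' R2' A P T1 T2 f2 g u p q v h t"
        and i: "i \<in> Hom B R2 R2'" "\<pi> \<in> Hom B R2' R2" "Comp B R2 R2' R2 \<pi> i = Ident B R2"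
          "st R2' R2' (Comp B R2' R2 R2' i \<pi>) (Ident B R2')" "Comp B R1' R2' R2 \<pi> f2 = f'"
        and r: "realizes B R1' R2' A f2 g (pull B A T1 R1' h \<delta>)" "realizes B R1' P T1 u p \<delta>"
      using ex_diagram[OF R1'(1) R2 f'] by blast
    note D = syzygy_diagramD[OF dg]
    note ob' = syzygy_ob[OF D(11)]
    have m2: "stably_right_minimal B R1' R2' f2"
      using stably_right_minimal_if_retract[of R1' R2 R2' \<pi> f2] m i(2,5) ob ob' D(17) by simp
    have "\<not> st R1' R2' f2 (hzero B R1' R2')"
    proof
      assume "st R1' R2' f2 (hzero B R1' R2')"
      from st_comp_left[OF this i(2) ob(2)] show False using False i(2,5) ob ob' by (simp add: comp_zero_right)
    qed
    then have z: "stable_zero A T1 h" using a[OF dg _ m2] by blast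
    have epi: "stable_epi R2' A g" using stable_epi_if_pullback[OF r D(21) z] .
    let ?c = "Comp B R2 R2' A g i"
    have c: "?c \<in> Hom B R2 A" using D ob ob' i by (simp add: comp_closed)
    have "stable_coker R1 R2 A f ?c"
    proof (rule stable_cokerI[OF f c D(13)])
      fix R \<phi> assume R: "R \<in> S" and \<phi>: "\<phi> \<in> Hom B R A"
      note Ro = syzygy_ob[OF R]
      obtain \<rho> where \<rho>: "\<rho> \<in> Hom B R R2'" "st R A \<phi> (Comp B R R2' A g \<rho>)"
        using stable_epiD[OF epi R \<phi>] by blast
      have gr: "Comp B R R2' A g \<rho> \<in> Hom B R A" using D ob' Ro \<rho> by (simp add: comp_closed)
      note \<rho>(2)
      also have "st R A (Comp B R R2' A g (Comp B R R2' R2' (Ident B R2') \<rho>))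
          (Comp B R R2' A g (Comp B R R2' R2' (Comp B R2' R2 R2' i \<pi>) \<rho>))"
        using st_comp_left[OF st_comp_right[OF st_sym[OF i(4)] \<rho>(1) Ro] D(18,13)] .
      then have "st R A (Comp B R R2' A g \<rho>) (Comp B R R2 A ?c (Comp B R R2' R2 \<pi> \<rho>))"
        using D ob ob' i(1,2) Ro \<rho>(1) by (simp add: comp_ident_left comp_assoc_right comp_closed)
      finally show "\<exists>\<rho>\<in>Hom B R R2. st R A \<phi> (Comp B R R2 A ?c \<rho>)"
        using ob ob' i(2) Ro \<rho>(1) by (intro bexI[of _ "Comp B R R2' R2 \<pi> \<rho>"]) (simp_all add: comp_closed)
    next
      fix R \<rho> assume R: "R \<in> S" and \<rho>: "\<rho> \<in> Hom B R R2" and z: "st R A (Comp B R R2 A ?c \<rho>) (hzero B R A)"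
      note Ro = syzygy_ob[OF R]
      obtain \<sigma> where s: "\<sigma> \<in> Hom B R R1'" "st R R2 \<rho> (Comp B R R1' R2 f' \<sigma>)"
        using z stable_kernel_of_retract[OF r(1) ob(2) i Ro \<rho>] by blast
      have "Comp B R R1' R2 f' \<sigma> = Comp B R R1 R2 f (Comp B R R1' R1 j \<sigma>)"
        using ob Ro s(1) f R1' by (simp add: f'_def comp_assoc_right)
      then show "\<exists>\<sigma>\<in>Hom B R R1. st R R2 \<rho> (Comp B R R1 R2 f \<sigma>)"
        using Ro s R1'(2) ob by (intro bexI[of _ "Comp B R R1' R1 j \<sigma>"]) (simp_all add: comp_closed)
    next
      fix R \<rho> \<sigma> assume R: "R \<in> S" and \<rho>: "\<rho> \<in> Hom B R R2" and s: "\<sigma> \<in> Hom B R R1"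
        and e: "st R R2 \<rho> (Comp B R R1 R2 f \<sigma>)"
      note Ro = syzygy_ob[OF R]
      obtain \<sigma>' where "\<sigma>' \<in> Hom B R R1'" "st R R2 (Comp B R R1 R2 f \<sigma>) (Comp B R R1' R2 f' \<sigma>')"
        using im[OF Ro s] by blast
      then show "st R A (Comp B R R2 A ?c \<rho>) (hzero B R A)"
        using st_trans[OF e] stable_kernel_of_retract[OF r(1) ob(2) i Ro \<rho>] by blast
    qed
    then show ?thesis by blast
  qed
qed

text \<open>A right approximation of \<open>X\<close> by a syzygy: approximate the cone \<open>C\<close> of an inflation
  \<open>X \<rightarrow> I\<close> into an injective by \<open>T\<close>, pull the extension back to the approximation \<open>T0\<close>, and write
  the result as a pushout of an extension \<open>R0 \<rightarrow> P0 \<rightarrow> T0\<close> with \<open>P0\<close> projective.\<close>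

lemma ex_syzygy_approximation:
  assumes X: "X \<in> Ob B"
  shows "\<exists>R0\<in>S. \<exists>a\<in>Hom B R0 X. stable_epi R0 X a"
proof -
  obtain C I x y where I: "I \<in> injectives B" and tI: "E_triangle B X I C x y"
    using enough_injectives X unfolding enough_injectives_def by blast
  obtain \<delta>I where rI: "realizes B X I C x y \<delta>I" using tI by (auto simp: E_triangle_def)
  note DI = realizesD[OF rI]
  obtain T0 \<tau> where T0: "T0 \<in> T" "\<tau> \<in> Hom B T0 C"
    and app: "\<And>T' g'. \<lbrakk>T' \<in> T; g' \<in> Hom B T' C\<rbrakk> \<Longrightarrow> \<exists>u\<in>Hom B T' T0. Comp B T' T0 C \<tau> u = g'"
    using contravariantly_finite DI(3) unfolding contravariantly_finite_def by blast
  note T0o = T_ob[OF T0(1)]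
  let ?\<epsilon> = "pull B T0 C X \<tau> \<delta>I"
  have \<epsilon>: "?\<epsilon> \<in> carrier (Ext B T0 X)" using pull_closed DI T0 T0o by simp
  obtain Y k l where rY: "realizes B X Y T0 k l ?\<epsilon>" using ex_realization[OF T0o X \<epsilon>] by blast
  note DY = realizesD[OF rY]
  obtain R0 P0 u0 p0 where P0: "P0 \<in> projectives B" and t0: "E_triangle B R0 P0 T0 u0 p0"
    using enough_projectives T0o unfolding enough_projectives_def by blast
  obtain \<delta>0 where r0: "realizes B R0 P0 T0 u0 p0 \<delta>0" using t0 by (auto simp: E_triangle_def)
  note D0 = realizesD[OF r0]
  have R0: "R0 \<in> S" using syzygyI[OF t0 P0 T0(1)] .
  obtain b where b: "b \<in> Hom B P0 Y" "p0 = Comp B P0 Y T0 l b"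
    using projective_lift[OF P0 _ D0(5)] rY unfolding E_triangle_def by blast
  \<comment> \<open>Read as a square over the identity of T0, this exhibits the pulled back class as
    the pushforward of \<delta>0 along a map a : R0 -> X, the desired approximation.\<close>
  have "Comp B P0 T0 T0 (Ident B T0) p0 = Comp B P0 Y T0 l b" using b D0 by (simp add: comp_ident_left)
  then obtain a where a: "a \<in> Hom B R0 X" "push B T0 R0 X a \<delta>0 = pull B T0 T0 X (Ident B T0) ?\<epsilon>"
    using ET3_op[OF r0 rY b(1) ident_closed[OF T0o]] by blast
  have a\<epsilon>: "push B T0 R0 X a \<delta>0 = ?\<epsilon>" using a(2) pull_ident[OF T0o X \<epsilon>] by simp
  have "stable_epi R0 X a"
    unfolding stable_epi_def
  proof (intro ballI)
    fix R \<phi> assume R: "R \<in> S" and \<phi>: "\<phi> \<in> Hom B R X"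
    obtain P D u p \<delta> where r: "realizes B R P D u p \<delta>" and P: "P \<in> projectives B" and DT: "D \<in> T"
      using R by (rule syzygyE)
    note E = realizesD[OF r]
    \<comment> \<open>Injectivity of I extends x \<phi> to P, so \<phi> pushes \<delta> to the
      pullback of \<delta>I along some t : D -> C. As D lies in \<open>T\<close>, t factors through
      the approximation T0.\<close>
    have "inflation B R P u" using r by (auto simp: inflation_def E_triangle_def)
    moreover have "Comp B R X I x \<phi> \<in> Hom B R I" using DI E \<phi> by (simp add: comp_closed)
    ultimately obtain f where f: "f \<in> Hom B P I" "Comp B R P I f u = Comp B R X I x \<phi>"
      using I unfolding injectives_def by blast
    obtain t where t: "t \<in> Hom B D C" "push B D R X \<phi> \<delta> = pull B D C X t \<delta>I"
      using ET3[OF r rI \<phi> f] by blast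
    obtain t' where t': "t' \<in> Hom B D T0" "Comp B D T0 C \<tau> t' = t" using app[OF DT t(1)] by blast
    have "Comp B P D T0 t' p \<in> Hom B P T0" using E T0o t' by (simp add: comp_closed)
    then obtain b' where b': "b' \<in> Hom B P P0" "Comp B P D T0 t' p = Comp B P P0 T0 p0 b'"
      using projective_lift[OF P t0] by blast
    obtain s where s: "s \<in> Hom B R R0" "push B D R R0 s \<delta> = pull B D T0 R0 t' \<delta>0"
      using ET3_op[OF r r0 b'(1) t'(1) b'(2)] by blast
    \<comment> \<open>\<phi> and a s push \<delta> to the same class, so their difference extends
      along u to P and is stably zero.\<close>
    have "push B D R X \<phi> \<delta> = pull B D T0 X t' (push B T0 R0 X a \<delta>0)"
      unfolding t(2) a\<epsilon> t'(2)[symmetric] using DI E T0 T0o t'(1) X by (intro pull_comp) simp_all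
    also have "\<dots> = push B D R0 X a (push B D R R0 s \<delta>)"
      unfolding s(2) using E D0 T0o t'(1) a(1) X by (intro push_pull[symmetric]) simp_all
    also have "\<dots> = push B D R X (Comp B R R0 X a s) \<delta>"
      using E D0 a(1) s(1) X by (intro push_comp[symmetric]) simp_all
    finally obtain c where c: "c \<in> Hom B P X" "\<phi> = hadd B R X (Comp B R R0 X a s) (Comp B R P X c u)"
      using inflation_factor_diff[OF r X \<phi>, of "Comp B R R0 X a s"] E D0 a(1) s(1) X by (auto simp: comp_closed)
    have "st R X \<phi> (Comp B R R0 X a s)"
      unfolding c(2) using E D0 X a(1) s(1) c(1) P by (intro stI FacI comp_closed) simp_all
    then show "\<exists>s\<in>Hom B R R0. st R X \<phi> (Comp B R R0 X a s)" using s(1) by blast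
  qed
  then show ?thesis using R0 a(1) by blast
qed

text \<open>Pulling D -> P -> X back along the approximation a gives K -> R0 through which every
  element stably killed by a lifts. K need not be a syzygy, so it is approximated by one in
  turn.\<close>

lemma ex_stable_presentation:
  assumes X: "X \<in> Ob B"
  shows "\<exists>R1\<in>S. \<exists>R0\<in>S. \<exists>f a. stable_coker R1 R0 X f a"
proof -
  obtain R0 a where R0: "R0 \<in> S" "a \<in> Hom B R0 X" "stable_epi R0 X a"
    using ex_syzygy_approximation[OF X] by blast
  note R0o = syzygy_ob[OF R0(1)]
  obtain D P d e where P: "P \<in> projectives B" and t: "E_triangle B D P X d e"
    using enough_projectives X unfolding enough_projectives_def by blast
  obtain \<delta> where r: "realizes B D P X d e \<delta>" using t by (auto simp: E_triangle_def)
  note E = realizesD[OF r]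
  let ?\<epsilon> = "pull B R0 X D a \<delta>"
  have \<epsilon>: "?\<epsilon> \<in> carrier (Ext B R0 D)" using pull_closed E R0 R0o by simp
  obtain K k l where rK: "realizes B D K R0 k l ?\<epsilon>" using ex_realization[OF R0o E(1) \<epsilon>] by blast
  note DK = realizesD[OF rK]
  obtain R1 a1 where R1: "R1 \<in> S" "a1 \<in> Hom B R1 K" "stable_epi R1 K a1"
    using ex_syzygy_approximation[OF DK(2)] by blast
  note R1o = syzygy_ob[OF R1(1)]
  obtain b where b: "b \<in> Hom B K P" "Comp B K P X e b = Comp B K R0 X a l"
    using realz_morphism[OF rK r ident_closed[OF E(1)] R0(2)] push_ident[OF R0o E(1) \<epsilon>] by auto
  \<comment> \<open>a l = e b passes through the projective P.\<close>
  have al: "st K X (Comp B K R0 X a l) (hzero B K X)"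
    unfolding b(2)[symmetric] using FacI[OF P b(1) E(5) DK(2) X] DK X by (simp add: st_zero_iff)
  let ?f = "Comp B R1 K R0 l a1"
  have f: "?f \<in> Hom B R1 R0" using DK R1 R1o by (simp add: comp_closed)
  have "stable_coker R1 R0 X ?f a"
  proof (rule stable_cokerI[OF f R0(2) X])
    show "\<exists>\<rho>\<in>Hom B R R0. st R X \<phi> (Comp B R R0 X a \<rho>)" if "R \<in> S" "\<phi> \<in> Hom B R X" for R \<phi>
      using stable_epiD[OF R0(3) that] .
  next
    fix R \<rho> assume R: "R \<in> S" and \<rho>: "\<rho> \<in> Hom B R R0" and z: "st R X (Comp B R R0 X a \<rho>) (hzero B R X)"
    note Ro = syzygy_ob[OF R]
    obtain \<kappa> where \<kappa>: "\<kappa> \<in> Hom B R K" "\<rho> = Comp B R K R0 l \<kappa>"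
      using lift_if_pullback_projective[OF rK r R0(2) Ro \<rho> z] by blast
    obtain \<sigma> where s: "\<sigma> \<in> Hom B R R1" "st R K \<kappa> (Comp B R R1 K a1 \<sigma>)"
      using stable_epiD[OF R1(3) R \<kappa>(1)] by blast
    have "st R R0 \<rho> (Comp B R R1 R0 ?f \<sigma>)"
      using st_comp_left[OF s(2) DK(5) R0o] \<kappa> DK R1(2) R1o Ro s(1) by (simp add: comp_assoc)
    then show "\<exists>\<sigma>\<in>Hom B R R1. st R R0 \<rho> (Comp B R R1 R0 ?f \<sigma>)" using s(1) by blast
  next
    fix R \<rho> \<sigma> assume R: "R \<in> S" and \<rho>: "\<rho> \<in> Hom B R R0" and s: "\<sigma> \<in> Hom B R R1"
      and eq: "st R R0 \<rho> (Comp B R R1 R0 ?f \<sigma>)"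
    note Ro = syzygy_ob[OF R]
    have as: "Comp B R R1 K a1 \<sigma> \<in> Hom B R K" using DK R1(2) R1o Ro s by (simp add: comp_closed)
    have "st R X (Comp B R R0 X a \<rho>) (Comp B R R0 X a (Comp B R R1 R0 ?f \<sigma>))"
      using st_comp_left[OF eq R0(2) X] .
    also have "\<dots> = Comp B R K X (Comp B K R0 X a l) (Comp B R R1 K a1 \<sigma>)"
      using DK R1(2) R1o R0(2) R0o Ro s X by (simp add: comp_assoc_right comp_closed)
    also have "st R X \<dots> (Comp B R K X (hzero B K X) (Comp B R R1 K a1 \<sigma>))"
      using st_comp_right[OF al as Ro] .
    also have "\<dots> = hzero B R X" using as DK X Ro by (simp add: comp_zero_left)
    finally show "st R X (Comp B R R0 X a \<rho>) (hzero B R X)" .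
  qed
  then show ?thesis using R1(1) R0(1) by blast
qed

text \<open>The cone A' of a right minimal presentation of F A need not be A. Comparison maps and
  locality of the endomorphism ring make A a summand of A', right minimality makes the complement
  projective, and the diagram is then restricted to A.\<close>

lemma condition_b_if_full:
  assumes full: "\<And>X. X \<in> Ob B \<Longrightarrow> full_at X" and ind: "indecomposable B A"
    and nz: "\<not> (\<forall>R\<in>S. \<forall>\<phi>\<in>Hom B R A. st R A \<phi> (hzero B R A))"
  shows "\<exists>R1 R2 P T1 T2 f g u p q v h t.
    syzygy_diagram B T R1 R2 A P T1 T2 f g u p q v h t \<and> stable_zero A T1 h"
proof -
  have Ao: "A \<in> Ob B" using ind by (simp add: indecomposable_def)
  have loc: "local_object B A" using indecomposable_local[OF ind] ex_local_length[OF Ao] by blast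
  obtain R1 R2 f a where R: "R1 \<in> S" "R2 \<in> S" and co: "stable_coker R1 R2 A f a"
    using ex_stable_presentation[OF Ao] by blast
  have f: "f \<in> Hom B R1 R2" and a: "a \<in> Hom B R2 A" and aepi: "stable_epi R2 A a"
    using co by (simp_all add: stable_coker_def)
  obtain R1' j where R1': "R1' \<in> S" "j \<in> Hom B R1' R1"
    and m: "stably_right_minimal B R1' R2 (Comp B R1' R1 R2 f j)"
    and im: "\<And>R \<sigma>. \<lbrakk>R \<in> Ob B; \<sigma> \<in> Hom B R R1\<rbrakk> \<Longrightarrow> \<exists>\<sigma>'\<in>Hom B R R1'.
       st R R2 (Comp B R R1 R2 f \<sigma>) (Comp B R R1' R2 (Comp B R1' R1 R2 f j) \<sigma>')"
    using ex_right_minimal[OF R f] by blast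
  note ob = syzygy_ob[OF R(1)] syzygy_ob[OF R(2)] syzygy_ob[OF R1'(1)] Ao
  define f' where "f' = Comp B R1' R1 R2 f j"
  have f': "f' \<in> Hom B R1' R2" using ob f R1' by (simp add: f'_def comp_closed)
  note m = m[folded f'_def] and im = im[folded f'_def]
  obtain R2' A' P T1 T2 f2 g' u p q v h t i \<pi> \<delta>
    where dg: "syzygy_diagram B T R1' R2' A' P T1 T2 f2 g' u p q v h t"
      and i: "i \<in> Hom B R2 R2'" "\<pi> \<in> Hom B R2' R2" "Comp B R2 R2' R2 \<pi> i = Ident B R2"
        "st R2' R2' (Comp B R2' R2 R2' i \<pi>) (Ident B R2')" "Comp B R1' R2' R2 \<pi> f2 = f'"
      and r: "realizes B R1' R2' A' f2 g' (pull B A' T1 R1' h \<delta>)" "realizes B R1' P T1 u p \<delta>"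
    using ex_diagram[OF R1'(1) R(2) f'] by blast
  note D = syzygy_diagramD[OF dg]
  note ob' = syzygy_ob[OF D(11)]
  have m2: "stably_right_minimal B R1' R2' f2"
    using stably_right_minimal_if_retract[of R1' R2 R2' \<pi> f2] m i(2,5) ob ob' D(17) by simp
  have gi: "Comp B R2 R2' A' g' i \<in> Hom B R2 A'" using D ob ob' i by (simp add: comp_closed)
  have api: "Comp B R2' R2 A a \<pi> \<in> Hom B R2' A" using ob ob' i a by (simp add: comp_closed)
  have gip: "st R2' A' (Comp B R2' R2 A' (Comp B R2 R2' A' g' i) \<pi>) g'"
    using st_comp_left[OF i(4) D(18,13)] D ob ob' i(1,2) by (simp add: comp_assoc_right comp_ident_right)
  have ker: "st R A' (Comp B R R2 A' (Comp B R2 R2' A' g' i) \<rho>) (hzero B R A')"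
    if R': "R \<in> S" and \<rho>: "\<rho> \<in> Hom B R R2" and z: "st R A (Comp B R R2 A a \<rho>) (hzero B R A)" for R \<rho>
  proof -
    note Ro = syzygy_ob[OF R']
    obtain \<sigma> where s: "\<sigma> \<in> Hom B R R1" "st R R2 \<rho> (Comp B R R1 R2 f \<sigma>)"
      using co R' \<rho> z unfolding stable_coker_def by blast
    obtain \<sigma>' where s': "\<sigma>' \<in> Hom B R R1'" "st R R2 (Comp B R R1 R2 f \<sigma>) (Comp B R R1' R2 f' \<sigma>')"
      using im[OF Ro s(1)] by blast
    show ?thesis
      using stable_kernel_of_retract[OF r(1) ob(2) i Ro \<rho>] s'(1) st_trans[OF s(2) s'(2)] by blast
  qed
  \<comment> \<open>The stable kernel of a is the image of f, hence of f', and g' i kills it;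
    fullness at A factors g' i through a.\<close>
  obtain \<alpha> where \<alpha>: "\<alpha> \<in> Hom B A A'" "st R2 A' (Comp B R2 A A' \<alpha> a) (Comp B R2 R2' A' g' i)"
    using descend_along_stable_epi[OF R(2) Ao D(13) a gi aepi ker full[OF Ao]] by blast
  \<comment> \<open>Conversely a \<pi> f2 = a f j is stably zero, so a \<pi> factors stably through
    g'.\<close>
  have "st R1' A (Comp B R1' R2' A (Comp B R2' R2 A a \<pi>) f2) (hzero B R1' A)"
  proof -
    have "Comp B R1' R2' A (Comp B R2' R2 A a \<pi>) f2 = Comp B R1' R1 A (Comp B R1 R2 A a f) j"
      using ob ob' i(1,2) a D(17) f R1'(2) by (simp add: comp_assoc_right i(5) f'_def)
    also have "st R1' A \<dots> (Comp B R1' R1 A (hzero B R1 A) j)"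
      using st_comp_right[OF stable_coker_comp_zero[OF co R] R1'(2) ob(3)] .
    also have "\<dots> = hzero B R1' A" using ob R1'(2) by (simp add: comp_zero_left)
    finally show ?thesis .
  qed
  then obtain \<beta> where \<beta>: "\<beta> \<in> Hom B A' A" "st R2' A (Comp B R2' R2 A a \<pi>) (Comp B R2' A' A \<beta> g')"
    using stable_cokernel[OF r(1) D(12) Ao api] by blast
  let ?\<theta> = "Comp B A A' A \<beta> \<alpha>"
  have \<theta>: "?\<theta> \<in> Hom B A A" using Ao D \<alpha> \<beta> by (simp add: comp_closed)
  have \<beta>gi: "st R2 A (Comp B R2 A' A \<beta> (Comp B R2 R2' A' g' i)) a"
  proof -
    have "st R2 A (Comp B R2 R2' A (Comp B R2' A' A \<beta> g') i) (Comp B R2 R2' A (Comp B R2' R2 A a \<pi>) i)"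
      using st_comp_right[OF st_sym[OF \<beta>(2)] i(1) ob(2)] .
    then show ?thesis using D ob ob' i(1-3) a \<beta>(1) by (simp add: comp_assoc_right comp_ident_right)
  qed
  have \<theta>id: "st R A (Comp B R A A ?\<theta> \<phi>) \<phi>" if R': "R \<in> S" and \<phi>: "\<phi> \<in> Hom B R A" for R \<phi>
  proof -
    note Ro = syzygy_ob[OF R']
    obtain \<rho> where \<rho>: "\<rho> \<in> Hom B R R2" "st R A \<phi> (Comp B R R2 A a \<rho>)"
      using stable_epiD[OF aepi R' \<phi>] by blast
    have "st R2 A (Comp B R2 A' A \<beta> (Comp B R2 A A' \<alpha> a)) a"
      using st_trans[OF st_comp_left[OF \<alpha>(2) \<beta>(1) Ao] \<beta>gi] .
    then have *: "st R2 A (Comp B R2 A A ?\<theta> a) a" using Ao D(13) ob \<alpha>(1) \<beta>(1) a by (simp add: comp_assoc_right)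
    have "st R A (Comp B R A A ?\<theta> \<phi>) (Comp B R A A ?\<theta> (Comp B R R2 A a \<rho>))"
      using st_comp_left[OF \<rho>(2) \<theta> Ao] .
    also have "\<dots> = Comp B R R2 A (Comp B R2 A A ?\<theta> a) \<rho>" using ob Ro \<theta> a \<rho> by (simp add: comp_assoc)
    also have "st R A \<dots> (Comp B R R2 A a \<rho>)" using st_comp_right[OF * \<rho>(1) Ro] .
    also have "st R A \<dots> \<phi>" using st_sym[OF \<rho>(2)] .
    finally show ?thesis .
  qed
  \<comment> \<open>\<theta> acts on F A as the identity, so 1 - \<theta> annihilates F A. If
    \<theta> were not invertible, 1 - \<theta> would be, and F A would vanish.\<close>
  have "is_iso B A A ?\<theta>"
  proof (rule ccontr)
    let ?n = "hadd B A A (Ident B A) (hneg B A A ?\<theta>)"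
    assume "\<not> is_iso B A A ?\<theta>"
    then have "is_iso B A A ?n" using loc \<theta> unfolding local_object_def by blast
    then obtain n' where n': "n' \<in> Hom B A A" "Comp B A A A n' ?n = Ident B A" by (auto simp: is_iso_def)
    have n: "?n \<in> Hom B A A" using Ao \<theta> by (simp add: hom_closed)
    have "st R A \<phi> (hzero B R A)" if R': "R \<in> S" and \<phi>: "\<phi> \<in> Hom B R A" for R \<phi>
    proof -
      note Ro = syzygy_ob[OF R']
      have "st R A (hadd B R A \<phi> (hneg B R A (Comp B R A A ?\<theta> \<phi>))) (hzero B R A)"
        using st_diff_zero[OF st_sym[OF \<theta>id[OF R' \<phi>]]] .
      then have "st R A (Comp B R A A ?n \<phi>) (hzero B R A)"
        using Ao Ro \<phi> \<theta> by (simp add: comp_add_left comp_neg_left comp_ident_left ident_closed hneg_closed)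
      from st_comp_left[OF this n'(1) Ao] have "st R A (Comp B R A A n' (Comp B R A A ?n \<phi>)) (hzero B R A)"
        using Ao Ro n'(1) by (simp add: comp_zero_right)
      then show ?thesis
        using comp_reassoc[OF n'(2) Ro Ao Ao Ao n n'(1) \<phi>] Ao Ro \<phi> by (simp add: comp_ident_left)
    qed
    then show False using nz by blast
  qed
  then obtain \<theta>' where \<theta>': "\<theta>' \<in> Hom B A A" "Comp B A A A \<theta>' ?\<theta> = Ident B A" by (auto simp: is_iso_def)
  obtain n where len: "local_length B n A'" using ex_local_length[OF D(13)] by blast
  \<comment> \<open>\<open>\<theta>' \<beta>\<close> is a retraction of \<alpha>, so A' is the sum
    of A and some S'.\<close>
  have "Comp B A A' A (Comp B A' A A \<theta>' \<beta>) \<alpha> = Ident B A"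
    using \<theta>' Ao D(13) \<alpha>(1) \<beta>(1) by (simp add: comp_assoc_right)
  then obtain S' j' p' q' where b: "biproduct B A S' A' \<alpha> j' p' q'"
    using local_retract_complement[OF loc len \<alpha>(1)] Ao D(13) \<theta>'(1) \<beta>(1) by (meson comp_closed)
  note bs = biproduct_simps[OF b]
  \<comment> \<open>The idempotent of A' with image A. From g' ~ \<alpha> \<beta> g' it fixes g'
    stably, so right minimality makes it stably split epi; an idempotent with this property is
    stably 1, and S' is stably zero.\<close>
  let ?c = "Comp B A' A A' \<alpha> p'"
  have c: "?c \<in> Hom B A' A'" "Comp B A' A' A' ?c ?c = ?c" using bs by (simp_all add: hom_simps)
  have g\<alpha>: "st R2' A' g' (Comp B R2' A A' \<alpha> (Comp B R2' A' A \<beta> g'))"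
  proof -
    have "st R2' A' (Comp B R2' R2 A' (Comp B R2 R2' A' g' i) \<pi>) (Comp B R2' R2 A' (Comp B R2 A A' \<alpha> a) \<pi>)"
      using st_comp_right[OF st_sym[OF \<alpha>(2)] i(2) ob'] .
    then have "st R2' A' g' (Comp B R2' R2 A' (Comp B R2 A A' \<alpha> a) \<pi>)"
      using st_trans[OF st_sym[OF gip]] by blast
    also have "\<dots> = Comp B R2' A A' \<alpha> (Comp B R2' R2 A a \<pi>)"
      using ob ob' D(13) \<alpha>(1) a i(2) by (simp add: comp_assoc_right)
    also have "st R2' A' \<dots> (Comp B R2' A A' \<alpha> (Comp B R2' A' A \<beta> g'))"
      using st_comp_left[OF \<beta>(2) \<alpha>(1) D(13)] .
    finally show ?thesis .
  qed
  have \<beta>g: "Comp B R2' A' A \<beta> g' \<in> Hom B R2' A" using ob ob' D(13,18) \<beta>(1) by (simp add: comp_closed)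
  have "st R2' A' (Comp B R2' A' A' ?c g') g'"
  proof -
    have "st R2' A' (Comp B R2' A' A' ?c g') (Comp B R2' A' A' ?c (Comp B R2' A A' \<alpha> (Comp B R2' A' A \<beta> g')))"
      using st_comp_left[OF g\<alpha> c(1) D(13)] .
    also have "\<dots> = Comp B R2' A A' \<alpha> (Comp B R2' A' A \<beta> g')"
      using bs \<beta>g ob' by (simp add: comp_assoc_right comp_closed)
    also have "st R2' A' \<dots> g'" using st_sym[OF g\<alpha>] .
    finally show ?thesis .
  qed
  then obtain d0 where d0: "d0 \<in> Hom B A' A'" "st A' A' (Comp B A' A' A' ?c d0) (Ident B A')"
    using cone_endo_split_epi[OF r(1) D(12) m2 c(1)] by blast
  have c1: "st A' A' ?c (Ident B A')"
  proof -
    have "st A' A' (Comp B A' A' A' ?c (Ident B A')) (Comp B A' A' A' ?c (Comp B A' A' A' ?c d0))"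
      using st_comp_left[OF st_sym[OF d0(2)] c(1) D(13)] .
    then have "st A' A' ?c (Comp B A' A' A' ?c d0)"
      using c d0(1) D(13) by (simp add: comp_reassoc[OF c(2)] comp_ident_right del: comp_closed)
    then show ?thesis using d0(2) by (rule st_trans)
  qed
  have "st S' S' (Comp B S' A' S' q' (Comp B S' A' A' (Ident B A') j')) (Comp B S' A' S' q' (Comp B S' A' A' ?c j'))"
    using st_comp_left[OF st_comp_right[OF st_sym[OF c1] bs(5,2)] bs(7,2)] .
  then have "st S' S' (Ident B S') (hzero B S' S')" using bs by (simp add: hom_simps)
  then have S': "S' \<in> projectives B" using projective_if_stably_zero bs(2) by blast
  \<comment> \<open>E is the part of R2' over the summand A, obtained from g' and the split triangle
    A -> A' -> S' by the dual octahedral axiom.\<close>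
  obtain E \<iota> d e \<epsilon>1 \<epsilon>2 where E: "E \<in> Ob B" "\<iota> \<in> Hom B E R2'" "d \<in> Hom B R1' E" "e \<in> Hom B E A"
    "Comp B R1' E R2' \<iota> d = f2" "Comp B E A A' \<alpha> e = Comp B E R2' A' g' \<iota>"
    "realizes B E R2' S' \<iota> (Comp B R2' A' S' q' g') \<epsilon>1" "realizes B R1' E A d e \<epsilon>2"
    using ET4_op[OF r(1) realz_zero[OF b]] by metis
  let ?y = "Comp B R2' A' S' q' g'"
  have y: "?y \<in> Hom B R2' S'" using bs D ob' by (simp add: comp_closed)
  \<comment> \<open>S' is projective, so R2' -> S' splits; what E omits passes through S', and
    \<iota> gets a stable right inverse \<eta>.\<close>
  obtain \<sigma> where \<sigma>: "\<sigma> \<in> Hom B S' R2'" "Ident B S' = Comp B S' R2' S' ?y \<sigma>"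
    using projective_lift[OF S' _ ident_closed[OF bs(2)]] E(7) unfolding E_triangle_def by blast
  have sy: "Comp B R2' S' R2' \<sigma> ?y \<in> Fac R2' R2'" using FacI[OF S' y \<sigma>(1) ob' ob'] .
  have "Comp B R2' R2' S' ?y (Ident B R2') = Comp B R2' R2' S' ?y (Comp B R2' S' R2' \<sigma> ?y)"
    using comp_reassoc[OF \<sigma>(2)[symmetric] ob' bs(2) ob' bs(2) \<sigma>(1) y y] y bs(2) ob'
    by (simp add: comp_ident_left comp_ident_right)
  then obtain \<eta> where \<eta>: "\<eta> \<in> Hom B R2' E"
    "Ident B R2' = hadd B R2' R2' (Comp B R2' S' R2' \<sigma> ?y) (Comp B R2' E R2' \<iota> \<eta>)"
    using weak_kernel[OF E(7) ob' ident_closed[OF ob'] Fac_Hom[OF sy]] by blast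
  have \<iota>\<eta>: "st R2' R2' (Ident B R2') (Comp B R2' E R2' \<iota> \<eta>)"
    using stI'[OF ob' ob' _ sy, of "Comp B R2' E R2' \<iota> \<eta>"] \<eta> E ob' by (simp add: comp_closed)
  obtain \<delta>q where rq: "realizes B R2' P T2 q v \<delta>q" using D(3) by (auto simp: E_triangle_def)
  \<comment> \<open>Passing from R2' to E replaces the cone T2 by an extension X of T2 by the
    projective S'. It splits by E(T,P) = 0, so X stays in \<open>T\<close>.\<close>
  obtain X v' x1 x2 \<epsilon>3 where X: "E_triangle B E P X (Comp B E R2' P q \<iota>) v'" "realizes B S' X T2 x1 x2 \<epsilon>3"
    using ET4[OF E(7) rq] unfolding E_triangle_def by metis
  have "\<epsilon>3 = \<zero>\<^bsub>Ext B T2 S'\<^esub>"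
    using realizesD(6)[OF X(2)] Ext_vanishes D(6) S' by (auto simp: Ext_vanishes_def)
  then have XT: "X \<in> T" using T_sum[OF _ D(6) split_triangle] X(2) S' projectives_subset by blast
  have eq: "Comp B R1' E P (Comp B E R2' P q \<iota>) d = u"
    using E(1-3,5) D(8,14,20) ob ob' by (simp add: comp_assoc_right)
  obtain T1' p2 h2 t2 \<delta>2 where dg2: "syzygy_diagram B T R1' E A P T1' X d e
      (Comp B R1' E P (Comp B E R2' P q \<iota>) d) p2 (Comp B E R2' P q \<iota>) v' h2 t2"
    using complete_diagram[OF E(8) X(1) D(7) XT D(2)[folded eq] D(5)] by blast
  note D2 = syzygy_diagramD[OF dg2]
  \<comment> \<open>An element a \<rho> is stably \<beta> g' i \<rho>. Moving i \<rho> into E by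
    \<iota> \<eta> turns this into \<theta> applied to an element of the image of e, and \<theta>
    acts as the identity on F A.\<close>
  have "stable_epi E A e"
    unfolding stable_epi_def
  proof (intro ballI)
    fix R \<phi> assume R': "R \<in> S" and \<phi>: "\<phi> \<in> Hom B R A"
    note Ro = syzygy_ob[OF R']
    obtain \<rho> where \<rho>: "\<rho> \<in> Hom B R R2" "st R A \<phi> (Comp B R R2 A a \<rho>)"
      using stable_epiD[OF aepi R' \<phi>] by blast
    let ?i = "Comp B R R2 R2' i \<rho>" and ?s = "Comp B R R2' E \<eta> (Comp B R R2 R2' i \<rho>)"
    have mem: "?i \<in> Hom B R R2'" "?s \<in> Hom B R E" "Comp B R E A e ?s \<in> Hom B R A"
      using E(1,4) \<eta>(1) i(1) \<rho>(1) Ro ob ob' by (simp_all add: comp_closed)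
    have "st R R2' (Comp B R R2' R2' (Ident B R2') ?i) (Comp B R R2' R2' (Comp B R2' E R2' \<iota> \<eta>) ?i)"
      using st_comp_right[OF \<iota>\<eta> mem(1) Ro] .
    then have 1: "st R R2' ?i (Comp B R E R2' \<iota> ?s)"
      using mem E(1,2) \<eta>(1) Ro ob' by (simp add: comp_ident_left comp_assoc_right)
    have "st R A (Comp B R R2 A (Comp B R2 A' A \<beta> (Comp B R2 R2' A' g' i)) \<rho>) (Comp B R R2 A a \<rho>)"
      using st_comp_right[OF \<beta>gi \<rho>(1) Ro] .
    then have "st R A \<phi> (Comp B R R2 A (Comp B R2 A' A \<beta> (Comp B R2 R2' A' g' i)) \<rho>)"
      using \<rho>(2) st_sym st_trans by blast
    also have "\<dots> = Comp B R A' A \<beta> (Comp B R R2' A' g' ?i)"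
      using ob ob' D(13,18) \<beta>(1) i(1) \<rho>(1) Ro by (simp add: comp_assoc_right comp_closed)
    also have "st R A \<dots> (Comp B R A' A \<beta> (Comp B R R2' A' g' (Comp B R E R2' \<iota> ?s)))"
      using st_comp_left[OF st_comp_left[OF 1 D(18,13)] \<beta>(1) Ao] .
    also have "\<dots> = Comp B R A A ?\<theta> (Comp B R E A e ?s)"
    proof -
      have "Comp B R R2' A' g' (Comp B R E R2' \<iota> ?s) = Comp B R A A' \<alpha> (Comp B R E A e ?s)"
        using comp_assoc[OF Ro E(1) ob' D(13) mem(2) E(2) D(18)] comp_assoc[OF Ro E(1) Ao D(13) mem(2) E(4) \<alpha>(1)] E(6)
        by simp
      then show ?thesis using Ro Ao D(13) \<alpha>(1) \<beta>(1) mem(3) by (simp add: comp_assoc_right)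
    qed
    also have "st R A \<dots> (Comp B R E A e ?s)" using \<theta>id[OF R' mem(3)] .
    finally show "\<exists>\<rho>\<in>Hom B R E. st R A \<phi> (Comp B R E A e \<rho>)" using mem(2) by blast
  qed
  then have "stable_zero A T1' h2" using stable_zero_if_epi D2 by blast
  then show ?thesis using dg2 by blast
qed

end

section \<open>Functors on stable syzygies\<close>

context extriangulated
begin

abbreviation "SC \<equiv> stable_cat B"
abbreviation "sq \<equiv> stable_mor B"

lemma stable_mor_eq_Collect:
  assumes "X \<in> Ob B" "Y \<in> Ob B" "f \<in> Hom B X Y"
  shows "sq X Y f = {g. st X Y g f}"
proof -
  have "sq X Y f = {hadd B X Y w f |w. w \<in> Fac X Y}" by (auto simp: qmor_def a_r_coset_def')
  also have "\<dots> = {g. st X Y g f}"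
    unfolding stably_equal_def using assms Fac_Hom hadd_closed hadd_comm by blast
  finally show ?thesis .
qed

lemma stable_mor_eq_iff:
  assumes "X \<in> Ob B" "Y \<in> Ob B" "f \<in> Hom B X Y" "g \<in> Hom B X Y"
  shows "sq X Y f = sq X Y g \<longleftrightarrow> st X Y f g"
proof
  assume "sq X Y f = sq X Y g"
  then have "{h. st X Y h f} = {h. st X Y h g}" using assms by (simp add: stable_mor_eq_Collect)
  then show "st X Y f g" using st_refl[OF assms(1-3)] by blast
next
  assume "st X Y f g"
  then have "st X Y h f \<longleftrightarrow> st X Y h g" for h using st_sym st_trans by blast
  then show "sq X Y f = sq X Y g" using assms by (simp add: stable_mor_eq_Collect)
qed

lemma Hom_stable: "Hom SC X Y = sq X Y ` Hom B X Y"
  by (auto simp: ideal_quotient_def A_RCOSETS_def' qmor_def)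

lemma stable_mor_closed: "f \<in> Hom B X Y \<Longrightarrow> sq X Y f \<in> Hom SC X Y"
  by (simp add: Hom_stable)

lemma Hom_stableE:
  assumes "\<phi> \<in> Hom SC X Y"
  obtains f where "f \<in> Hom B X Y" "\<phi> = sq X Y f"
  using assms by (auto simp: Hom_stable)

text \<open>Composition of cosets is a union over all representatives; compatibility with stable
  equality makes every member of the union the same coset.\<close>

lemma Comp_stable:
  assumes "X \<in> Ob B" "Y \<in> Ob B" "Z \<in> Ob B" "f \<in> Hom B X Y" "g \<in> Hom B Y Z"
  shows "Comp SC X Y Z (sq Y Z g) (sq X Y f) = sq X Z (Comp B X Y Z g f)"
proof -
  have "sq X Z (Comp B X Y Z g' f') = sq X Z (Comp B X Y Z g f)" if "st X Y f' f" "st Y Z g' g" for f' g'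
    using st_comp[OF that] stD[OF that(1)] stD[OF that(2)] assms
    by (simp add: stable_mor_eq_iff comp_closed)
  then have "(\<Union>g'\<in>{g'. st Y Z g' g}. \<Union>f'\<in>{f'. st X Y f' f}. sq X Z (Comp B X Y Z g' f')) = sq X Z (Comp B X Y Z g f)"
    using assms st_refl[of X Y f] st_refl[of Y Z g] by blast
  then show ?thesis
    using assms stable_mor_eq_Collect[of X Y f] stable_mor_eq_Collect[of Y Z g] by (simp add: ideal_quotient_def)
qed

lemma hadd_stable:
  assumes "X \<in> Ob B" "Y \<in> Ob B" "f \<in> Hom B X Y" "g \<in> Hom B X Y"
  shows "hadd SC X Y (sq X Y f) (sq X Y g) = sq X Y (hadd B X Y f g)"
proof -
  have "sq X Y (hadd B X Y f' g') = sq X Y (hadd B X Y f g)" if "st X Y f' f" "st X Y g' g" for f' g'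
    using st_add[OF that] stD[OF that(1)] stD[OF that(2)] assms
    by (simp add: stable_mor_eq_iff hadd_closed)
  then have "(\<Union>f'\<in>{f'. st X Y f' f}. \<Union>g'\<in>{g'. st X Y g' g}. sq X Y (hadd B X Y f' g')) = sq X Y (hadd B X Y f g)"
    using assms st_refl[of X Y f] st_refl[of X Y g] by blast
  then show ?thesis
    using assms stable_mor_eq_Collect[of X Y f] stable_mor_eq_Collect[of X Y g] by (simp add: ideal_quotient_def)
qed

lemma hzero_stable: "hzero SC X Y = sq X Y (hzero B X Y)"
  and Ident_stable: "Ident SC X = sq X X (Ident B X)"
  by (simp_all add: ideal_quotient_def)

lemma abelian_group_Hom_stable:
  assumes ob: "X \<in> Ob B" "Y \<in> Ob B"
  shows "abelian_group (HomG SC X Y)"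
proof (rule abelian_groupI)
  fix x assume "x \<in> carrier (HomG SC X Y)"
  then obtain f where f: "f \<in> Hom B X Y" "x = sq X Y f" by (auto elim: Hom_stableE)
  show "\<zero>\<^bsub>HomG SC X Y\<^esub> \<oplus>\<^bsub>HomG SC X Y\<^esub> x = x"
    using f ob by (simp add: hzero_stable hadd_stable hzero_closed hadd_zero_left)
  show "\<exists>y\<in>carrier (HomG SC X Y). y \<oplus>\<^bsub>HomG SC X Y\<^esub> x = \<zero>\<^bsub>HomG SC X Y\<^esub>"
    using f ob by (intro bexI[of _ "sq X Y (hneg B X Y f)"])
      (simp_all add: hadd_stable hneg_closed hadd_neg_left hzero_stable stable_mor_closed)
  fix y assume "y \<in> carrier (HomG SC X Y)"
  then obtain g where g: "g \<in> Hom B X Y" "y = sq X Y g" by (auto elim: Hom_stableE)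
  show "x \<oplus>\<^bsub>HomG SC X Y\<^esub> y \<in> carrier (HomG SC X Y)"
    using f g ob by (simp add: hadd_stable stable_mor_closed hadd_closed)
  show "x \<oplus>\<^bsub>HomG SC X Y\<^esub> y = y \<oplus>\<^bsub>HomG SC X Y\<^esub> x"
    using f g ob hadd_comm[of X Y f g] by (simp add: hadd_stable)
  fix z assume "z \<in> carrier (HomG SC X Y)"
  then obtain h where h: "h \<in> Hom B X Y" "z = sq X Y h" by (auto elim: Hom_stableE)
  show "x \<oplus>\<^bsub>HomG SC X Y\<^esub> y \<oplus>\<^bsub>HomG SC X Y\<^esub> z = x \<oplus>\<^bsub>HomG SC X Y\<^esub> (y \<oplus>\<^bsub>HomG SC X Y\<^esub> z)"
    using f g h ob by (simp add: hadd_stable hadd_closed hadd_assoc)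
qed (use ob in \<open>simp add: hzero_stable stable_mor_closed hzero_closed\<close>)

end

lemma abelian_group_hom_if_additive:
  assumes G: "abelian_group G" and H: "abelian_group H"
    and "\<And>x. x \<in> carrier G \<Longrightarrow> h x \<in> carrier H"
    and "\<And>x y. \<lbrakk>x \<in> carrier G; y \<in> carrier G\<rbrakk> \<Longrightarrow> h (x \<oplus>\<^bsub>G\<^esub> y) = h x \<oplus>\<^bsub>H\<^esub> h y"
  shows "abelian_group_hom G H h"
proof (rule abelian_group_homI[OF G H])
  interpret G: abelian_group G by (rule G)
  interpret H: abelian_group H by (rule H)
  show "group_hom (add_monoid G) (add_monoid H) h"
    using assms(3,4) by unfold_locales (simp add: hom_def)
qed

context syzygy_setting
begin

abbreviation "SS \<equiv> stable_syzygies B T"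
abbreviation "F \<equiv> hom_functor SC"

lemma stable_syzygies_simps:
  "Ob SS = S" "Hom SS = Hom SC" "Comp SS = Comp SC" "Ident SS = Ident SC" "hadd SS = hadd SC"
  "hzero SS = hzero SC" "HomG SS = HomG SC" "hom_functor SS = hom_functor SC"
  by (simp_all add: stable_syzygies_def full_subcat_def HomG_def hom_functor_def fun_eq_iff)

lemma hom_functor_simps:
  "ab_ob (F X) R = HomG SC R X" "ab_hom (F X) R' R r \<phi> = Comp SC R' R X \<phi> r"
  by (simp_all add: hom_functor_def)

lemma additive_hom_functor:
  assumes X: "X \<in> Ob B"
  shows "additive_ab_functor SS (F X)"
  unfolding additive_ab_functor_def stable_syzygies_simps hom_functor_simps
proof (intro conjI ballI)
  fix R assume R: "R \<in> S"
  note Ro = syzygy_ob[OF R]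
  show G: "abelian_group (HomG SC R X)" using abelian_group_Hom_stable[OF Ro X] .
  show "Comp SC R R X v (Ident SC R) = v" if "v \<in> carrier (HomG SC R X)" for v
    using that Ro X by (auto simp: Hom_stable Ident_stable Comp_stable ident_closed comp_ident_right)
  fix R' assume R': "R' \<in> S"
  note Ro' = syzygy_ob[OF R']
  {
    fix r assume "r \<in> Hom SC R R'"
    then obtain r0 where r: "r0 \<in> Hom B R R'" "r = sq R R' r0" by (rule Hom_stableE)
    show "abelian_group_hom (HomG SC R' X) (HomG SC R X) (\<lambda>\<phi>. Comp SC R R' X \<phi> r)"
    proof (rule abelian_group_hom_if_additive[OF abelian_group_Hom_stable[OF Ro' X] G])
      fix x assume "x \<in> carrier (HomG SC R' X)"
      then obtain f where f: "f \<in> Hom B R' X" "x = sq R' X f" by (auto elim: Hom_stableE)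
      then show "Comp SC R R' X x r \<in> carrier (HomG SC R X)"
        using r Ro Ro' X by (simp add: Comp_stable stable_mor_closed comp_closed)
      fix y assume "y \<in> carrier (HomG SC R' X)"
      then obtain g where g: "g \<in> Hom B R' X" "y = sq R' X g" by (auto elim: Hom_stableE)
      then show "Comp SC R R' X (x \<oplus>\<^bsub>HomG SC R' X\<^esub> y) r = Comp SC R R' X x r \<oplus>\<^bsub>HomG SC R X\<^esub> Comp SC R R' X y r"
        using f r Ro Ro' X by (simp add: Comp_stable hadd_stable hadd_closed comp_closed comp_add_left)
    qed
    fix s assume "s \<in> Hom SC R R'"
    then obtain s0 where s: "s0 \<in> Hom B R R'" "s = sq R R' s0" by (rule Hom_stableE)
    fix v assume "v \<in> carrier (HomG SC R' X)"
    then obtain f where f: "f \<in> Hom B R' X" "v = sq R' X f" by (auto elim: Hom_stableE)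
    show "Comp SC R R' X v (hadd SC R R' r s) = Comp SC R R' X v r \<oplus>\<^bsub>HomG SC R X\<^esub> Comp SC R R' X v s"
      using f r s Ro Ro' X by (simp add: Comp_stable hadd_stable hadd_closed comp_closed comp_add_right)
  }
  fix R'' r s v assume R'': "R'' \<in> S" and "r \<in> Hom SC R R'" "s \<in> Hom SC R' R''" "v \<in> carrier (HomG SC R'' X)"
  note Ro'' = syzygy_ob[OF R'']
  show "Comp SC R R'' X v (Comp SC R R' R'' s r) = Comp SC R R' X (Comp SC R' R'' X v s) r"
    using \<open>r \<in> _\<close> \<open>s \<in> _\<close> \<open>v \<in> _\<close> Ro Ro' Ro'' X
    by (auto simp: Hom_stable Comp_stable comp_closed comp_assoc)
qed

lemma additiveD:
  assumes "additive_ab_functor SS M"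
  shows "R \<in> S \<Longrightarrow> abelian_group (ab_ob M R)"
    "\<lbrakk>R \<in> S; R' \<in> S; r \<in> Hom SC R' R\<rbrakk> \<Longrightarrow> abelian_group_hom (ab_ob M R) (ab_ob M R') (ab_hom M R' R r)"
  using assms unfolding additive_ab_functor_def stable_syzygies_simps by blast+

lemma nat_transD:
  assumes "\<eta> \<in> nat_trans SS M N" "R \<in> S"
  shows "abelian_group_hom (ab_ob M R) (ab_ob N R) (\<eta> R)"
    "v \<in> carrier (ab_ob M R) \<Longrightarrow> \<eta> R v \<in> carrier (ab_ob N R)"
    "\<lbrakk>v \<in> carrier (ab_ob M R); w \<in> carrier (ab_ob M R)\<rbrakk> \<Longrightarrow> \<eta> R (v \<oplus>\<^bsub>ab_ob M R\<^esub> w) = \<eta> R v \<oplus>\<^bsub>ab_ob N R\<^esub> \<eta> R w"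
    "\<eta> R \<zero>\<^bsub>ab_ob M R\<^esub> = \<zero>\<^bsub>ab_ob N R\<^esub>"
    "\<lbrakk>R' \<in> S; r \<in> Hom SC R' R; v \<in> carrier (ab_ob M R)\<rbrakk>
      \<Longrightarrow> \<eta> R' (ab_hom M R' R r v) = ab_hom N R' R r (\<eta> R v)"
proof -
  show h: "abelian_group_hom (ab_ob M R) (ab_ob N R) (\<eta> R)"
    using assms by (simp add: nat_trans_def stable_syzygies_simps)
  interpret h: abelian_group_hom "ab_ob M R" "ab_ob N R" "\<eta> R" by (rule h)
  show "v \<in> carrier (ab_ob M R) \<Longrightarrow> \<eta> R v \<in> carrier (ab_ob N R)"
    "\<lbrakk>v \<in> carrier (ab_ob M R); w \<in> carrier (ab_ob M R)\<rbrakk> \<Longrightarrow> \<eta> R (v \<oplus>\<^bsub>ab_ob M R\<^esub> w) = \<eta> R v \<oplus>\<^bsub>ab_ob N R\<^esub> \<eta> R w"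
    "\<eta> R \<zero>\<^bsub>ab_ob M R\<^esub> = \<zero>\<^bsub>ab_ob N R\<^esub>"
    by (simp_all add: h.hom_closed h.hom_add h.hom_zero)
  show "\<lbrakk>R' \<in> S; r \<in> Hom SC R' R; v \<in> carrier (ab_ob M R)\<rbrakk>
      \<Longrightarrow> \<eta> R' (ab_hom M R' R r v) = ab_hom N R' R r (\<eta> R v)"
    using assms by (simp add: nat_trans_def stable_syzygies_simps)
qed

lemma nat_trans_eqI:
  assumes "\<eta> \<in> nat_trans SS M N" "\<eta>' \<in> nat_trans SS M N'"
    and eq: "\<And>R v. \<lbrakk>R \<in> S; v \<in> carrier (ab_ob M R)\<rbrakk> \<Longrightarrow> \<eta> R v = \<eta>' R v"
  shows "\<eta> = \<eta>'"
proof (rule extensionalityI[where A = S])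
  show "\<eta> \<in> extensional S" "\<eta>' \<in> extensional S"
    using assms by (simp_all add: nat_trans_def stable_syzygies_simps)
  fix R assume R: "R \<in> S"
  show "\<eta> R = \<eta>' R"
    using assms R by (intro extensionalityI[where A = "carrier (ab_ob M R)"])
      (simp_all add: nat_trans_def stable_syzygies_simps)
qed

text \<open>The passage from representatives to cosets, done once. Extensionality is built into the
  definition of \<open>\<eta>\<close>, and \<open>cong\<close> makes the choice of representatives
  immaterial.\<close>

lemma nat_trans_if_family:
  assumes X: "X \<in> Ob B" and M: "\<And>R. R \<in> S \<Longrightarrow> abelian_group (ab_ob M R)"
    and closed: "\<And>R \<rho>. \<lbrakk>R \<in> S; \<rho> \<in> Hom B R X\<rbrakk> \<Longrightarrow> \<Theta> R \<rho> \<in> carrier (ab_ob M R)"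
    and cong: "\<And>R \<rho> \<rho>'. \<lbrakk>R \<in> S; st R X \<rho> \<rho>'\<rbrakk> \<Longrightarrow> \<Theta> R \<rho> = \<Theta> R \<rho>'"
    and add: "\<And>R \<rho> \<rho>'. \<lbrakk>R \<in> S; \<rho> \<in> Hom B R X; \<rho>' \<in> Hom B R X\<rbrakk>
      \<Longrightarrow> \<Theta> R (hadd B R X \<rho> \<rho>') = \<Theta> R \<rho> \<oplus>\<^bsub>ab_ob M R\<^esub> \<Theta> R \<rho>'"
    and nat: "\<And>R R' r \<rho>. \<lbrakk>R \<in> S; R' \<in> S; r \<in> Hom B R' R; \<rho> \<in> Hom B R X\<rbrakk>
      \<Longrightarrow> \<Theta> R' (Comp B R' R X \<rho> r) = ab_hom M R' R (sq R' R r) (\<Theta> R \<rho>)"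
  shows "\<exists>\<eta>\<in>nat_trans SS (F X) M. \<forall>R\<in>S. \<forall>\<rho>\<in>Hom B R X. \<eta> R (sq R X \<rho>) = \<Theta> R \<rho>"
proof -
  define rep where "rep R \<phi> = (SOME \<rho>. \<rho> \<in> Hom B R X \<and> \<phi> = sq R X \<rho>)" for R \<phi>
  define \<eta> where "\<eta> = (\<lambda>R\<in>S. \<lambda>\<phi>\<in>Hom SC R X. \<Theta> R (rep R \<phi>))"
  have \<eta>: "\<eta> R (sq R X \<rho>) = \<Theta> R \<rho>" if R: "R \<in> S" and \<rho>: "\<rho> \<in> Hom B R X" for R \<rho>
  proof -
    have "rep R (sq R X \<rho>) \<in> Hom B R X \<and> sq R X \<rho> = sq R X (rep R (sq R X \<rho>))"
      unfolding rep_def by (rule someI[of _ \<rho>]) (simp add: \<rho>)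
    then have "st R X (rep R (sq R X \<rho>)) \<rho>"
      using stable_mor_eq_iff[OF syzygy_ob[OF R] X] \<rho> by metis
    then show ?thesis using cong[OF R] R \<rho> by (simp add: \<eta>_def stable_mor_closed)
  qed
  have "\<eta> \<in> nat_trans SS (F X) M"
    unfolding nat_trans_def stable_syzygies_simps hom_functor_simps
  proof (intro CollectI conjI ballI)
    show "\<eta> \<in> extensional S" by (simp add: \<eta>_def)
    fix R assume R: "R \<in> S"
    note Ro = syzygy_ob[OF R]
    show "\<eta> R \<in> extensional (carrier (HomG SC R X))" using R by (simp add: \<eta>_def)
    show "abelian_group_hom (HomG SC R X) (ab_ob M R) (\<eta> R)"
    proof (rule abelian_group_hom_if_additive[OF abelian_group_Hom_stable[OF Ro X] M[OF R]])
      fix x assume "x \<in> carrier (HomG SC R X)"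
      then obtain f where f: "f \<in> Hom B R X" "x = sq R X f" by (auto elim: Hom_stableE)
      then show "\<eta> R x \<in> carrier (ab_ob M R)" using \<eta> closed R by simp
      fix y assume "y \<in> carrier (HomG SC R X)"
      then obtain g where g: "g \<in> Hom B R X" "y = sq R X g" by (auto elim: Hom_stableE)
      then show "\<eta> R (x \<oplus>\<^bsub>HomG SC R X\<^esub> y) = \<eta> R x \<oplus>\<^bsub>ab_ob M R\<^esub> \<eta> R y"
        using f \<eta> add R Ro X by (simp add: hadd_stable hadd_closed)
    qed
    fix R' r v assume R': "R' \<in> S" and "r \<in> Hom SC R R'" and "v \<in> carrier (HomG SC R' X)"
    then obtain r0 f where "r0 \<in> Hom B R R'" "r = sq R R' r0" "f \<in> Hom B R' X" "v = sq R' X f"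
      by (auto elim!: Hom_stableE)
    then show "\<eta> R (Comp SC R R' X v r) = ab_hom M R R' r (\<eta> R' v)"
      using \<eta> nat[OF R' R] R R' Ro syzygy_ob[OF R'] X by (simp add: Comp_stable comp_closed)
  qed
  then show ?thesis using \<eta> by blast
qed

lemma nat_trans_from_hom_functor:
  assumes \<eta>: "\<eta> \<in> nat_trans SS (F X) M" and X: "X \<in> Ob B" and R: "R \<in> S"
  shows "\<rho> \<in> Hom B R X \<Longrightarrow> \<eta> R (sq R X \<rho>) \<in> carrier (ab_ob M R)"
    "\<lbrakk>\<rho> \<in> Hom B R X; \<rho>' \<in> Hom B R X\<rbrakk>
      \<Longrightarrow> \<eta> R (sq R X (hadd B R X \<rho> \<rho>')) = \<eta> R (sq R X \<rho>) \<oplus>\<^bsub>ab_ob M R\<^esub> \<eta> R (sq R X \<rho>')"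
    "\<lbrakk>R' \<in> S; r \<in> Hom B R' R; \<rho> \<in> Hom B R X\<rbrakk>
      \<Longrightarrow> \<eta> R' (sq R' X (Comp B R' R X \<rho> r)) = ab_hom M R' R (sq R' R r) (\<eta> R (sq R X \<rho>))"
    "st R X \<rho> \<rho>' \<Longrightarrow> \<eta> R (sq R X \<rho>) = \<eta> R (sq R X \<rho>')"
proof -
  note Ro = syzygy_ob[OF R]
  show "\<rho> \<in> Hom B R X \<Longrightarrow> \<eta> R (sq R X \<rho>) \<in> carrier (ab_ob M R)"
    using nat_transD(2)[OF \<eta> R] by (simp add: hom_functor_simps stable_mor_closed)
  show "\<lbrakk>\<rho> \<in> Hom B R X; \<rho>' \<in> Hom B R X\<rbrakk>
      \<Longrightarrow> \<eta> R (sq R X (hadd B R X \<rho> \<rho>')) = \<eta> R (sq R X \<rho>) \<oplus>\<^bsub>ab_ob M R\<^esub> \<eta> R (sq R X \<rho>')"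
    using nat_transD(3)[OF \<eta> R, of "sq R X \<rho>" "sq R X \<rho>'"] Ro X
    by (simp add: hom_functor_simps stable_mor_closed hadd_stable)
  show "\<lbrakk>R' \<in> S; r \<in> Hom B R' R; \<rho> \<in> Hom B R X\<rbrakk>
      \<Longrightarrow> \<eta> R' (sq R' X (Comp B R' R X \<rho> r)) = ab_hom M R' R (sq R' R r) (\<eta> R (sq R X \<rho>))"
    using nat_transD(5)[OF \<eta> R, of R' "sq R' R r" "sq R X \<rho>"] Ro syzygy_ob[of R'] X
    by (simp add: hom_functor_simps stable_mor_closed Comp_stable)
  show "st R X \<rho> \<rho>' \<Longrightarrow> \<eta> R (sq R X \<rho>) = \<eta> R (sq R X \<rho>')"
    using stable_mor_eq_iff[OF Ro X] stD by metis
qed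

lemma Hom_syzygies_on_hom:
  assumes "R \<in> S" "X \<in> Ob B" "Y \<in> Ob B" "f \<in> Hom B X Y" "\<rho> \<in> Hom B R X"
  shows "on_hom (Hom_syzygies B T) X Y f R (sq R X \<rho>) = sq R Y (Comp B R X Y f \<rho>)"
  using assms syzygy_ob by (simp add: Hom_syzygies_def stable_mor_closed Comp_stable)

lemma on_hom_nat_trans:
  assumes ob: "X \<in> Ob B" "Y \<in> Ob B" and f: "f \<in> Hom B X Y"
  shows "on_hom (Hom_syzygies B T) X Y f \<in> nat_trans SS (F X) (F Y)"
proof -
  have "\<exists>\<eta>\<in>nat_trans SS (F X) (F Y). \<forall>R\<in>S. \<forall>\<rho>\<in>Hom B R X. \<eta> R (sq R X \<rho>) = sq R Y (Comp B R X Y f \<rho>)"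
  proof (rule nat_trans_if_family[OF ob(1)]; (unfold hom_functor_simps)?)
    fix R assume R: "R \<in> S"
    note Ro = syzygy_ob[OF R]
    show "abelian_group (HomG SC R Y)" using abelian_group_Hom_stable Ro ob by simp
    show "sq R Y (Comp B R X Y f \<rho>) \<in> carrier (HomG SC R Y)" if "\<rho> \<in> Hom B R X" for \<rho>
      using that Ro ob f by (simp add: stable_mor_closed comp_closed)
    show "sq R Y (Comp B R X Y f \<rho>) = sq R Y (Comp B R X Y f \<rho>')" if "st R X \<rho> \<rho>'" for \<rho> \<rho>'
      using st_comp_left[OF that f ob(2)] stD[OF that] ob f by (simp add: stable_mor_eq_iff comp_closed)
    show "sq R Y (Comp B R X Y f (hadd B R X \<rho> \<rho>'))
        = sq R Y (Comp B R X Y f \<rho>) \<oplus>\<^bsub>HomG SC R Y\<^esub> sq R Y (Comp B R X Y f \<rho>')"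
      if "\<rho> \<in> Hom B R X" "\<rho>' \<in> Hom B R X" for \<rho> \<rho>'
      using that Ro ob f by (simp add: hadd_stable comp_closed comp_add_right)
    show "sq R' Y (Comp B R' X Y f (Comp B R' R X \<rho> r)) = Comp SC R' R Y (sq R Y (Comp B R X Y f \<rho>)) (sq R' R r)"
      if "R' \<in> S" "r \<in> Hom B R' R" "\<rho> \<in> Hom B R X" for R' r \<rho>
      using that Ro syzygy_ob[OF that(1)] ob f by (simp add: Comp_stable comp_closed comp_assoc)
  qed
  then obtain \<eta> where \<eta>: "\<eta> \<in> nat_trans SS (F X) (F Y)"
    "\<And>R \<rho>. \<lbrakk>R \<in> S; \<rho> \<in> Hom B R X\<rbrakk> \<Longrightarrow> \<eta> R (sq R X \<rho>) = sq R Y (Comp B R X Y f \<rho>)" by blast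
  have "on_hom (Hom_syzygies B T) X Y f = \<eta>"
  proof (rule extensionalityI[where A = S])
    show "on_hom (Hom_syzygies B T) X Y f \<in> extensional S" by (simp add: Hom_syzygies_def)
    show "\<eta> \<in> extensional S" using \<eta>(1) by (simp add: nat_trans_def stable_syzygies_simps)
    fix R assume R: "R \<in> S"
    show "on_hom (Hom_syzygies B T) X Y f R = \<eta> R"
    proof (rule extensionalityI[where A = "Hom SC R X"])
      show "on_hom (Hom_syzygies B T) X Y f R \<in> extensional (Hom SC R X)"
        using R by (simp add: Hom_syzygies_def)
      show "\<eta> R \<in> extensional (Hom SC R X)"
        using \<eta>(1) R by (simp add: nat_trans_def stable_syzygies_simps hom_functor_simps)
      show "on_hom (Hom_syzygies B T) X Y f R x = \<eta> R x" if "x \<in> Hom SC R X" for x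
        using that \<eta>(2)[OF R] R ob f by (auto simp: Hom_syzygies_on_hom elim!: Hom_stableE)
    qed
  qed
  then show ?thesis using \<eta> by simp
qed

lemma hom_functor_nat_trans_eqI:
  assumes "\<eta> \<in> nat_trans SS (F X) N" "\<eta>' \<in> nat_trans SS (F X) N'"
    and "\<And>R \<rho>. \<lbrakk>R \<in> S; \<rho> \<in> Hom B R X\<rbrakk> \<Longrightarrow> \<eta> R (sq R X \<rho>) = \<eta>' R (sq R X \<rho>)"
  shows "\<eta> = \<eta>'"
  using assms by (intro nat_trans_eqI) (auto simp: hom_functor_simps elim!: Hom_stableE)

section \<open>Fullness and finite presentation on representatives\<close>

lemma full_functor_iff: "full_functor B (mod_cat SS) (Hom_syzygies B T) \<longleftrightarrow> (\<forall>X\<in>Ob B. full_at X)"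
proof
  assume fl: "full_functor B (mod_cat SS) (Hom_syzygies B T)"
  show "\<forall>X\<in>Ob B. full_at X"
    unfolding full_at_def
  proof (intro ballI allI impI)
    fix X Y \<Phi> assume ob: "X \<in> Ob B" "Y \<in> Ob B" and \<Phi>: "stable_family X Y \<Phi>"
    have "\<exists>\<eta>\<in>nat_trans SS (F X) (F Y). \<forall>R\<in>S. \<forall>\<rho>\<in>Hom B R X. \<eta> R (sq R X \<rho>) = sq R Y (\<Phi> R \<rho>)"
    proof (rule nat_trans_if_family[OF ob(1)]; (unfold hom_functor_simps)?)
      fix R assume R: "R \<in> S"
      note Ro = syzygy_ob[OF R]
      note \<Phi>R = stable_familyD[OF \<Phi> R]
      show "abelian_group (HomG SC R Y)" using abelian_group_Hom_stable Ro ob by simp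
      show "sq R Y (\<Phi> R \<rho>) \<in> carrier (HomG SC R Y)" if "\<rho> \<in> Hom B R X" for \<rho>
        using \<Phi>R(1)[OF that] by (simp add: stable_mor_closed)
      show "sq R Y (\<Phi> R \<rho>) = sq R Y (\<Phi> R \<rho>')" if "st R X \<rho> \<rho>'" for \<rho> \<rho>'
        using \<Phi>R(2)[OF that] stD[OF that] \<Phi>R(1) Ro ob by (simp add: stable_mor_eq_iff)
      show "sq R Y (\<Phi> R (hadd B R X \<rho> \<rho>')) = sq R Y (\<Phi> R \<rho>) \<oplus>\<^bsub>HomG SC R Y\<^esub> sq R Y (\<Phi> R \<rho>')"
        if "\<rho> \<in> Hom B R X" "\<rho>' \<in> Hom B R X" for \<rho> \<rho>'
        using \<Phi>R(3)[OF that] that \<Phi>R(1) Ro ob by (simp add: hadd_stable stable_mor_eq_iff hadd_closed)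
      show "sq R' Y (\<Phi> R' (Comp B R' R X \<rho> r)) = Comp SC R' R Y (sq R Y (\<Phi> R \<rho>)) (sq R' R r)"
        if "R' \<in> S" "r \<in> Hom B R' R" "\<rho> \<in> Hom B R X" for R' r \<rho>
        using \<Phi>R(4)[OF that] that \<Phi>R(1) stable_familyD(1)[OF \<Phi> that(1)] Ro syzygy_ob[OF that(1)] ob
        by (simp add: Comp_stable stable_mor_eq_iff comp_closed)
    qed
    then obtain \<eta> where \<eta>: "\<eta> \<in> nat_trans SS (F X) (F Y)"
      "\<And>R \<rho>. \<lbrakk>R \<in> S; \<rho> \<in> Hom B R X\<rbrakk> \<Longrightarrow> \<eta> R (sq R X \<rho>) = sq R Y (\<Phi> R \<rho>)" by blast
    have "\<eta> \<in> Hom (mod_cat SS) (on_ob (Hom_syzygies B T) X) (on_ob (Hom_syzygies B T) Y)"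
      using \<eta>(1) by (simp add: mod_cat_def Hom_syzygies_def)
    then obtain f where f: "f \<in> Hom B X Y" "on_hom (Hom_syzygies B T) X Y f = \<eta>"
      using fl ob unfolding full_functor_def by blast
    have "st R Y (\<Phi> R \<rho>) (Comp B R X Y f \<rho>)" if R: "R \<in> S" and \<rho>: "\<rho> \<in> Hom B R X" for R \<rho>
      using Hom_syzygies_on_hom[OF R ob f(1) \<rho>] \<eta>(2)[OF R \<rho>] stable_familyD(1)[OF \<Phi> R \<rho>]
        syzygy_ob[OF R] ob f \<rho> by (simp add: stable_mor_eq_iff comp_closed)
    then show "\<exists>c\<in>Hom B X Y. \<forall>R\<in>S. \<forall>\<rho>\<in>Hom B R X. st R Y (\<Phi> R \<rho>) (Comp B R X Y c \<rho>)"
      using f(1) by blast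
  qed
next
  assume fl: "\<forall>X\<in>Ob B. full_at X"
  show "full_functor B (mod_cat SS) (Hom_syzygies B T)"
    unfolding full_functor_def
  proof (intro ballI)
    fix X Y \<eta> assume ob: "X \<in> Ob B" "Y \<in> Ob B"
      and "\<eta> \<in> Hom (mod_cat SS) (on_ob (Hom_syzygies B T) X) (on_ob (Hom_syzygies B T) Y)"
    then have \<eta>: "\<eta> \<in> nat_trans SS (F X) (F Y)" by (simp add: mod_cat_def Hom_syzygies_def)
    note H = nat_trans_from_hom_functor[OF \<eta> ob(1)]
    define \<Phi> where "\<Phi> R \<rho> = (SOME \<sigma>. \<sigma> \<in> Hom B R Y \<and> \<eta> R (sq R X \<rho>) = sq R Y \<sigma>)" for R \<rho>
    have \<Phi>: "\<Phi> R \<rho> \<in> Hom B R Y" "\<eta> R (sq R X \<rho>) = sq R Y (\<Phi> R \<rho>)" if "R \<in> S" "\<rho> \<in> Hom B R X" for R \<rho>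
    proof -
      have "\<exists>\<sigma>. \<sigma> \<in> Hom B R Y \<and> \<eta> R (sq R X \<rho>) = sq R Y \<sigma>"
        using H(1)[OF that] by (auto simp: hom_functor_simps elim!: Hom_stableE)
      from someI_ex[OF this] show "\<Phi> R \<rho> \<in> Hom B R Y" "\<eta> R (sq R X \<rho>) = sq R Y (\<Phi> R \<rho>)"
        unfolding \<Phi>_def by blast+
    qed
    have "stable_family X Y \<Phi>"
      unfolding stable_family_def
    proof (intro conjI ballI allI impI)
      fix R \<rho> \<rho>' assume R: "R \<in> S" and e: "st R X \<rho> \<rho>'"
      show "st R Y (\<Phi> R \<rho>) (\<Phi> R \<rho>')"
        using H(4)[OF R e] \<Phi>[OF R stD(3)[OF e]] \<Phi>[OF R stD(4)[OF e]] syzygy_ob[OF R] ob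
        by (simp add: stable_mor_eq_iff)
    next
      fix R \<rho> \<rho>' assume R: "R \<in> S" and \<rho>: "\<rho> \<in> Hom B R X" "\<rho>' \<in> Hom B R X"
      note Ro = syzygy_ob[OF R]
      have "hadd B R X \<rho> \<rho>' \<in> Hom B R X" using \<rho> Ro ob by (simp add: hadd_closed)
      then show "st R Y (\<Phi> R (hadd B R X \<rho> \<rho>')) (hadd B R Y (\<Phi> R \<rho>) (\<Phi> R \<rho>'))"
        using H(2)[OF R \<rho>] \<Phi>[OF R] \<rho> Ro ob
        by (simp add: hom_functor_simps hadd_stable stable_mor_eq_iff hadd_closed)
    next
      fix R R' r \<rho> assume R: "R \<in> S" "R' \<in> S" and r: "r \<in> Hom B R' R" and \<rho>: "\<rho> \<in> Hom B R X"
      note Ro = syzygy_ob[OF R(1)] syzygy_ob[OF R(2)]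
      have "Comp B R' R X \<rho> r \<in> Hom B R' X" using \<rho> r Ro ob by (simp add: comp_closed)
      then show "st R' Y (\<Phi> R' (Comp B R' R X \<rho> r)) (Comp B R' R Y (\<Phi> R \<rho>) r)"
        using H(3)[OF R(1,2) r \<rho>] \<Phi>[OF R(1) \<rho>] \<Phi>[OF R(2)] r Ro ob
        by (simp add: hom_functor_simps Comp_stable stable_mor_eq_iff comp_closed)
    qed (rule \<Phi>(1))
    then obtain c where c: "c \<in> Hom B X Y" "\<And>R \<rho>. \<lbrakk>R \<in> S; \<rho> \<in> Hom B R X\<rbrakk> \<Longrightarrow> st R Y (\<Phi> R \<rho>) (Comp B R X Y c \<rho>)"
      using fl ob unfolding full_at_def by blast
    have "on_hom (Hom_syzygies B T) X Y c = \<eta>"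
    proof (rule hom_functor_nat_trans_eqI[OF on_hom_nat_trans[OF ob c(1)] \<eta>])
      fix R \<rho> assume R: "R \<in> S" and \<rho>: "\<rho> \<in> Hom B R X"
      then show "on_hom (Hom_syzygies B T) X Y c R (sq R X \<rho>) = \<eta> R (sq R X \<rho>)"
        using c(2)[OF R \<rho>] \<Phi>[OF R \<rho>] syzygy_ob[OF R] ob c(1) stD[OF c(2)[OF R \<rho>]]
        by (simp add: Hom_syzygies_on_hom stable_mor_eq_iff st_sym)
    qed
    then show "\<exists>f\<in>Hom B X Y. on_hom (Hom_syzygies B T) X Y f = \<eta>" using c(1) by blast
  qed
qed

lemma finitely_presentedI:
  assumes M: "additive_ab_functor SS M" and R: "R1 \<in> S" "R2 \<in> S" and f: "f \<in> Hom B R1 R2"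
    and \<pi>: "\<pi> \<in> nat_trans SS (F R2) M"
    and surj: "\<And>R v. \<lbrakk>R \<in> S; v \<in> carrier (ab_ob M R)\<rbrakk> \<Longrightarrow> \<exists>\<rho>\<in>Hom B R R2. v = \<pi> R (sq R R2 \<rho>)"
    and ker: "\<And>R \<rho>. \<lbrakk>R \<in> S; \<rho> \<in> Hom B R R2\<rbrakk> \<Longrightarrow>
      \<pi> R (sq R R2 \<rho>) = \<zero>\<^bsub>ab_ob M R\<^esub> \<longleftrightarrow> (\<exists>\<sigma>\<in>Hom B R R1. st R R2 \<rho> (Comp B R R1 R2 f \<sigma>))"
  shows "finitely_presented SS M"
proof -
  note ob = syzygy_ob[OF R(1)] syzygy_ob[OF R(2)]
  let ?\<alpha> = "on_hom (Hom_syzygies B T) R1 R2 f"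
  have \<alpha>: "?\<alpha> \<in> nat_trans SS (F R1) (F R2)" using on_hom_nat_trans[OF ob f] .
  have surj': "\<pi> R ` Hom SC R R2 = carrier (ab_ob M R)" if "R \<in> S" for R
    using surj[OF that] nat_trans_from_hom_functor(1)[OF \<pi> ob(2) that] unfolding Hom_stable by blast
  have ker': "?\<alpha> R ` Hom SC R R1 = a_kernel (HomG SC R R2) (ab_ob M R) (\<pi> R)" if R: "R \<in> S" for R
  proof -
    note Ro = syzygy_ob[OF R]
    have "?\<alpha> R ` Hom SC R R1 = {sq R R2 (Comp B R R1 R2 f \<sigma>) |\<sigma>. \<sigma> \<in> Hom B R R1}"
      unfolding Hom_stable image_image using R ob f by (auto simp: Hom_syzygies_on_hom)
    also have "\<dots> = {sq R R2 \<rho> |\<rho>. \<rho> \<in> Hom B R R2 \<and> (\<exists>\<sigma>\<in>Hom B R R1. st R R2 \<rho> (Comp B R R1 R2 f \<sigma>))}"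
    proof (intro equalityI subsetI)
      fix x assume "x \<in> {sq R R2 (Comp B R R1 R2 f \<sigma>) |\<sigma>. \<sigma> \<in> Hom B R R1}"
      then obtain \<sigma> where "\<sigma> \<in> Hom B R R1" "x = sq R R2 (Comp B R R1 R2 f \<sigma>)" by blast
      then show "x \<in> {sq R R2 \<rho> |\<rho>. \<rho> \<in> Hom B R R2 \<and> (\<exists>\<sigma>\<in>Hom B R R1. st R R2 \<rho> (Comp B R R1 R2 f \<sigma>))}"
        using comp_closed[OF Ro ob _ f] st_refl[OF Ro ob(2)] by blast
    next
      fix x assume "x \<in> {sq R R2 \<rho> |\<rho>. \<rho> \<in> Hom B R R2 \<and> (\<exists>\<sigma>\<in>Hom B R R1. st R R2 \<rho> (Comp B R R1 R2 f \<sigma>))}"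
      then obtain \<rho> \<sigma> where *: "x = sq R R2 \<rho>" "\<rho> \<in> Hom B R R2" "\<sigma> \<in> Hom B R R1" "st R R2 \<rho> (Comp B R R1 R2 f \<sigma>)"
        by blast
      then have "x = sq R R2 (Comp B R R1 R2 f \<sigma>)" using stable_mor_eq_iff Ro ob f by (simp add: comp_closed)
      then show "x \<in> {sq R R2 (Comp B R R1 R2 f \<sigma>) |\<sigma>. \<sigma> \<in> Hom B R R1}" using * by blast
    qed
    also have "\<dots> = {sq R R2 \<rho> |\<rho>. \<rho> \<in> Hom B R R2 \<and> \<pi> R (sq R R2 \<rho>) = \<zero>\<^bsub>ab_ob M R\<^esub>}"
      using ker[OF R] by blast
    also have "\<dots> = a_kernel (HomG SC R R2) (ab_ob M R) (\<pi> R)"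
      by (auto simp: a_kernel_def' Hom_stable)
    finally show ?thesis .
  qed
  show ?thesis
    unfolding finitely_presented_def stable_syzygies_simps
    by (intro conjI M bexI[OF _ R(1)] bexI[OF _ R(2)] bexI[OF _ \<alpha>] bexI[OF _ \<pi>] ballI)
      (simp_all add: surj' ker')
qed

text \<open>By Yoneda the first map of the presentation is composition with a morphism f, namely a
  representative of its value at the identity of R1.\<close>

lemma finitely_presentedE:
  assumes M: "finitely_presented SS M"
  obtains R1 R2 f \<pi> where "R1 \<in> S" "R2 \<in> S" "f \<in> Hom B R1 R2" "\<pi> \<in> nat_trans SS (F R2) M"
    "\<And>R v. \<lbrakk>R \<in> S; v \<in> carrier (ab_ob M R)\<rbrakk> \<Longrightarrow> \<exists>\<rho>\<in>Hom B R R2. v = \<pi> R (sq R R2 \<rho>)"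
    "\<And>R \<rho>. \<lbrakk>R \<in> S; \<rho> \<in> Hom B R R2\<rbrakk> \<Longrightarrow>
      \<pi> R (sq R R2 \<rho>) = \<zero>\<^bsub>ab_ob M R\<^esub> \<longleftrightarrow> (\<exists>\<sigma>\<in>Hom B R R1. st R R2 \<rho> (Comp B R R1 R2 f \<sigma>))"
proof -
  obtain R1 R2 \<alpha> \<pi> where R: "R1 \<in> S" "R2 \<in> S" and \<alpha>: "\<alpha> \<in> nat_trans SS (F R1) (F R2)"
    and \<pi>: "\<pi> \<in> nat_trans SS (F R2) M"
    and ex: "\<forall>R\<in>S. \<pi> R ` Hom SC R R2 = carrier (ab_ob M R) \<and>
      \<alpha> R ` Hom SC R R1 = a_kernel (HomG SC R R2) (ab_ob M R) (\<pi> R)"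
    using M unfolding finitely_presented_def stable_syzygies_simps by (elim conjE bexE) (rule that)
  have surj: "\<And>R. R \<in> S \<Longrightarrow> \<pi> R ` Hom SC R R2 = carrier (ab_ob M R)"
    and ker: "\<And>R. R \<in> S \<Longrightarrow> \<alpha> R ` Hom SC R R1 = a_kernel (HomG SC R R2) (ab_ob M R) (\<pi> R)"
    using ex by simp_all
  note ob = syzygy_ob[OF R(1)] syzygy_ob[OF R(2)]
  have "\<alpha> R1 (sq R1 R1 (Ident B R1)) \<in> Hom SC R1 R2"
    using nat_trans_from_hom_functor(1)[OF \<alpha> ob(1) R(1) ident_closed[OF ob(1)]] by (simp add: hom_functor_simps)
  then obtain f where f: "f \<in> Hom B R1 R2" "\<alpha> R1 (sq R1 R1 (Ident B R1)) = sq R1 R2 f" by (rule Hom_stableE)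
  have \<alpha>f: "\<alpha> R (sq R R1 \<sigma>) = sq R R2 (Comp B R R1 R2 f \<sigma>)" if R': "R \<in> S" and s: "\<sigma> \<in> Hom B R R1" for R \<sigma>
    using nat_trans_from_hom_functor(3)[OF \<alpha> ob(1) R(1) R' s ident_closed[OF ob(1)]] syzygy_ob[OF R'] ob f s
    by (simp add: hom_functor_simps Comp_stable comp_ident_left)
  show thesis
  proof (rule that[OF R f(1) \<pi>])
    show "\<exists>\<rho>\<in>Hom B R R2. v = \<pi> R (sq R R2 \<rho>)" if "R \<in> S" "v \<in> carrier (ab_ob M R)" for R v
      using surj[OF that(1)] that(2) by (auto simp: Hom_stable)
    fix R \<rho> assume R': "R \<in> S" and \<rho>: "\<rho> \<in> Hom B R R2"
    note Ro = syzygy_ob[OF R']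
    have "\<pi> R (sq R R2 \<rho>) = \<zero>\<^bsub>ab_ob M R\<^esub> \<longleftrightarrow> sq R R2 \<rho> \<in> a_kernel (HomG SC R R2) (ab_ob M R) (\<pi> R)"
      using \<rho> by (simp add: a_kernel_def' stable_mor_closed)
    also have "\<dots> \<longleftrightarrow> (\<exists>\<sigma>\<in>Hom B R R1. sq R R2 \<rho> = sq R R2 (Comp B R R1 R2 f \<sigma>))"
      unfolding ker[OF R', symmetric] Hom_stable using \<alpha>f[OF R'] by auto
    also have "\<dots> \<longleftrightarrow> (\<exists>\<sigma>\<in>Hom B R R1. st R R2 \<rho> (Comp B R R1 R2 f \<sigma>))"
      using stable_mor_eq_iff[OF Ro ob(2) \<rho>] comp_closed[OF Ro ob _ f(1)] by blast
    finally show "\<pi> R (sq R R2 \<rho>) = \<zero>\<^bsub>ab_ob M R\<^esub> \<longleftrightarrow> (\<exists>\<sigma>\<in>Hom B R R1. st R R2 \<rho> (Comp B R R1 R2 f \<sigma>))" .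
  qed
qed

text \<open>Needed for the functor to land in \<open>mod_cat\<close>. Enough injectives and
  contravariant finiteness enter here, through \<open>ex_stable_presentation\<close>.\<close>

lemma finitely_presented_hom_functor:
  assumes X: "X \<in> Ob B"
  shows "finitely_presented SS (F X)"
proof -
  obtain R1 R2 f a where R: "R1 \<in> S" "R2 \<in> S" and co: "stable_coker R1 R2 X f a"
    using ex_stable_presentation[OF X] by blast
  then have f: "f \<in> Hom B R1 R2" and a: "a \<in> Hom B R2 X" and epi: "stable_epi R2 X a"
    by (simp_all add: stable_coker_def)
  note ob = syzygy_ob[OF R(1)] syzygy_ob[OF R(2)]
  show ?thesis
  proof (rule finitely_presentedI[OF additive_hom_functor[OF X] R f on_hom_nat_trans[OF ob(2) X a]])
    fix R v assume R': "R \<in> S" and "v \<in> carrier (ab_ob (F X) R)"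
    then obtain \<phi> where \<phi>: "\<phi> \<in> Hom B R X" "v = sq R X \<phi>" by (auto simp: hom_functor_simps elim!: Hom_stableE)
    obtain \<rho> where "\<rho> \<in> Hom B R R2" "st R X \<phi> (Comp B R R2 X a \<rho>)" using stable_epiD[OF epi R' \<phi>(1)] by blast
    then show "\<exists>\<rho>\<in>Hom B R R2. v = on_hom (Hom_syzygies B T) R2 X a R (sq R R2 \<rho>)"
      using \<phi> R' syzygy_ob[OF R'] ob X a
      by (intro bexI[of _ \<rho>]) (simp_all add: Hom_syzygies_on_hom stable_mor_eq_iff comp_closed)
  next
    fix R \<rho> assume R': "R \<in> S" and \<rho>: "\<rho> \<in> Hom B R R2"
    have "on_hom (Hom_syzygies B T) R2 X a R (sq R R2 \<rho>) = \<zero>\<^bsub>ab_ob (F X) R\<^esub>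
        \<longleftrightarrow> st R X (Comp B R R2 X a \<rho>) (hzero B R X)"
      using R' \<rho> syzygy_ob[OF R'] ob X a
      by (simp add: Hom_syzygies_on_hom hom_functor_simps hzero_stable stable_mor_eq_iff comp_closed hzero_closed)
    then show "on_hom (Hom_syzygies B T) R2 X a R (sq R R2 \<rho>) = \<zero>\<^bsub>ab_ob (F X) R\<^esub>
        \<longleftrightarrow> (\<exists>\<sigma>\<in>Hom B R R1. st R R2 \<rho> (Comp B R R1 R2 f \<sigma>))"
      using co R' \<rho> by (simp add: stable_coker_def)
  qed
qed

lemma is_functor_Hom_syzygies: "is_functor B (mod_cat SS) (Hom_syzygies B T)"
proof -
  have on_ob: "on_ob (Hom_syzygies B T) = F" by (simp add: Hom_syzygies_def)
  show ?thesis
    unfolding is_functor_def on_ob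
  proof (intro conjI ballI)
    fix X assume X: "X \<in> Ob B"
    show "F X \<in> Ob (mod_cat SS)" using finitely_presented_hom_functor[OF X] by (simp add: mod_cat_def)
    show "on_hom (Hom_syzygies B T) X X (Ident B X) = Ident (mod_cat SS) (F X)"
    proof (intro extensionalityI[where A = S])
      show "on_hom (Hom_syzygies B T) X X (Ident B X) \<in> extensional S" by (simp add: Hom_syzygies_def)
      show "Ident (mod_cat SS) (F X) \<in> extensional S" by (simp add: mod_cat_def stable_syzygies_simps)
      fix R assume R: "R \<in> S"
      show "on_hom (Hom_syzygies B T) X X (Ident B X) R = Ident (mod_cat SS) (F X) R"
      proof (rule extensionalityI[where A = "Hom SC R X"])
        fix x assume "x \<in> Hom SC R X"
        then show "on_hom (Hom_syzygies B T) X X (Ident B X) R x = Ident (mod_cat SS) (F X) R x"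
          using R X syzygy_ob[OF R] by (auto simp: Hom_syzygies_on_hom mod_cat_def stable_syzygies_simps
            hom_functor_simps ident_closed comp_ident_left stable_mor_closed elim!: Hom_stableE)
      qed (use R in \<open>simp_all add: Hom_syzygies_def mod_cat_def stable_syzygies_simps hom_functor_simps\<close>)
    qed
    fix Y assume Y: "Y \<in> Ob B"
    show "on_hom (Hom_syzygies B T) X Y f \<in> Hom (mod_cat SS) (F X) (F Y)" if "f \<in> Hom B X Y" for f
      using on_hom_nat_trans[OF X Y that] by (simp add: mod_cat_def)
    fix Z f g assume Z: "Z \<in> Ob B" and f: "f \<in> Hom B X Y" and g: "g \<in> Hom B Y Z"
    show "on_hom (Hom_syzygies B T) X Z (Comp B X Y Z g f) = Comp (mod_cat SS) (F X) (F Y) (F Z)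
        (on_hom (Hom_syzygies B T) Y Z g) (on_hom (Hom_syzygies B T) X Y f)" (is "?l = ?r")
    proof (intro extensionalityI[where A = S])
      show "?l \<in> extensional S" by (simp add: Hom_syzygies_def)
      show "?r \<in> extensional S" by (simp add: mod_cat_def stable_syzygies_simps)
      fix R assume R: "R \<in> S"
      show "?l R = ?r R"
      proof (rule extensionalityI[where A = "Hom SC R X"])
        fix x assume "x \<in> Hom SC R X"
        then show "?l R x = ?r R x"
          using R X Y Z f g syzygy_ob[OF R] by (auto simp: Hom_syzygies_on_hom mod_cat_def stable_syzygies_simps
            hom_functor_simps comp_closed comp_assoc stable_mor_closed elim!: Hom_stableE)
      qed (use R in \<open>simp_all add: Hom_syzygies_def mod_cat_def stable_syzygies_simps hom_functor_simps\<close>)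
    qed
  qed
qed

text \<open>The pointwise inverse is additive and natural because both sides agree after applying
  the injective \<eta>.\<close>

lemma is_iso_mod_cat:
  assumes M: "additive_ab_functor SS M" and N: "additive_ab_functor SS N" and \<eta>: "\<eta> \<in> nat_trans SS M N"
    and bij: "\<And>R. R \<in> S \<Longrightarrow> bij_betw (\<eta> R) (carrier (ab_ob M R)) (carrier (ab_ob N R))"
  shows "is_iso (mod_cat SS) M N \<eta>"
proof -
  define \<theta> where "\<theta> = (\<lambda>R\<in>S. \<lambda>v\<in>carrier (ab_ob N R). inv_into (carrier (ab_ob M R)) (\<eta> R) v)"
  have \<theta>: "\<theta> R v \<in> carrier (ab_ob M R)" "\<eta> R (\<theta> R v) = v" if "R \<in> S" "v \<in> carrier (ab_ob N R)" for R v
    using that bij_betw_inv_into_right[OF bij[OF that(1)] that(2)] bij_betw_apply[OF bij_betw_inv_into[OF bij[OF that(1)]]]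
    by (simp_all add: \<theta>_def)
  have \<theta>\<eta>: "\<theta> R (\<eta> R v) = v" if "R \<in> S" "v \<in> carrier (ab_ob M R)" for R v
    using that bij_betw_inv_into_left[OF bij[OF that(1)] that(2)] nat_transD(2)[OF \<eta>] by (simp add: \<theta>_def)
  have inj: "v = w" if "R \<in> S" "v \<in> carrier (ab_ob M R)" "w \<in> carrier (ab_ob M R)" "\<eta> R v = \<eta> R w" for R v w
    using that \<theta>\<eta> by metis
  have "\<theta> \<in> nat_trans SS N M"
    unfolding nat_trans_def stable_syzygies_simps
  proof (intro CollectI conjI ballI)
    show "\<theta> \<in> extensional S" by (simp add: \<theta>_def)
    fix R assume R: "R \<in> S"
    show "\<theta> R \<in> extensional (carrier (ab_ob N R))" using R by (simp add: \<theta>_def)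
    interpret MR: abelian_group "ab_ob M R" using additiveD(1)[OF M R] .
    interpret NR: abelian_group "ab_ob N R" using additiveD(1)[OF N R] .
    show "abelian_group_hom (ab_ob N R) (ab_ob M R) (\<theta> R)"
    proof (rule abelian_group_hom_if_additive[OF additiveD(1)[OF N R] additiveD(1)[OF M R]])
      fix x y assume xy: "x \<in> carrier (ab_ob N R)" "y \<in> carrier (ab_ob N R)"
      note tx = \<theta>[OF R xy(1)] and ty = \<theta>[OF R xy(2)] and txy = \<theta>[OF R NR.a_closed[OF xy]]
      have "\<eta> R (\<theta> R x \<oplus>\<^bsub>ab_ob M R\<^esub> \<theta> R y) = x \<oplus>\<^bsub>ab_ob N R\<^esub> y"
        using nat_transD(3)[OF \<eta> R tx(1) ty(1)] tx(2) ty(2) by simp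
      then show "\<theta> R (x \<oplus>\<^bsub>ab_ob N R\<^esub> y) = \<theta> R x \<oplus>\<^bsub>ab_ob M R\<^esub> \<theta> R y"
        using inj[OF R txy(1) MR.a_closed[OF tx(1) ty(1)]] txy(2) by simp
    qed (use \<theta>[OF R] in simp)
    fix R' r v assume R': "R' \<in> S" and r: "r \<in> Hom SC R R'" and v: "v \<in> carrier (ab_ob N R')"
    interpret hM: abelian_group_hom "ab_ob M R'" "ab_ob M R" "ab_hom M R R' r" using additiveD(2)[OF M R' R r] .
    interpret hN: abelian_group_hom "ab_ob N R'" "ab_ob N R" "ab_hom N R R' r" using additiveD(2)[OF N R' R r] .
    have "\<eta> R (ab_hom M R R' r (\<theta> R' v)) = ab_hom N R R' r v"
      using nat_transD(5)[OF \<eta> R' R r \<theta>(1)[OF R' v]] \<theta>(2)[OF R' v] by simp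
    then show "\<theta> R (ab_hom N R R' r v) = ab_hom M R R' r (\<theta> R' v)"
      using inj[OF R \<theta>(1)[OF R hN.hom_closed[OF v]] hM.hom_closed[OF \<theta>(1)[OF R' v]]]
        \<theta>(2)[OF R hN.hom_closed[OF v]] by simp
  qed
  moreover have "Comp (mod_cat SS) M N M \<theta> \<eta> = Ident (mod_cat SS) M"
    using \<theta>\<eta> by (auto simp: mod_cat_def stable_syzygies_simps fun_eq_iff restrict_def)
  moreover have "Comp (mod_cat SS) N M N \<eta> \<theta> = Ident (mod_cat SS) N"
    using \<theta>(2) by (auto simp: mod_cat_def stable_syzygies_simps fun_eq_iff restrict_def)
  ultimately show ?thesis using \<eta> unfolding is_iso_def by (auto simp: mod_cat_def)
qed

text \<open>M and F X are cokernels of the same map F f. The isomorphism sends an element of F X to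
  the value of \<pi> at any preimage under c.\<close>

lemma dense_functor_if_stable_cokers:
  assumes dense: "\<And>R1 R2 f. \<lbrakk>R1 \<in> S; R2 \<in> S; f \<in> Hom B R1 R2\<rbrakk> \<Longrightarrow> \<exists>X c. stable_coker R1 R2 X f c"
  shows "dense_functor B (mod_cat SS) (Hom_syzygies B T)"
  unfolding dense_functor_def
proof (intro ballI)
  fix M assume "M \<in> Ob (mod_cat SS)"
  then have fp: "finitely_presented SS M" by (simp add: mod_cat_def)
  then have M: "additive_ab_functor SS M" by (simp add: finitely_presented_def)
  obtain R1 R2 f \<pi> where R12: "R1 \<in> S" "R2 \<in> S" "f \<in> Hom B R1 R2" and \<pi>: "\<pi> \<in> nat_trans SS (F R2) M"
    and surj: "\<And>R v. \<lbrakk>R \<in> S; v \<in> carrier (ab_ob M R)\<rbrakk> \<Longrightarrow> \<exists>\<rho>\<in>Hom B R R2. v = \<pi> R (sq R R2 \<rho>)"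
    and ker: "\<And>R \<rho>. \<lbrakk>R \<in> S; \<rho> \<in> Hom B R R2\<rbrakk> \<Longrightarrow>
      \<pi> R (sq R R2 \<rho>) = \<zero>\<^bsub>ab_ob M R\<^esub> \<longleftrightarrow> (\<exists>\<sigma>\<in>Hom B R R1. st R R2 \<rho> (Comp B R R1 R2 f \<sigma>))"
    using finitely_presentedE[OF fp] by blast
  obtain X c where co: "stable_coker R1 R2 X f c" using dense[OF R12] by blast
  then have X: "X \<in> Ob B" and c: "c \<in> Hom B R2 X" and epi: "stable_epi R2 X c"
    by (simp_all add: stable_coker_def)
  note R2o = syzygy_ob[OF R12(2)]
  note H = nat_trans_from_hom_functor[OF \<pi> R2o]
  \<comment> \<open>c and \<pi> have the same kernel, the image of f, so they identify the same
    pairs. This gives both well-definedness and injectivity.\<close>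
  have eq_iff: "st R X (Comp B R R2 X c \<rho>) (Comp B R R2 X c \<rho>') \<longleftrightarrow> \<pi> R (sq R R2 \<rho>) = \<pi> R (sq R R2 \<rho>')"
    if R: "R \<in> S" and \<rho>: "\<rho> \<in> Hom B R R2" "\<rho>' \<in> Hom B R R2" for R \<rho> \<rho>'
  proof -
    note Ro = syzygy_ob[OF R]
    interpret MR: abelian_group "ab_ob M R" using additiveD(1)[OF M R] .
    let ?d = "hadd B R R2 \<rho> (hneg B R R2 \<rho>')"
    have d: "?d \<in> Hom B R R2" using Ro R2o \<rho> by (simp add: hom_closed)
    have "hadd B R R2 ?d \<rho>' = \<rho>" using Ro R2o \<rho> by (simp add: hom_simps hadd_assoc)
    then have add: "\<pi> R (sq R R2 \<rho>) = \<pi> R (sq R R2 ?d) \<oplus>\<^bsub>ab_ob M R\<^esub> \<pi> R (sq R R2 \<rho>')"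
      using H(2)[OF R d \<rho>(2)] by simp
    note cl = H(1)[OF R d] H(1)[OF R \<rho>(2)]
    have "\<pi> R (sq R R2 \<rho>) = \<pi> R (sq R R2 \<rho>') \<longleftrightarrow> \<pi> R (sq R R2 ?d) = \<zero>\<^bsub>ab_ob M R\<^esub>"
      unfolding add using cl by (metis MR.a_assoc MR.a_inv_closed MR.r_neg MR.r_zero MR.l_zero)
    also have "\<dots> \<longleftrightarrow> st R X (Comp B R R2 X c ?d) (hzero B R X)"
      using ker[OF R d] co R d by (simp add: stable_coker_def)
    also have "Comp B R R2 X c ?d = hadd B R X (Comp B R R2 X c \<rho>) (hneg B R X (Comp B R R2 X c \<rho>'))"
      using Ro R2o X c \<rho> by (simp add: comp_add_right comp_neg_right hneg_closed)
    also have "st R X \<dots> (hzero B R X) \<longleftrightarrow> st R X (Comp B R R2 X c \<rho>) (Comp B R R2 X c \<rho>')"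
      using st_diff_zero st_if_diff_zero comp_closed[OF Ro R2o X _ c] \<rho> by blast
    finally show ?thesis by simp
  qed
  define \<psi> where "\<psi> R \<phi> = (SOME \<rho>. \<rho> \<in> Hom B R R2 \<and> st R X \<phi> (Comp B R R2 X c \<rho>))" for R \<phi>
  have \<psi>: "\<psi> R \<phi> \<in> Hom B R R2" "st R X \<phi> (Comp B R R2 X c (\<psi> R \<phi>))" if "R \<in> S" "\<phi> \<in> Hom B R X" for R \<phi>
    using someI_ex[of "\<lambda>\<rho>. \<rho> \<in> Hom B R R2 \<and> st R X \<phi> (Comp B R R2 X c \<rho>)"] stable_epiD[OF epi that]
    unfolding \<psi>_def by blast+
  have key: "\<pi> R (sq R R2 (\<psi> R \<phi>)) = \<pi> R (sq R R2 \<rho>)"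
    if R: "R \<in> S" and \<rho>: "\<rho> \<in> Hom B R R2" and e: "st R X \<phi> (Comp B R R2 X c \<rho>)" for R \<phi> \<rho>
    using eq_iff[OF R \<psi>(1)[OF R stD(3)[OF e]] \<rho>] st_trans[OF st_sym[OF \<psi>(2)[OF R stD(3)[OF e]]] e] by simp
  have "\<exists>\<eta>\<in>nat_trans SS (F X) M. \<forall>R\<in>S. \<forall>\<phi>\<in>Hom B R X. \<eta> R (sq R X \<phi>) = \<pi> R (sq R R2 (\<psi> R \<phi>))"
  proof (rule nat_trans_if_family[OF X])
    fix R assume R: "R \<in> S"
    note Ro = syzygy_ob[OF R]
    show "abelian_group (ab_ob M R)" using additiveD(1)[OF M R] .
    show "\<pi> R (sq R R2 (\<psi> R \<phi>)) \<in> carrier (ab_ob M R)" if "\<phi> \<in> Hom B R X" for \<phi>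
      using H(1)[OF R \<psi>(1)[OF R that]] .
    show "\<pi> R (sq R R2 (\<psi> R \<phi>)) = \<pi> R (sq R R2 (\<psi> R \<phi>'))" if e: "st R X \<phi> \<phi>'" for \<phi> \<phi>'
      using key[OF R \<psi>(1)[OF R stD(4)[OF e]] st_trans[OF e \<psi>(2)[OF R stD(4)[OF e]]]] .
    show "\<pi> R (sq R R2 (\<psi> R (hadd B R X \<phi> \<phi>')))
        = \<pi> R (sq R R2 (\<psi> R \<phi>)) \<oplus>\<^bsub>ab_ob M R\<^esub> \<pi> R (sq R R2 (\<psi> R \<phi>'))"
      if f: "\<phi> \<in> Hom B R X" "\<phi>' \<in> Hom B R X" for \<phi> \<phi>'
    proof -
      note p = \<psi>[OF R f(1)] \<psi>[OF R f(2)]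
      have "st R X (hadd B R X \<phi> \<phi>') (Comp B R R2 X c (hadd B R R2 (\<psi> R \<phi>) (\<psi> R \<phi>')))"
        using st_add[OF p(2,4)] Ro R2o X c p(1,3) by (simp add: comp_add_right)
      from key[OF R _ this] show ?thesis using H(2)[OF R p(1,3)] Ro R2o p(1,3) by (simp add: hadd_closed)
    qed
    show "\<pi> R' (sq R' R2 (\<psi> R' (Comp B R' R X \<phi> r))) = ab_hom M R' R (sq R' R r) (\<pi> R (sq R R2 (\<psi> R \<phi>)))"
      if R': "R' \<in> S" and r: "r \<in> Hom B R' R" and \<phi>: "\<phi> \<in> Hom B R X" for R' r \<phi>
    proof -
      note Ro' = syzygy_ob[OF R'] and p = \<psi>[OF R \<phi>]
      have "st R' X (Comp B R' R X \<phi> r) (Comp B R' R2 X c (Comp B R' R R2 (\<psi> R \<phi>) r))"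
        using st_comp_right[OF p(2) r Ro'] Ro Ro' R2o X c p(1) r by (simp add: comp_assoc)
      from key[OF R' _ this] show ?thesis using H(3)[OF R R' r p(1)] Ro Ro' R2o p(1) r by (simp add: comp_closed)
    qed
  qed
  then obtain \<eta> where \<eta>: "\<eta> \<in> nat_trans SS (F X) M"
    "\<And>R \<phi>. \<lbrakk>R \<in> S; \<phi> \<in> Hom B R X\<rbrakk> \<Longrightarrow> \<eta> R (sq R X \<phi>) = \<pi> R (sq R R2 (\<psi> R \<phi>))" by blast
  have "is_iso (mod_cat SS) (F X) M \<eta>"
  proof (rule is_iso_mod_cat[OF additive_hom_functor[OF X] M \<eta>(1)])
    fix R assume R: "R \<in> S"
    note Ro = syzygy_ob[OF R]
    show "bij_betw (\<eta> R) (carrier (ab_ob (F X) R)) (carrier (ab_ob M R))"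
    proof (rule bij_betw_imageI)
      show "inj_on (\<eta> R) (carrier (ab_ob (F X) R))"
      proof (rule inj_onI)
        fix x y assume "x \<in> carrier (ab_ob (F X) R)" "y \<in> carrier (ab_ob (F X) R)" and e: "\<eta> R x = \<eta> R y"
        then obtain \<phi> \<phi>' where p: "\<phi> \<in> Hom B R X" "x = sq R X \<phi>" "\<phi>' \<in> Hom B R X" "y = sq R X \<phi>'"
          by (auto simp: hom_functor_simps elim!: Hom_stableE)
        note q = \<psi>[OF R p(1)] \<psi>[OF R p(3)]
        have "\<pi> R (sq R R2 (\<psi> R \<phi>)) = \<pi> R (sq R R2 (\<psi> R \<phi>'))" using e \<eta>(2)[OF R] p by simp
        then have "st R X (Comp B R R2 X c (\<psi> R \<phi>)) (Comp B R R2 X c (\<psi> R \<phi>'))" using eq_iff[OF R q(1,3)] by simp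
        from st_trans[OF q(2) st_trans[OF this st_sym[OF q(4)]]] have "st R X \<phi> \<phi>'" .
        then show "x = y" using p stable_mor_eq_iff[OF Ro X] by simp
      qed
      have "\<exists>\<phi>\<in>Hom B R X. v = \<eta> R (sq R X \<phi>)" if v: "v \<in> carrier (ab_ob M R)" for v
      proof -
        obtain \<rho> where \<rho>: "\<rho> \<in> Hom B R R2" "v = \<pi> R (sq R R2 \<rho>)" using surj[OF R v] by blast
        have cr: "Comp B R R2 X c \<rho> \<in> Hom B R X" using Ro R2o X c \<rho> by (simp add: comp_closed)
        then show ?thesis using \<eta>(2)[OF R cr] key[OF R \<rho>(1) st_refl[OF Ro X cr]] \<rho>(2) by metis
      qed
      then show "\<eta> R ` carrier (ab_ob (F X) R) = carrier (ab_ob M R)"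
        using nat_transD(2)[OF \<eta>(1) R] unfolding hom_functor_simps HomG_simps Hom_stable by blast
    qed
  qed
  then show "\<exists>X\<in>Ob B. isomorphic (mod_cat SS) (on_ob (Hom_syzygies B T) X) M"
    using X by (auto simp: isomorphic_def Hom_syzygies_def)
qed

text \<open>The values of a finitely presented functor must live in the type of stable morphisms, so the
  cokernel of \<open>f\<close> is realised as the image of \<open>Hom(-,g)\<close> inside \<open>Hom(-,A)\<close>.\<close>

definition image_functor :: "'o \<Rightarrow> 'o \<Rightarrow> 'm \<Rightarrow> ('o, 'm set, 'm set) ab_functor" where
  "image_functor Y A k = \<lparr>
     ab_ob = (\<lambda>R. (HomG SC R A)\<lparr>carrier := {sq R A (Comp B R Y A k \<rho>) |\<rho>. \<rho> \<in> Hom B R Y}\<rparr>),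
     ab_hom = ab_hom (F A)\<rparr>"

lemma image_functor_simps:
  "carrier (ab_ob (image_functor Y A k) R) = {sq R A (Comp B R Y A k \<rho>) |\<rho>. \<rho> \<in> Hom B R Y}"
  "x \<oplus>\<^bsub>ab_ob (image_functor Y A k) R\<^esub> y = hadd SC R A x y"
  "\<zero>\<^bsub>ab_ob (image_functor Y A k) R\<^esub> = hzero SC R A"
  "ab_hom (image_functor Y A k) R' R r \<phi> = Comp SC R' R A \<phi> r"
  by (simp_all add: image_functor_def hom_functor_simps HomG_def)

text \<open>The image is closed under sums, negatives and restriction; the functor laws are
  inherited from F A.\<close>

lemma additive_image_functor:
  assumes ob: "Y \<in> Ob B" "A \<in> Ob B" and k: "k \<in> Hom B Y A"
  shows "additive_ab_functor SS (image_functor Y A k)"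
proof -
  note A = additive_hom_functor[OF ob(2), unfolded additive_ab_functor_def stable_syzygies_simps hom_functor_simps]
  have sub: "v \<in> Hom SC R A" if "R \<in> S" "v \<in> carrier (ab_ob (image_functor Y A k) R)" for R v
    using that ob k syzygy_ob[OF that(1)] by (auto simp: image_functor_simps stable_mor_closed comp_closed)
  have add: "hadd SC R A v w \<in> carrier (ab_ob (image_functor Y A k) R)"
    if R: "R \<in> S" and vw: "v \<in> carrier (ab_ob (image_functor Y A k) R)" "w \<in> carrier (ab_ob (image_functor Y A k) R)"
    for R v w
  proof -
    note Ro = syzygy_ob[OF R]
    obtain \<rho> \<sigma> where "\<rho> \<in> Hom B R Y" "v = sq R A (Comp B R Y A k \<rho>)" "\<sigma> \<in> Hom B R Y" "w = sq R A (Comp B R Y A k \<sigma>)"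
      using vw by (auto simp: image_functor_simps)
    then have "hadd SC R A v w = sq R A (Comp B R Y A k (hadd B R Y \<rho> \<sigma>))" "hadd B R Y \<rho> \<sigma> \<in> Hom B R Y"
      using Ro ob k by (simp_all add: hadd_stable comp_closed comp_add_right hadd_closed)
    then show ?thesis by (auto simp: image_functor_simps)
  qed
  have G: "abelian_group (ab_ob (image_functor Y A k) R)" if R: "R \<in> S" for R
  proof -
    note Ro = syzygy_ob[OF R]
    interpret h: abelian_group "HomG SC R A" using abelian_group_Hom_stable[OF Ro ob(2)] .
    show ?thesis
    proof (rule abelian_groupI; (unfold image_functor_simps(2,3))?)
      show "hzero SC R A \<in> carrier (ab_ob (image_functor Y A k) R)"
        using Ro ob k comp_zero_right[OF Ro ob k] hzero_closed[OF Ro ob(1)]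
        unfolding image_functor_simps hzero_stable by (intro CollectI exI[of _ "hzero B R Y"]) simp
      fix v assume v: "v \<in> carrier (ab_ob (image_functor Y A k) R)"
      note v' = sub[OF R v]
      show "hadd SC R A (hzero SC R A) v = v" using h.l_zero v' by simp
      obtain \<rho> where \<rho>: "\<rho> \<in> Hom B R Y" "v = sq R A (Comp B R Y A k \<rho>)" using v by (auto simp: image_functor_simps)
      show "\<exists>w\<in>carrier (ab_ob (image_functor Y A k) R). hadd SC R A w v = hzero SC R A"
      proof (rule bexI[of _ "sq R A (Comp B R Y A k (hneg B R Y \<rho>))"])
        show "hadd SC R A (sq R A (Comp B R Y A k (hneg B R Y \<rho>))) v = hzero SC R A"
          using \<rho> Ro ob k
          by (simp add: hadd_stable comp_neg_right comp_closed hneg_closed hadd_neg_left hzero_stable)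
        show "sq R A (Comp B R Y A k (hneg B R Y \<rho>)) \<in> carrier (ab_ob (image_functor Y A k) R)"
          using \<rho> Ro ob by (auto simp: image_functor_simps hneg_closed)
      qed
      fix w assume w: "w \<in> carrier (ab_ob (image_functor Y A k) R)"
      show "hadd SC R A v w \<in> carrier (ab_ob (image_functor Y A k) R)" using add[OF R v w] .
      show "hadd SC R A v w = hadd SC R A w v" using h.a_comm v' sub[OF R w] by simp
      fix x assume "x \<in> carrier (ab_ob (image_functor Y A k) R)"
      then show "hadd SC R A (hadd SC R A v w) x = hadd SC R A v (hadd SC R A w x)"
        using h.a_assoc v' sub[OF R w] sub[OF R] by simp
    qed
  qed
  have cl: "Comp SC R R' A v r \<in> carrier (ab_ob (image_functor Y A k) R)"
    if R: "R \<in> S" "R' \<in> S" and r: "r \<in> Hom SC R R'" and v: "v \<in> carrier (ab_ob (image_functor Y A k) R')" for R R' r v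
  proof -
    note Ro = syzygy_ob[OF R(1)] syzygy_ob[OF R(2)]
    obtain r0 where "r0 \<in> Hom B R R'" "r = sq R R' r0" using r by (rule Hom_stableE)
    moreover obtain \<rho> where "\<rho> \<in> Hom B R' Y" "v = sq R' A (Comp B R' Y A k \<rho>)" using v by (auto simp: image_functor_simps)
    ultimately have "Comp SC R R' A v r = sq R A (Comp B R Y A k (Comp B R R' Y \<rho> r0))" "Comp B R R' Y \<rho> r0 \<in> Hom B R Y"
      using Ro ob k by (simp_all add: Comp_stable comp_closed comp_assoc)
    then show ?thesis by (auto simp: image_functor_simps)
  qed
  show ?thesis
    unfolding additive_ab_functor_def stable_syzygies_simps image_functor_simps(4)
  proof (intro conjI ballI)
    show "abelian_group (ab_ob (image_functor Y A k) R)" if "R \<in> S" for R using G[OF that] .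
    show "abelian_group_hom (ab_ob (image_functor Y A k) R') (ab_ob (image_functor Y A k) R) (\<lambda>\<phi>. Comp SC R R' A \<phi> r)"
      if R: "R \<in> S" "R' \<in> S" and r: "r \<in> Hom SC R R'" for R R' r
    proof (rule abelian_group_hom_if_additive[OF G[OF R(2)] G[OF R(1)]]; (unfold image_functor_simps(2))?)
      interpret h: abelian_group_hom "HomG SC R' A" "HomG SC R A" "\<lambda>\<phi>. Comp SC R R' A \<phi> r" using A R r by blast
      fix x assume x: "x \<in> carrier (ab_ob (image_functor Y A k) R')"
      show "Comp SC R R' A x r \<in> carrier (ab_ob (image_functor Y A k) R)" using cl[OF R r x] .
      fix y assume y: "y \<in> carrier (ab_ob (image_functor Y A k) R')"
      show "Comp SC R R' A (hadd SC R' A x y) r = hadd SC R A (Comp SC R R' A x r) (Comp SC R R' A y r)"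
        using h.hom_add sub[OF R(2) x] sub[OF R(2) y] by simp
    qed
    show "Comp SC R R A v (Ident SC R) = v" if "R \<in> S" "v \<in> carrier (ab_ob (image_functor Y A k) R)" for R v
      using A sub[OF that] that(1) by simp
    show "Comp SC R R'' A v (Comp SC R R' R'' s r) = Comp SC R R' A (Comp SC R' R'' A v s) r"
      if "R \<in> S" "R' \<in> S" "R'' \<in> S" "r \<in> Hom SC R R'" "s \<in> Hom SC R' R''" "v \<in> carrier (ab_ob (image_functor Y A k) R'')"
      for R R' R'' r s v
      using A sub[OF that(3,6)] that(1-5) by simp
    show "Comp SC R R' A v (hadd SC R R' r s)
        = Comp SC R R' A v r \<oplus>\<^bsub>ab_ob (image_functor Y A k) R\<^esub> Comp SC R R' A v s"
      if "R \<in> S" "R' \<in> S" "r \<in> Hom SC R R'" "s \<in> Hom SC R R'" "v \<in> carrier (ab_ob (image_functor Y A k) R')"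
      for R R' r s v
      using A sub[OF that(2,5)] that(1-4) by (simp add: image_functor_simps)
  qed
qed

text \<open>For k = g i the kernel of F k is the image of F f, so the image of F k is a cokernel of
  F f with values in the right type. Density replaces it by some F X.\<close>

lemma stable_coker_if_dense_functor:
  assumes dense: "dense_functor B (mod_cat SS) (Hom_syzygies B T)"
    and R12: "R1 \<in> S" "R2 \<in> S" and f: "f \<in> Hom B R1 R2"
  shows "\<exists>X c. stable_coker R1 R2 X f c"
proof -
  note ob = syzygy_ob[OF R12(1)] syzygy_ob[OF R12(2)]
  obtain R2' A P T1 T2 f' g u p q v h t i \<pi> \<delta>
    where dg: "syzygy_diagram B T R1 R2' A P T1 T2 f' g u p q v h t"
      and i: "i \<in> Hom B R2 R2'" "\<pi> \<in> Hom B R2' R2" "Comp B R2 R2' R2 \<pi> i = Ident B R2"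
        "st R2' R2' (Comp B R2' R2 R2' i \<pi>) (Ident B R2')" "Comp B R1 R2' R2 \<pi> f' = f"
      and r: "realizes B R1 R2' A f' g (pull B A T1 R1 h \<delta>)"
    using ex_diagram[OF R12 f] by blast
  note D = syzygy_diagramD[OF dg]
  let ?k = "Comp B R2 R2' A g i"
  have k: "?k \<in> Hom B R2 A" using D(13,18) ob syzygy_ob[OF D(11)] i by (simp add: comp_closed)
  have ker: "st R A (Comp B R R2 A ?k \<rho>) (hzero B R A) \<longleftrightarrow> (\<exists>\<sigma>\<in>Hom B R R1. st R R2 \<rho> (Comp B R R1 R2 f \<sigma>))"
    if "R \<in> S" "\<rho> \<in> Hom B R R2" for R \<rho>
    using stable_kernel_of_retract[OF r ob(2) i syzygy_ob[OF that(1)] that(2)] .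
  let ?M = "image_functor R2 A ?k"
  have M: "additive_ab_functor SS ?M" using additive_image_functor[OF ob(2) D(13) k] .
  have "\<exists>\<kappa>\<in>nat_trans SS (F R2) ?M. \<forall>R\<in>S. \<forall>\<rho>\<in>Hom B R R2. \<kappa> R (sq R R2 \<rho>) = sq R A (Comp B R R2 A ?k \<rho>)"
  proof (rule nat_trans_if_family[OF ob(2)]; (unfold image_functor_simps(2-4))?)
    fix R assume R: "R \<in> S"
    note Ro = syzygy_ob[OF R]
    show "abelian_group (ab_ob ?M R)" using additiveD(1)[OF M R] .
    show "sq R A (Comp B R R2 A ?k \<rho>) \<in> carrier (ab_ob ?M R)" if "\<rho> \<in> Hom B R R2" for \<rho>
      using that by (auto simp: image_functor_simps)
    show "sq R A (Comp B R R2 A ?k \<rho>) = sq R A (Comp B R R2 A ?k \<rho>')" if "st R R2 \<rho> \<rho>'" for \<rho> \<rho>'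
      using st_comp_left[OF that k D(13)] stD[OF that] D(13) k by (simp add: stable_mor_eq_iff comp_closed)
    show "sq R A (Comp B R R2 A ?k (hadd B R R2 \<rho> \<rho>'))
        = hadd SC R A (sq R A (Comp B R R2 A ?k \<rho>)) (sq R A (Comp B R R2 A ?k \<rho>'))"
      if "\<rho> \<in> Hom B R R2" "\<rho>' \<in> Hom B R R2" for \<rho> \<rho>'
      using that Ro ob D(13) k by (simp add: hadd_stable comp_closed comp_add_right)
    show "sq R' A (Comp B R' R2 A ?k (Comp B R' R R2 \<rho> r)) = Comp SC R' R A (sq R A (Comp B R R2 A ?k \<rho>)) (sq R' R r)"
      if "R' \<in> S" "r \<in> Hom B R' R" "\<rho> \<in> Hom B R R2" for R' r \<rho>
      using that Ro syzygy_ob[OF that(1)] ob D(13) k by (simp add: Comp_stable comp_closed comp_assoc)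
  qed
  then obtain \<kappa> where \<kappa>: "\<kappa> \<in> nat_trans SS (F R2) ?M"
    "\<And>R \<rho>. \<lbrakk>R \<in> S; \<rho> \<in> Hom B R R2\<rbrakk> \<Longrightarrow> \<kappa> R (sq R R2 \<rho>) = sq R A (Comp B R R2 A ?k \<rho>)" by blast
  have zero_iff: "sq R A (Comp B R R2 A ?k \<rho>) = hzero SC R A \<longleftrightarrow> st R A (Comp B R R2 A ?k \<rho>) (hzero B R A)"
    if "R \<in> S" "\<rho> \<in> Hom B R R2" for R \<rho>
    using that syzygy_ob[OF that(1)] ob D(13) k by (simp add: hzero_stable stable_mor_eq_iff comp_closed hzero_closed)
  have "finitely_presented SS ?M"
    by (rule finitely_presentedI[OF M R12 f \<kappa>(1)])
      (auto simp: \<kappa>(2) image_functor_simps zero_iff ker)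
  then have "?M \<in> Ob (mod_cat SS)" by (simp add: mod_cat_def)
  then obtain X where X: "X \<in> Ob B" and "isomorphic (mod_cat SS) (F X) ?M"
    using dense unfolding dense_functor_def by (auto simp: Hom_syzygies_def)
  then obtain \<theta> \<theta>' where \<theta>: "\<theta> \<in> nat_trans SS (F X) ?M" "\<theta>' \<in> nat_trans SS ?M (F X)"
    and inv: "Comp (mod_cat SS) (F X) ?M (F X) \<theta>' \<theta> = Ident (mod_cat SS) (F X)"
      "Comp (mod_cat SS) ?M (F X) ?M \<theta> \<theta>' = Ident (mod_cat SS) ?M"
    unfolding isomorphic_def is_iso_def by (auto simp: mod_cat_def)
  have \<theta>'\<theta>: "\<theta>' R (\<theta> R v) = v" if "R \<in> S" "v \<in> carrier (ab_ob (F X) R)" for R v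
    using fun_cong[OF fun_cong[OF inv(1), of R], of v] that by (simp add: mod_cat_def stable_syzygies_simps)
  have \<theta>\<theta>': "\<theta> R (\<theta>' R v) = v" if "R \<in> S" "v \<in> carrier (ab_ob ?M R)" for R v
    using fun_cong[OF fun_cong[OF inv(2), of R], of v] that by (simp add: mod_cat_def stable_syzygies_simps)
  have kM: "sq R A (Comp B R R2 A ?k \<rho>) \<in> carrier (ab_ob ?M R)" if "\<rho> \<in> Hom B R R2" for R \<rho>
    using that by (auto simp: image_functor_simps)
  have kM1: "sq R2 A ?k \<in> carrier (ab_ob ?M R2)"
    using kM[OF ident_closed[OF ob(2)]] ob D(13) k by (simp add: comp_ident_right)
  \<comment> \<open>k generates the image functor, so its value under the isomorphism with F X
    determines the cokernel map c.\<close>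
  have "\<theta>' R2 (sq R2 A ?k) \<in> Hom SC R2 X"
    using nat_transD(2)[OF \<theta>(2) R12(2) kM1] by (simp add: hom_functor_simps)
  then obtain c where c: "c \<in> Hom B R2 X" "\<theta>' R2 (sq R2 A ?k) = sq R2 X c" by (rule Hom_stableE)
  have \<theta>'k: "\<theta>' R (sq R A (Comp B R R2 A ?k \<rho>)) = sq R X (Comp B R R2 X c \<rho>)"
    if R: "R \<in> S" and \<rho>: "\<rho> \<in> Hom B R R2" for R \<rho>
    using nat_transD(5)[OF \<theta>(2) R12(2) R stable_mor_closed[OF \<rho>] kM1] \<rho> syzygy_ob[OF R] ob D(13) k X c
    by (simp add: image_functor_simps hom_functor_simps Comp_stable)
  have "stable_coker R1 R2 X f c"
    unfolding stable_coker_def stable_epi_def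
  proof (intro conjI f c(1) X ballI)
    fix R \<phi> assume R: "R \<in> S" and \<phi>: "\<phi> \<in> Hom B R X"
    have s: "sq R X \<phi> \<in> carrier (ab_ob (F X) R)" using \<phi> by (simp add: hom_functor_simps stable_mor_closed)
    obtain \<rho> where \<rho>: "\<rho> \<in> Hom B R R2" "\<theta> R (sq R X \<phi>) = sq R A (Comp B R R2 A ?k \<rho>)"
      using nat_transD(2)[OF \<theta>(1) R s] by (auto simp: image_functor_simps)
    have "sq R X \<phi> = sq R X (Comp B R R2 X c \<rho>)" using \<theta>'\<theta>[OF R s] \<rho> \<theta>'k[OF R \<rho>(1)] by simp
    then show "\<exists>\<rho>\<in>Hom B R R2. st R X \<phi> (Comp B R R2 X c \<rho>)"
      using \<rho>(1) \<phi> syzygy_ob[OF R] ob X c(1) by (intro bexI[of _ \<rho>]) (simp_all add: stable_mor_eq_iff comp_closed)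
  next
    fix R \<rho> assume R: "R \<in> S" and \<rho>: "\<rho> \<in> Hom B R R2"
    note z = nat_transD(4)[OF \<theta>(1) R] nat_transD(4)[OF \<theta>(2) R]
    have "st R X (Comp B R R2 X c \<rho>) (hzero B R X) \<longleftrightarrow> sq R X (Comp B R R2 X c \<rho>) = hzero SC R X"
      using \<rho> syzygy_ob[OF R] ob X c(1) by (simp add: hzero_stable stable_mor_eq_iff comp_closed hzero_closed)
    also have "\<dots> \<longleftrightarrow> sq R A (Comp B R R2 A ?k \<rho>) = hzero SC R A"
      using \<theta>'k[OF R \<rho>] \<theta>\<theta>'[OF R kM[OF \<rho>]] z by (simp add: image_functor_simps hom_functor_simps) metis
    also have "\<dots> \<longleftrightarrow> (\<exists>\<sigma>\<in>Hom B R R1. st R R2 \<rho> (Comp B R R1 R2 f \<sigma>))"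
      using zero_iff[OF R \<rho>] ker[OF R \<rho>] by simp
    finally show "st R X (Comp B R R2 X c \<rho>) (hzero B R X) \<longleftrightarrow> (\<exists>\<sigma>\<in>Hom B R R1. st R R2 \<rho> (Comp B R R1 R2 f \<sigma>))" .
  qed
  then show ?thesis by blast
qed

section \<open>Translation of the two conditions and the equivalence\<close>

lemma Hom_syzygies_mor_zero_iff:
  assumes ob: "X \<in> Ob B" "Y \<in> Ob B" and h: "h \<in> Hom B X Y"
  shows "Hom_syzygies_mor_zero B T X Y h \<longleftrightarrow> stable_zero X Y h"
proof -
  have "Comp SC R X Y (sq X Y h) (sq R X \<phi>) = hzero SC R Y \<longleftrightarrow> st R Y (Comp B R X Y h \<phi>) (hzero B R Y)"
    if "R \<in> S" "\<phi> \<in> Hom B R X" for R \<phi>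
    using that syzygy_ob[OF that(1)] ob h by (simp add: Comp_stable hzero_stable stable_mor_eq_iff comp_closed hzero_closed)
  then show ?thesis unfolding Hom_syzygies_mor_zero_def stable_zero_def Hom_stable by simp
qed

lemma Hom_syzygies_ob_zero_iff:
  assumes X: "X \<in> Ob B"
  shows "Hom_syzygies_ob_zero B T X \<longleftrightarrow> (\<forall>R\<in>S. \<forall>\<phi>\<in>Hom B R X. st R X \<phi> (hzero B R X))"
proof -
  have "Hom SC R X = {hzero SC R X} \<longleftrightarrow> (\<forall>\<phi>\<in>Hom B R X. st R X \<phi> (hzero B R X))" if R: "R \<in> S" for R
  proof -
    note Ro = syzygy_ob[OF R]
    have "Hom SC R X = {hzero SC R X} \<longleftrightarrow> (\<forall>\<phi>\<in>Hom B R X. sq R X \<phi> = sq R X (hzero B R X))"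
      unfolding Hom_stable hzero_stable using hzero_closed[OF Ro X] by blast
    then show ?thesis using stable_mor_eq_iff[OF Ro X _ hzero_closed[OF Ro X]] by simp
  qed
  then show ?thesis by (simp add: Hom_syzygies_ob_zero_def)
qed

lemma right_minimal_iff:
  assumes ob: "X \<in> Ob B" "Y \<in> Ob B" and f: "f \<in> Hom B X Y"
  shows "right_minimal SC X Y (sq X Y f) \<longleftrightarrow> stably_right_minimal B X Y f"
proof -
  have 1: "Comp SC X X Y (sq X Y f) (sq X X r) = sq X Y f \<longleftrightarrow> st X Y (Comp B X X Y f r) f" if "r \<in> Hom B X X" for r
    using that ob f by (simp add: Comp_stable stable_mor_eq_iff comp_closed)
  have 2: "is_iso SC X X (sq X X r) \<longleftrightarrow> (\<exists>r'\<in>Hom B X X. st X X (Comp B X X X r r') (Ident B X) \<and>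
          st X X (Comp B X X X r' r) (Ident B X))" if r: "r \<in> Hom B X X" for r
  proof -
    have "Comp SC X X X (sq X X r') (sq X X r) = Ident SC X \<and> Comp SC X X X (sq X X r) (sq X X r') = Ident SC X
      \<longleftrightarrow> st X X (Comp B X X X r r') (Ident B X) \<and> st X X (Comp B X X X r' r) (Ident B X)"
      if "r' \<in> Hom B X X" for r'
      using that r ob by (simp add: Comp_stable Ident_stable stable_mor_eq_iff comp_closed ident_closed) blast
    then show ?thesis using r unfolding is_iso_def Hom_stable by auto
  qed
  show ?thesis unfolding right_minimal_def stably_right_minimal_def Hom_stable using 1 2 by simp
qed

lemma quotient_functor_iff:
  "quotient_functor B (mod_cat SS) (Hom_syzygies B T) \<longleftrightarrow>
    (\<forall>R1 R2 A P T1 T2 f g u p q v h t.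
       syzygy_diagram B T R1 R2 A P T1 T2 f g u p q v h t \<longrightarrow>
       sq R1 R2 f \<noteq> hzero SC R1 R2 \<longrightarrow>
       right_minimal SC R1 R2 (sq R1 R2 f) \<longrightarrow>
       Hom_syzygies_mor_zero B T A T1 h) \<and>
    (\<forall>A. indecomposable B A \<longrightarrow> \<not> Hom_syzygies_ob_zero B T A \<longrightarrow>
       (\<exists>R1 R2 P T1 T2 f g u p q v h t.
          syzygy_diagram B T R1 R2 A P T1 T2 f g u p q v h t \<and>
          Hom_syzygies_mor_zero B T A T1 h))"
  (is "?Q \<longleftrightarrow> ?a \<and> ?b")
proof (intro iffI conjI)
  assume Q: ?Q
  then have full: "X \<in> Ob B \<Longrightarrow> full_at X" for X
    using full_functor_iff by (simp add: quotient_functor_def)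
  have dense: "\<lbrakk>R1 \<in> S; R2 \<in> S; f \<in> Hom B R1 R2\<rbrakk> \<Longrightarrow> \<exists>X c. stable_coker R1 R2 X f c" for R1 R2 f
    using stable_coker_if_dense_functor Q by (simp add: quotient_functor_def)
  show ?a
  proof (intro allI impI)
    fix R1 R2 A P T1 T2 f g u p q v h t
    assume d: "syzygy_diagram B T R1 R2 A P T1 T2 f g u p q v h t"
      and m: "right_minimal SC R1 R2 (sq R1 R2 f)"
    note D = syzygy_diagramD[OF d]
    have "stably_right_minimal B R1 R2 f"
      using m right_minimal_iff[OF syzygy_ob[OF D(10)] syzygy_ob[OF D(11)] D(17)] by simp
    then show "Hom_syzygies_mor_zero B T A T1 h"
      using condition_a_if_full_dense[OF full dense d] Hom_syzygies_mor_zero_iff D by simp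
  qed
  show ?b
  proof (intro allI impI)
    fix A assume ind: "indecomposable B A" and nz: "\<not> Hom_syzygies_ob_zero B T A"
    have "A \<in> Ob B" using ind by (simp add: indecomposable_def)
    then obtain R1 R2 P T1 T2 f g u p q v h t where
      d: "syzygy_diagram B T R1 R2 A P T1 T2 f g u p q v h t" "stable_zero A T1 h"
      using condition_b_if_full[OF full ind] nz Hom_syzygies_ob_zero_iff by blast
    then have "Hom_syzygies_mor_zero B T A T1 h"
      using Hom_syzygies_mor_zero_iff syzygy_diagramD[OF d(1)] by simp
    then show "\<exists>R1 R2 P T1 T2 f g u p q v h t.
        syzygy_diagram B T R1 R2 A P T1 T2 f g u p q v h t \<and> Hom_syzygies_mor_zero B T A T1 h"
      using d(1) by blast
  qed
next
  assume ab: "?a \<and> ?b"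
  have "stable_zero A T1 h"
    if d: "syzygy_diagram B T R1 R2 A P T1 T2 f g u p q v h t" and nz: "\<not> st R1 R2 f (hzero B R1 R2)"
      and m: "stably_right_minimal B R1 R2 f" for R1 R2 A P T1 T2 f g u p q v h t
  proof -
    note D = syzygy_diagramD[OF d]
    note ob = syzygy_ob[OF D(10)] syzygy_ob[OF D(11)]
    have "sq R1 R2 f \<noteq> hzero SC R1 R2"
      using nz ob D(17) by (simp add: hzero_stable stable_mor_eq_iff hzero_closed)
    moreover have "right_minimal SC R1 R2 (sq R1 R2 f)" using m right_minimal_iff[OF ob D(17)] by simp
    ultimately have "Hom_syzygies_mor_zero B T A T1 h" using ab d by blast
    then show ?thesis using Hom_syzygies_mor_zero_iff D by simp
  qed
  then have dense: "dense_functor B (mod_cat SS) (Hom_syzygies B T)"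
    using dense_functor_if_stable_cokers[OF dense_if_condition_a] by blast
  have "full_at A" if ind: "indecomposable B A" for A
  proof (cases "Hom_syzygies_ob_zero B T A")
    case True
    have "A \<in> Ob B" using ind by (simp add: indecomposable_def)
    then show ?thesis using True full_at_if_Hom_zero Hom_syzygies_ob_zero_iff by blast
  next
    case False
    from conjunct2[OF ab, rule_format, OF ind this] obtain R1 R2 P T1 T2 f g u p q v h t where
      d: "syzygy_diagram B T R1 R2 A P T1 T2 f g u p q v h t" "Hom_syzygies_mor_zero B T A T1 h"
      by blast
    note D = syzygy_diagramD[OF d(1)]
    have "stable_zero A T1 h" using d(2) Hom_syzygies_mor_zero_iff D by simp
    then show ?thesis using full_at_if_stable_zero D by blast
  qed
  then have "full_functor B (mod_cat SS) (Hom_syzygies B T)"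
    using full_functor_iff full_at_if_indecomposables by blast
  then show ?Q using is_functor_Hom_syzygies dense by (simp add: quotient_functor_def)
qed

end

theorem theorem1p2:
  fixes K :: "('k, 'y) ring_scheme"
    and B :: "('o, 'm, 'e, 'k, 'z) lin_excat_scheme"
    and T :: "'o set"
  assumes "field K"
    and "extriangulated B"
    and "linear_over K B"
    and "hom_finite K B"
    and "krull_schmidt B"
    and "enough_projectives B"
    and "enough_injectives B"
    and "replete_subcat B T"
    and "contravariantly_finite B T"
    and "closed_under_sums B T"
    and "closed_under_summands B T"
    and "projectives B \<subseteq> T"
    and "Ext_vanishes B T (projectives B)"
  shows "quotient_functor B (mod_cat (stable_syzygies B T)) (Hom_syzygies B T) \<longleftrightarrow>
    (\<forall>R1 R2 A P T1 T2 f g u p q v h t.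
       syzygy_diagram B T R1 R2 A P T1 T2 f g u p q v h t \<longrightarrow>
       stable_mor B R1 R2 f \<noteq> hzero (stable_cat B) R1 R2 \<longrightarrow>
       right_minimal (stable_cat B) R1 R2 (stable_mor B R1 R2 f) \<longrightarrow>
       Hom_syzygies_mor_zero B T A T1 h) \<and>
    (\<forall>A. indecomposable B A \<longrightarrow> \<not> Hom_syzygies_ob_zero B T A \<longrightarrow>
       (\<exists>R1 R2 P T1 T2 f g u p q v h t.
          syzygy_diagram B T R1 R2 A P T1 T2 f g u p q v h t \<and>
          Hom_syzygies_mor_zero B T A T1 h))"
proof -
  interpret syzygy_setting B T
    using assms by (simp add: syzygy_setting_def syzygy_setting_axioms_def)
  show ?thesis by (rule quotient_functor_iff)
qed

end
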